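(* Let $M\subseteq\mathbb{R}^2$ be a compact smooth curve (without boundary). Then the residues at $s=1,-1,-3,-5$ of (the meromorphic continuation to $\mathbb{C}$ of) $B_{\bar{\bar M}}$ are $$\mathrm{Res}_{s=1}B_{\bar{\bar M}}=-2\,\mathrm{Length}(M),$$ $$\mathrm{Res}_{s=-1}B_{\bar{\bar M}}=\int_M\frac{3}{4}\kappa_0^2\,dA,$$ $$\mathrm{Res}_{s=-3}B_{\bar{\bar M}}=\int_M\left(\frac{45}{64}\kappa_0^4+\frac{5}{4}\kappa_1^2+\frac{15}{8}\kappa_0\kappa_2\right)dA,$$ $$\mathrm{Res}_{s=-5}B_{\bar{\bar M}}=\int_M\left(\frac{175}{512}\kappa_0^6+\frac{1295}{288}\kappa_0^2\kappa_1^2+\frac{1085}{576}\kappa_0^3\kappa_2+\frac{175}{576}\kappa_2^2+\frac{35}{72}\kappa_1\kappa_3+\frac{35}{144}\kappa_0\kappa_4\right)dA,$$ where $\kappa_0$ is the curvature of $M$ and $\kappa_n$ is the $n$-th derivative of $\kappa_0$ with respect to a unit speed parametrization.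
   Context: Let $dA$ be the arc-length measure on $M$ and $\nu$ the outward unit normal vector field of $M$. For $s\in\mathbb{C}$ write $N_s(u,v)=\|u-v\|^s$ for $u,v\in\mathbb{R}^2$ (Euclidean norm). The Brylinski beta function of a double layer on $M$ is defined for $\mathrm{Re}\, s>2$ by $$B_{\bar{\bar M}}(s)=\int_M\int_M \partial_{\nu_u}\partial_{\nu_v}N_s(u,v)\,dA(v)\,dA(u),$$ where $\partial_{\nu_u}$ (resp. $\partial_{\nu_v}$) denotes the directional derivative in the first variable $u$ (resp. the second variable $v$) in the direction of the unit normal $\nu_u$ to $M$ at $u$ (resp. $\nu_v$ to $M$ at $v$). This function is holomorphic on $\mathrm{Re}\, s>2$ and continues analytically to a meromorphic function on $\mathbb{C}$, holomorphic away from $s=1,-1,-3,-5,\dots$, where it has at most simple poles; $B_{\bar{\bar M}}$ also denotes this continuation. The curvature $\kappa_0$ is the signed curvature, i.e. the single component of the second fundamental form of $M$ in a unit speed parametrization. *)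

theory Defs
  imports "HOL-Complex_Analysis.Complex_Analysis"
begin

definition nth_vector_deriv :: "nat \<Rightarrow> (real \<Rightarrow> 'a::real_normed_vector) \<Rightarrow> real \<Rightarrow> 'a" where
  "nth_vector_deriv n f = ((\<lambda>g t. vector_derivative g (at t)) ^^ n) f"

definition smooth_on :: "real set \<Rightarrow> (real \<Rightarrow> 'a::real_normed_vector) \<Rightarrow> bool" where
  "smooth_on I f \<longleftrightarrow> (\<forall>n. \<forall>t\<in>I. nth_vector_deriv n f differentiable (at t))"

text \<open>A smooth regular parametrization of a relatively open piece of \<open>M\<close> which is a homeomorphism
  onto that piece. Together with \<open>compact_smooth_curve\<close> this is the usual notion of an embedded
  one-dimensional submanifold without boundary; \<open>M\<close> need not be connected.\<close>

definition regular_param :: "(real^2) set \<Rightarrow> real set \<Rightarrow> (real \<Rightarrow> real^2) \<Rightarrow> bool" where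
  "regular_param M I \<gamma> \<longleftrightarrow>
     open I \<and> connected I \<and> smooth_on I \<gamma> \<and>
     (\<forall>t\<in>I. vector_derivative \<gamma> (at t) \<noteq> 0) \<and>
     openin (top_of_set M) (\<gamma> ` I) \<and>
     (\<exists>g. homeomorphism I (\<gamma> ` I) \<gamma> g)"

definition unit_speed_param :: "(real^2) set \<Rightarrow> real set \<Rightarrow> (real \<Rightarrow> real^2) \<Rightarrow> bool" where
  "unit_speed_param M I \<gamma> \<longleftrightarrow>
     regular_param M I \<gamma> \<and> (\<forall>t\<in>I. norm (vector_derivative \<gamma> (at t)) = 1)"

definition compact_smooth_curve :: "(real^2) set \<Rightarrow> bool" where
  "compact_smooth_curve M \<longleftrightarrow>
     compact M \<and> M \<noteq> {} \<and> (\<forall>p\<in>M. \<exists>I \<gamma>. regular_param M I \<gamma> \<and> p \<in> \<gamma> ` I)"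

text \<open>The arc-length measure on the Borel sets of \<open>M\<close>, characterized by \<open>dA = |\<gamma>'(t)| dt\<close> in every
  local parametrization.\<close>

definition arclength_measure :: "(real^2) set \<Rightarrow> (real^2) measure \<Rightarrow> bool" where
  "arclength_measure M A \<longleftrightarrow>
     space A = M \<and> sets A = sets (restrict_space borel M) \<and>
     (\<forall>I \<gamma> E. regular_param M I \<gamma> \<and> E \<in> sets borel \<and> E \<subseteq> I \<longrightarrow>
        emeasure A (\<gamma> ` E) =
          (\<integral>\<^sup>+ t\<in>E. ennreal (norm (vector_derivative \<gamma> (at t))) \<partial>lborel))"

text \<open>\<open>M\<close> is the boundary of a bounded open set \<open>\<Omega>\<close>, uniquely determined by the requirement that the
  two sides of \<open>M\<close> lie in \<open>\<Omega>\<close> and outside its closure, respectively (the inside of \<open>M\<close> if \<open>M\<close> is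
  connected). The unit normal field \<open>\<nu>\<close> points out of \<open>\<Omega>\<close>.\<close>

definition outward_unit_normal :: "(real^2) set \<Rightarrow> (real^2 \<Rightarrow> real^2) \<Rightarrow> bool" where
  "outward_unit_normal M \<nu> \<longleftrightarrow>
     continuous_on M \<nu> \<and>
     (\<forall>p\<in>M. norm (\<nu> p) = 1) \<and>
     (\<forall>I \<gamma>. regular_param M I \<gamma> \<longrightarrow> (\<forall>t\<in>I. \<nu> (\<gamma> t) \<bullet> vector_derivative \<gamma> (at t) = 0)) \<and>
     (\<exists>\<Omega>. open \<Omega> \<and> bounded \<Omega> \<and> frontier \<Omega> = M \<and>
        (\<forall>p\<in>M. \<forall>\<^sub>F h in at_right 0. p - h *\<^sub>R \<nu> p \<in> \<Omega> \<and> p + h *\<^sub>R \<nu> p \<notin> closure \<Omega>))"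

definition dir_deriv :: "(real^2 \<Rightarrow> complex) \<Rightarrow> real^2 \<Rightarrow> real^2 \<Rightarrow> complex" where
  "dir_deriv f p w = vector_derivative (\<lambda>h. f (p + h *\<^sub>R w)) (at 0)"

definition N_pow :: "complex \<Rightarrow> real^2 \<Rightarrow> real^2 \<Rightarrow> complex" where
  "N_pow s u v = complex_of_real (norm (u - v)) powr s"

definition double_layer_kernel ::
  "(real^2 \<Rightarrow> real^2) \<Rightarrow> complex \<Rightarrow> real^2 \<Rightarrow> real^2 \<Rightarrow> complex" where
  "double_layer_kernel \<nu> s u v =
     dir_deriv (\<lambda>u'. dir_deriv (\<lambda>v'. N_pow s u' v') v (\<nu> v)) u (\<nu> u)"

definition double_layer_integral ::
  "(real^2) measure \<Rightarrow> (real^2 \<Rightarrow> real^2) \<Rightarrow> complex \<Rightarrow> complex" where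
  "double_layer_integral A \<nu> s = (LINT u|A. LINT v|A. double_layer_kernel \<nu> s u v)"

text \<open>The continuation is unique up to its values on a sparse set, in particular its residues are
  uniquely determined.\<close>

definition double_layer_beta ::
  "(real^2) measure \<Rightarrow> (real^2 \<Rightarrow> real^2) \<Rightarrow> (complex \<Rightarrow> complex) \<Rightarrow> bool" where
  "double_layer_beta A \<nu> B \<longleftrightarrow>
     B meromorphic_on UNIV \<and> (\<forall>s. Re s > 2 \<longrightarrow> B s = double_layer_integral A \<nu> s)"

text \<open>A unit speed parametrization passing through \<open>p\<close> at parameter \<open>0\<close>. It is determined only up to
  reversal of direction (near \<open>0\<close>). For a given \<open>p\<close> the same parametrization is used for all
  \<open>\<kappa> n\<close>; reversal of direction multiplies \<open>\<kappa> n\<close> by \<open>(-1)^n\<close>, so expressions in which the total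
  order of differentiation is even do not depend on the choice.\<close>

definition unit_speed_at :: "(real^2) set \<Rightarrow> real^2 \<Rightarrow> real \<Rightarrow> real^2" where
  "unit_speed_at M p = (SOME \<gamma>. \<exists>I. unit_speed_param M I \<gamma> \<and> 0 \<in> I \<and> \<gamma> 0 = p)"

text \<open>The component of the second fundamental form with respect to the normal field \<open>\<nu>\<close>
  in the parametrization \<open>\<gamma>\<close>.\<close>

definition second_fundamental_form ::
  "(real^2 \<Rightarrow> real^2) \<Rightarrow> (real \<Rightarrow> real^2) \<Rightarrow> real \<Rightarrow> real" where
  "second_fundamental_form \<nu> \<gamma> t = nth_vector_deriv 2 \<gamma> t \<bullet> \<nu> (\<gamma> t)"

definition curvature_deriv ::
  "(real^2) set \<Rightarrow> (real^2 \<Rightarrow> real^2) \<Rightarrow> nat \<Rightarrow> real^2 \<Rightarrow> real" where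
  "curvature_deriv M \<nu> n p =
     nth_vector_deriv n (second_fundamental_form \<nu> (unit_speed_at M p)) 0"

end

theory Submission
  imports Defs
begin

text \<open>For \<open>u \<noteq> v\<close> on the curve the kernel is smooth in \<open>u, v\<close> and entire in \<open>s\<close>, so pairs of points at a
distance bounded away from \<open>0\<close> contribute an entire function. All poles come from a neighbourhood of the
diagonal, where the kernel can be written down in a unit speed chart \<open>\<gamma>\<close>. With \<open>u = \<gamma> t\<close>,
\<open>v = \<gamma> (t + h)\<close> and the frame \<open>T, N\<close> at \<open>t\<close>, put \<open>\<gamma> (t + h) - \<gamma> t = h \<xi> T + h \<eta> N\<close> and
\<open>g = \<xi>\<^sup>2 + \<eta>\<^sup>2\<close>, so that the distance is \<open>\<bar>h\<bar> g\<^sup>1\<^sup>/\<^sup>2\<close> with \<open>g \<rightarrow> 1\<close> as \<open>h \<rightarrow> 0\<close>. The kernel becomes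
\<open>\<bar>h\<bar> powr (s - 2) * \<Phi> s t h\<close>, where \<open>\<Phi>\<close> is a polynomial in \<open>s, \<xi>, \<eta>\<close>, the coordinates of
\<open>T (t + h)\<close>, and complex powers of \<open>g\<close> (lemma \<open>kernel_chart\<close>).

Expanding \<open>\<Phi>\<close> in powers of \<open>h\<close> gives coefficients \<open>c\<^sub>k(s,t)\<close>, entire in \<open>s\<close>, and a remainder
\<open>O(h\<^sup>8)\<close> that is uniform in \<open>t\<close> and locally uniform in \<open>s\<close> (\<open>expands_\<Phi>\<close>). The integral of
\<open>\<bar>h\<bar> powr (s - 2) * h ^ k\<close> over \<open>(-\<epsilon>, \<epsilon>)\<close> vanishes for odd \<open>k\<close> and equals
\<open>2 \<epsilon> powr (s - 1 + k) / (s - 1 + k)\<close> for even \<open>k\<close>, and the remainder contributes a holomorphic function on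
\<open>Re s > -6\<close>. So the continuation has at \<open>1 - k\<close>, \<open>k = 0, 2, 4, 6\<close>, at most a simple pole with residue
\<open>2 \<integral> c\<^sub>k(1 - k, t) dt\<close>.

By the Frenet equations the Taylor coefficients of \<open>\<xi>, \<eta>\<close> are polynomials in the curvature and its
derivatives, and \<open>2 c\<^sub>k(1 - k, t)\<close> is a finite computation with power series truncated at order \<open>6\<close>. It gives
the integrands of the theorem pointwise, without any integration by parts (\<open>frenet_series\<close>).

What remains is bookkeeping. Every point of the curve has a unit speed chart, and two such charts differ locally by a
shift and possibly a reversal (\<open>unit_speed_transition\<close>); a reversal multiplies the \<open>n\<close>-th derivative of the
curvature by \<open>(-1) ^ n\<close>, and every monomial that occurs has even total order. Likewise the normal enters
the kernel near the diagonal twice, so its sign cancels there. Finitely many compact arcs cover the curve, and the decomposition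
into a holomorphic function plus poles is additive over disjoint Borel pieces. Finally the identity theorem carries
the residues over to the given meromorphic function (\<open>residue_of_continuation\<close>).\<close>

section \<open>Finite-order differentiability and smoothness on an open set\<close>

lemma nth_vector_deriv_0 [simp]: "nth_vector_deriv 0 f = f"
  by (simp add: nth_vector_deriv_def)

lemma nth_vector_deriv_Suc:
  "nth_vector_deriv (Suc n) f = (\<lambda>t. vector_derivative (nth_vector_deriv n f) (at t))"
  by (simp add: nth_vector_deriv_def)

lemma nth_vector_deriv_Suc':
  "nth_vector_deriv (Suc n) f = nth_vector_deriv n (\<lambda>t. vector_derivative f (at t))"
  by (simp add: nth_vector_deriv_def funpow_swap1 del: funpow.simps) (simp add: funpow_Suc_right del: funpow.simps)

lemma vector_derivative_cong_open:
  assumes "open I" "t \<in> I" "\<And>t. t \<in> I \<Longrightarrow> f t = g t"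
  shows "vector_derivative f (at t) = vector_derivative g (at t)"
proof (rule vector_derivative_cong_eq)
  show "\<forall>\<^sub>F x in nhds t. x \<in> UNIV \<longrightarrow> f x = g x"
    using assms by (auto simp: eventually_nhds)
qed (use assms in auto)

lemma nth_vector_deriv_cong:
  assumes "open I" "t \<in> I" "\<And>t. t \<in> I \<Longrightarrow> f t = g t"
  shows "nth_vector_deriv n f t = nth_vector_deriv n g t"
  using assms(2,3)
proof (induction n arbitrary: f g t)
  case (Suc n)
  show ?case
    unfolding nth_vector_deriv_Suc'
    by (rule Suc.IH) (use Suc.prems assms(1) in \<open>auto intro: vector_derivative_cong_open\<close>)
qed auto

text \<open>Iterated differentiability with existentially chosen derivatives. Unlike \<open>smooth_on\<close>, which refers to one
particular derivative function, this predicate lets closure under products, composition and powers be proved by induction on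
the order.\<close>

primrec nth_diff_on :: "nat \<Rightarrow> real set \<Rightarrow> (real \<Rightarrow> 'a::real_normed_vector) \<Rightarrow> bool" where
  "nth_diff_on 0 I f \<longleftrightarrow> True"
| "nth_diff_on (Suc n) I f \<longleftrightarrow>
     (\<exists>f'. (\<forall>t\<in>I. (f has_vector_derivative f' t) (at t)) \<and> nth_diff_on n I f')"

lemma nth_diff_on_SucE:
  assumes "nth_diff_on (Suc n) I f"
  obtains f' where "\<And>t. t \<in> I \<Longrightarrow> (f has_vector_derivative f' t) (at t)" "nth_diff_on n I f'"
  using assms by auto

lemma nth_diff_on_SucD: "nth_diff_on (Suc n) I f \<Longrightarrow> nth_diff_on n I f"
  by (induction n arbitrary: f) fastforce+

lemma nth_diff_on_cong:
  assumes "open I" "\<And>t. t \<in> I \<Longrightarrow> f t = g t" "nth_diff_on n I f"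
  shows "nth_diff_on n I g"
proof (cases n)
  case (Suc m)
  then obtain f' where f': "\<And>t. t \<in> I \<Longrightarrow> (f has_vector_derivative f' t) (at t)" "nth_diff_on m I f'"
    using assms by auto
  have "(g has_vector_derivative f' t) (at t)" if "t \<in> I" for t
    using has_vector_derivative_transform_within_open[OF f'(1)[OF that] assms(1) that] assms(2) by auto
  with f' Suc show ?thesis by auto
qed auto

lemma smooth_on_iff:
  assumes "open I"
  shows "smooth_on I f \<longleftrightarrow> (\<forall>n. nth_diff_on n I f)"
proof safe
  fix n
  show "nth_diff_on n I f" if "smooth_on I f"
    using that
  proof (induction n arbitrary: f)
    case (Suc n)
    have "f differentiable (at t)" if "t \<in> I" for t
      using Suc.prems that unfolding smooth_on_def
      by (metis nth_vector_deriv_0)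
    moreover have "smooth_on I (\<lambda>t. vector_derivative f (at t))"
      using Suc.prems unfolding smooth_on_def by (metis nth_vector_deriv_Suc')
    ultimately show ?case using Suc.IH
      by (auto simp: vector_derivative_works intro!: exI[of _ "\<lambda>t. vector_derivative f (at t)"])
  qed auto
next
  assume *: "\<forall>n. nth_diff_on n I f"
  have "nth_vector_deriv n f differentiable (at t)" if "nth_diff_on (Suc n) I f" "t \<in> I" for n t
    using that
  proof (induction n arbitrary: f t)
    case 0
    then show ?case by (auto intro: differentiableI_vector)
  next
    case (Suc n)
    obtain f' where f': "\<And>t. t \<in> I \<Longrightarrow> (f has_vector_derivative f' t) (at t)" "nth_diff_on (Suc n) I f'"
      by (rule nth_diff_on_SucE[OF Suc.prems(1)]) blast
    have "nth_diff_on (Suc n) I (\<lambda>t. vector_derivative f (at t))"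
      by (rule nth_diff_on_cong[OF assms _ f'(2)]) (metis f'(1) vector_derivative_at)
    from Suc.IH[OF this] Suc.prems show ?case by (simp add: nth_vector_deriv_Suc')
  qed
  with * show "smooth_on I f" unfolding smooth_on_def by blast
qed

lemma nth_diff_on_const: "nth_diff_on n I (\<lambda>_. c)"
proof (induction n arbitrary: c)
  case (Suc n)
  then show ?case by (auto intro!: exI[of _ "\<lambda>_. 0"] derivative_intros)
qed auto

lemma nth_diff_on_add:
  "nth_diff_on n I f \<Longrightarrow> nth_diff_on n I g \<Longrightarrow> nth_diff_on n I (\<lambda>t. f t + g t)"
proof (induction n arbitrary: f g)
  case (Suc n)
  obtain f' where f': "\<And>t. t \<in> I \<Longrightarrow> (f has_vector_derivative f' t) (at t)" "nth_diff_on n I f'"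
    by (rule nth_diff_on_SucE[OF Suc.prems(1)]) blast
  obtain g' where g': "\<And>t. t \<in> I \<Longrightarrow> (g has_vector_derivative g' t) (at t)" "nth_diff_on n I g'"
    by (rule nth_diff_on_SucE[OF Suc.prems(2)]) blast
  from f' g' Suc.IH[of f' g'] show ?case
    by (auto intro!: exI[of _ "\<lambda>t. f' t + g' t"] has_vector_derivative_add)
qed auto

lemma nth_diff_on_bilinear:
  assumes "bounded_bilinear p"
  shows "nth_diff_on n I f \<Longrightarrow> nth_diff_on n I g \<Longrightarrow> nth_diff_on n I (\<lambda>t. p (f t) (g t))"
proof (induction n arbitrary: f g)
  case (Suc n)
  obtain f' where f': "\<And>t. t \<in> I \<Longrightarrow> (f has_vector_derivative f' t) (at t)" "nth_diff_on n I f'"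
    by (rule nth_diff_on_SucE[OF Suc.prems(1)]) blast
  obtain g' where g': "\<And>t. t \<in> I \<Longrightarrow> (g has_vector_derivative g' t) (at t)" "nth_diff_on n I g'"
    by (rule nth_diff_on_SucE[OF Suc.prems(2)]) blast
  have "nth_diff_on n I (\<lambda>t. p (f t) (g' t) + p (f' t) (g t))"
    by (intro nth_diff_on_add Suc.IH f' g' nth_diff_on_SucD[OF Suc.prems(1)] nth_diff_on_SucD[OF Suc.prems(2)])
  with f' g' show ?case
    by (auto intro!: exI[of _ "\<lambda>t. p (f t) (g' t) + p (f' t) (g t)"]
        bounded_bilinear.has_vector_derivative[OF assms])
qed auto

text \<open>The inverse \<open>\<phi>\<close> of an arc length function solves an autonomous equation \<open>\<phi>' = r \<circ> \<phi>\<close>. Each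
differentiation of \<open>f \<circ> \<phi>\<close> replaces \<open>f\<close> by \<open>r * f'\<close> and leaves \<open>\<phi>\<close> alone, so the induction runs over \<open>f\<close>.\<close>

lemma nth_diff_on_compose_autonomous:
  assumes "\<And>n. nth_diff_on n I r" "\<And>s. s \<in> J \<Longrightarrow> \<phi> s \<in> I"
    and "\<And>s. s \<in> J \<Longrightarrow> (\<phi> has_real_derivative r (\<phi> s)) (at s)"
  shows "nth_diff_on n I f \<Longrightarrow> nth_diff_on n J (\<lambda>s. f (\<phi> s))"
proof (induction n arbitrary: f)
  case (Suc n)
  then obtain f' where 1: "\<And>t. t \<in> I \<Longrightarrow> (f has_vector_derivative f' t) (at t)" "nth_diff_on n I f'"
    by auto
  have "nth_diff_on n J (\<lambda>s. r (\<phi> s) *\<^sub>R f' (\<phi> s))"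
    by (rule Suc.IH[of "\<lambda>t. r t *\<^sub>R f' t"])
      (intro nth_diff_on_bilinear[OF bounded_bilinear_scaleR] 1 assms(1))
  moreover have "((\<lambda>s. f (\<phi> s)) has_vector_derivative r (\<phi> s) *\<^sub>R f' (\<phi> s)) (at s)" if "s \<in> J" for s
    using vector_diff_chain_at[of \<phi> "r (\<phi> s)" s f "f' (\<phi> s)"] assms(2,3) that 1(1)
    by (auto simp: o_def has_real_derivative_iff_has_vector_derivative)
  ultimately show ?case by (auto intro!: exI[of _ "\<lambda>s. r (\<phi> s) *\<^sub>R f' (\<phi> s)"])
qed auto

text \<open>The factor \<open>p\<close> makes the induction go through: \<open>(p u\<^sup>a)' = (p' u + a p u') u\<^sup>a\<^sup>-\<^sup>1\<close> has the same shape.\<close>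

lemma nth_diff_on_powr:
  fixes u p :: "real \<Rightarrow> real"
  assumes "\<And>n. nth_diff_on n I u" "\<And>t. t \<in> I \<Longrightarrow> u t > 0"
  shows "nth_diff_on n I p \<Longrightarrow> nth_diff_on n I (\<lambda>t. p t * u t powr a)"
proof (induction n arbitrary: p a)
  case (Suc n)
  from assms(1)[of "Suc n"] obtain u' where u': "\<And>t. t \<in> I \<Longrightarrow> (u has_real_derivative u' t) (at t)" "nth_diff_on n I u'"
    by (auto simp: has_real_derivative_iff_has_vector_derivative)
  from Suc.prems obtain p' where p': "\<And>t. t \<in> I \<Longrightarrow> (p has_real_derivative p' t) (at t)" "nth_diff_on n I p'"
    by (auto simp: has_real_derivative_iff_has_vector_derivative)
  let ?q = "\<lambda>t. p' t * u t + (a * p t) * u' t"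
  have "nth_diff_on n I ?q"
    by (intro nth_diff_on_add nth_diff_on_bilinear[OF bounded_bilinear_mult] nth_diff_on_const
        u' p' assms nth_diff_on_SucD[OF Suc.prems])
  from Suc.IH[OF this, of "a - 1"] have 1: "nth_diff_on n I (\<lambda>t. ?q t * u t powr (a - 1))" .
  have "((\<lambda>t. p t * u t powr a) has_real_derivative ?q t * u t powr (a - 1)) (at t)" if "t \<in> I" for t
  proof -
    have "u t > 0" using assms that by auto
    have "((\<lambda>t. p t * u t powr a) has_real_derivative
        p t * (a * u t powr (a - 1) * u' t) + p' t * u t powr a) (at t)"
      by (rule DERIV_mult'[OF p'(1)[OF that] DERIV_fun_powr[OF u'(1)[OF that] \<open>u t > 0\<close>, simplified]])
    moreover have "u t powr a = u t * u t powr (a - 1)"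
      using \<open>u t > 0\<close> by (simp add: powr_diff)
    ultimately show ?thesis by (simp add: algebra_simps)
  qed
  with 1 show ?case
    by (auto simp: has_real_derivative_iff_has_vector_derivative
        intro!: exI[of _ "\<lambda>t. ?q t * u t powr (a - 1)"])
qed auto

lemma has_vector_derivative_nth:
  assumes "smooth_on I f" "t \<in> I"
  shows "(nth_vector_deriv n f has_vector_derivative nth_vector_deriv (Suc n) f t) (at t)"
  using assms unfolding smooth_on_def nth_vector_deriv_Suc
  by (simp add: vector_derivative_works)

lemma smooth_on_subset: "smooth_on I f \<Longrightarrow> J \<subseteq> I \<Longrightarrow> smooth_on J f"
  by (auto simp: smooth_on_def)

lemma smooth_on_nth: "smooth_on I f \<Longrightarrow> smooth_on I (nth_vector_deriv n f)"
proof (induction n)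
  case (Suc n)
  have "nth_vector_deriv m (nth_vector_deriv (Suc n) f) = nth_vector_deriv (Suc m) (nth_vector_deriv n f)" for m
    by (simp add: nth_vector_deriv_Suc' [of m] nth_vector_deriv_Suc[of n])
  with Suc show ?case unfolding smooth_on_def by metis
qed auto

lemma smooth_on_bilinear:
  assumes "bounded_bilinear p" "open I" "smooth_on I f" "smooth_on I g"
  shows "smooth_on I (\<lambda>t. p (f t) (g t))"
  using assms nth_diff_on_bilinear[OF assms(1)] by (auto simp: smooth_on_iff)

lemma smooth_on_cong:
  assumes "open I" "\<And>t. t \<in> I \<Longrightarrow> f t = g t" "smooth_on I f"
  shows "smooth_on I g"
  using assms(3) nth_diff_on_cong[OF assms(1,2)] by (auto simp: smooth_on_iff[OF assms(1)])

lemma continuous_on_nth_vector_deriv: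
  assumes "smooth_on I f"
  shows "continuous_on I (nth_vector_deriv n f)"
  using has_vector_derivative_nth[OF assms]
  by (meson continuous_at_imp_continuous_on has_vector_derivative_continuous)

text \<open>Used with \<open>\<sigma> = 1\<close> or \<open>\<sigma> = -1\<close>, the two ways in which unit speed parametrizations can differ.\<close>

lemma nth_vector_deriv_affine:
  fixes f :: "real \<Rightarrow> 'a::real_normed_vector"
  assumes "smooth_on I f" "open J" "\<And>s. s \<in> J \<Longrightarrow> c + \<sigma> * s \<in> I" "s \<in> J"
  shows "nth_vector_deriv n (\<lambda>s. f (c + \<sigma> * s)) s = \<sigma> ^ n *\<^sub>R nth_vector_deriv n f (c + \<sigma> * s)"
  using assms(4)
proof (induction n arbitrary: s)
  case (Suc n)
  have aff: "((\<lambda>s. c + \<sigma> * s) has_vector_derivative \<sigma>) (at s)"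
    by (auto intro!: derivative_eq_intros simp: has_real_derivative_iff_has_vector_derivative[symmetric])
  have "(nth_vector_deriv n f has_vector_derivative nth_vector_deriv (Suc n) f (c + \<sigma> * s)) (at (c + \<sigma> * s))"
    by (intro has_vector_derivative_nth[OF assms(1)] assms Suc.prems)
  from vector_diff_chain_at[OF aff this]
  have "((\<lambda>s. nth_vector_deriv n f (c + \<sigma> * s)) has_vector_derivative
        \<sigma> *\<^sub>R nth_vector_deriv (Suc n) f (c + \<sigma> * s)) (at s)"
    by (simp add: o_def)
  from bounded_linear.has_vector_derivative[OF bounded_linear_scaleR_right this]
  have 1: "((\<lambda>s. \<sigma> ^ n *\<^sub>R nth_vector_deriv n f (c + \<sigma> * s)) has_vector_derivative
        \<sigma> ^ n *\<^sub>R (\<sigma> *\<^sub>R nth_vector_deriv (Suc n) f (c + \<sigma> * s))) (at s)" .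
  have "nth_vector_deriv (Suc n) (\<lambda>s. f (c + \<sigma> * s)) s =
      vector_derivative (\<lambda>s. \<sigma> ^ n *\<^sub>R nth_vector_deriv n f (c + \<sigma> * s)) (at s)"
    unfolding nth_vector_deriv_Suc[of n "(\<lambda>s. f (c + \<sigma> * s))"]
    by (rule vector_derivative_cong_open[OF assms(2)]) (use Suc in auto)
  also have "\<dots> = \<sigma> ^ n *\<^sub>R (\<sigma> *\<^sub>R nth_vector_deriv (Suc n) f (c + \<sigma> * s))"
    using 1 by (rule vector_derivative_at)
  finally show ?case by (simp add: mult.commute)
qed auto

section \<open>Unit speed parametrizations\<close>

lemma regular_param_subset:
  assumes "regular_param M I \<gamma>" "J \<subseteq> I" "open J" "connected J"
  shows "regular_param M J \<gamma>"
proof -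
  from assms obtain g where g: "homeomorphism I (\<gamma> ` I) \<gamma> g"
    by (auto simp: regular_param_def)
  have "homeomorphism J (\<gamma> ` J) \<gamma> g"
    by (rule homeomorphism_of_subsets[OF g assms(2), of "\<gamma> ` J"]) (use assms(2) in auto)
  moreover have "openin (top_of_set (\<gamma> ` I)) (\<gamma> ` J)"
    by (rule homeomorphism_imp_open_map[OF g]) (use assms in \<open>auto intro: open_subset\<close>)
  hence "openin (top_of_set M) (\<gamma> ` J)"
    using assms(1) unfolding regular_param_def by (metis openin_trans)
  ultimately show ?thesis
    using assms smooth_on_subset[of I \<gamma> J] unfolding regular_param_def by blast
qed

text \<open>Locally the arc length \<open>L\<close> is a strictly increasing primitive of the speed; \<open>\<gamma>\<close> composed with the inverse of \<open>L\<close>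
has unit speed.\<close>

lemma regular_param_imp_unit_speed_param:
  assumes reg: "regular_param M I \<gamma>" and t0: "t0 \<in> I"
  obtains J \<delta> where "unit_speed_param M J \<delta>" "0 \<in> J" "\<delta> 0 = \<gamma> t0"
proof -
  define \<gamma>1 where "\<gamma>1 = (\<lambda>t. vector_derivative \<gamma> (at t))"
  from reg have I: "open I" "smooth_on I \<gamma>" "\<And>t. t \<in> I \<Longrightarrow> \<gamma>1 t \<noteq> 0"
    by (auto simp: regular_param_def \<gamma>1_def)
  have \<gamma>1_nth: "\<gamma>1 = nth_vector_deriv (Suc 0) \<gamma>" by (simp add: \<gamma>1_def nth_vector_deriv_Suc)
  have sm1: "smooth_on I \<gamma>1" unfolding \<gamma>1_nth by (rule smooth_on_nth[OF I(2)])
  have \<gamma>_deriv: "(\<gamma> has_vector_derivative \<gamma>1 t) (at t)" if "t \<in> I" for t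
    using has_vector_derivative_nth[OF I(2) that, of 0] by (simp add: \<gamma>1_nth)
  obtain e where e: "e > 0" "cball t0 e \<subseteq> I" using I(1) t0 open_contains_cball by blast
  define B where "B = ball t0 e"
  have B: "open B" "connected B" "B \<subseteq> I" "t0 \<in> B" "B \<subseteq> {t0-e..t0+e}" "{t0-e..t0+e} \<subseteq> I"
    using e ball_subset_cball[of t0 e] by (auto simp: B_def cball_eq_atLeastAtMost dist_real_def)
  define v where "v = (\<lambda>t. norm (\<gamma>1 t))"
  define u where "u = (\<lambda>t. \<gamma>1 t \<bullet> \<gamma>1 t)"
  define r where "r = (\<lambda>t. 1 * u t powr (- (1/2)))"
  have vpos: "v t > 0" "u t > 0" if "t \<in> I" for t using I(3)[OF that] by (auto simp: v_def u_def)
  have r_eq: "r t = inverse (v t)" if "t \<in> I" for t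
    using vpos[OF that] by (simp add: r_def v_def u_def powr_minus powr_half_sqrt norm_eq_sqrt_inner)
  have "smooth_on I u" unfolding u_def
    by (rule smooth_on_bilinear[OF bounded_bilinear_inner I(1) sm1 sm1])
  hence r_smooth: "nth_diff_on n I r" for n
    unfolding r_def
    by (intro nth_diff_on_powr nth_diff_on_const) (auto simp: smooth_on_iff[OF I(1)] vpos)
  have cont_v: "continuous_on {t0-e..t0+e} v"
    unfolding v_def \<gamma>1_nth
    by (intro continuous_intros continuous_on_subset[OF continuous_on_nth_vector_deriv[OF I(2)]] B)
  define L where "L = (\<lambda>t. integral {t0-e..t} v - integral {t0-e..t0} v)"
  have L_deriv: "(L has_real_derivative v t) (at t)" if "t \<in> B" for t
  proof -
    have t: "t \<in> {t0-e<..<t0+e}" using that by (auto simp: B_def dist_real_def)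
    have "((\<lambda>x. integral {t0-e..x} v) has_real_derivative v t) (at t within {t0-e..t0+e})"
      by (rule integral_has_real_derivative[OF cont_v]) (use t in auto)
    moreover have "at t within {t0-e..t0+e} = at t"
      using t by (intro at_within_interior) auto
    ultimately show ?thesis unfolding L_def by (auto intro!: derivative_eq_intros)
  qed
  have L_cont: "continuous_on B L"
    using L_deriv by (meson DERIV_isCont continuous_at_imp_continuous_on)
  have L_less: "L a < L b" if "a \<in> B" "b \<in> B" "a < b" for a b
  proof (rule DERIV_pos_imp_increasing[OF that(3)])
    fix x assume "a \<le> x" "x \<le> b"
    hence "x \<in> B" using that by (auto simp: B_def dist_real_def)
    thus "\<exists>y. (L has_real_derivative y) (at x) \<and> 0 < y"
      using L_deriv vpos B by blast
  qed
  hence L_inj: "inj_on L B" by (metis inj_onI less_irrefl linorder_neqE_linordered_idom)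
  obtain \<phi> where \<phi>: "homeomorphism B (L ` B) L \<phi>"
    using invariance_of_domain_homeomorphism[OF B(1) L_cont _ L_inj] by auto
  define J where "J = L ` B"
  have J: "open J" "connected J" "0 \<in> J"
    using injective_into_1d_imp_open_map_UNIV[OF B(1) L_cont L_inj] connected_continuous_image[OF L_cont B(2)] B(4)
    by (auto simp: J_def L_def)
  have \<phi>B: "\<phi> s \<in> B" "L (\<phi> s) = s" if "s \<in> J" for s
    using \<phi> that by (auto simp: homeomorphism_def J_def)
  have "L t0 = 0" by (simp add: L_def)
  hence \<phi>0: "\<phi> 0 = t0"
    using inj_onD[OF L_inj _ \<phi>B(1)[OF J(3)] B(4)] \<phi>B(2)[OF J(3)] by metis
  have \<phi>_deriv: "(\<phi> has_real_derivative r (\<phi> s)) (at s)" if s: "s \<in> J" for s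
  proof -
    obtain d where d: "d > 0" "ball s d \<subseteq> J" using openE[OF J(1) s] by metis
    have "(\<phi> has_real_derivative inverse (v (\<phi> s))) (at s)"
    proof (rule DERIV_inverse_function[where f=L and a="s-d" and b="s+d"])
      show "(L has_real_derivative v (\<phi> s)) (at (\<phi> s))" using \<phi>B that L_deriv by auto
      show "v (\<phi> s) \<noteq> 0" using vpos(1)[of "\<phi> s"] \<phi>B(1)[OF that] B(3) by auto
      show "L (\<phi> y) = y" if "s - d < y" "y < s + d" for y
        using that d by (intro \<phi>B) (auto simp: dist_real_def subset_eq)
      show "isCont \<phi> s"
        using \<phi> that J(1) by (auto simp: homeomorphism_def J_def continuous_on_eq_continuous_at)
    qed (use d in auto)
    thus ?thesis using r_eq[of "\<phi> s"] \<phi>B(1)[OF that] B(3) by auto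
  qed
  define \<delta> where "\<delta> = (\<lambda>s. \<gamma> (\<phi> s))"
  have "nth_diff_on n J \<delta>" for n
    unfolding \<delta>_def
    by (rule nth_diff_on_compose_autonomous[OF r_smooth _ \<phi>_deriv])
       (use I \<phi>B B in \<open>auto simp: smooth_on_iff[OF I(1)]\<close>)
  hence sm: "smooth_on J \<delta>" by (simp add: smooth_on_iff[OF J(1)])
  have \<delta>1: "vector_derivative \<delta> (at s) = r (\<phi> s) *\<^sub>R \<gamma>1 (\<phi> s)" if "s \<in> J" for s
    using vector_diff_chain_at[of \<phi> "r (\<phi> s)" s \<gamma> "\<gamma>1 (\<phi> s)"] \<phi>_deriv[OF that] \<gamma>_deriv \<phi>B[OF that] B
    by (auto simp: o_def \<delta>_def has_real_derivative_iff_has_vector_derivative intro!: vector_derivative_at)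
  have n1: "norm (vector_derivative \<delta> (at s)) = 1" if "s \<in> J" for s
    using \<delta>1[OF that] r_eq[of "\<phi> s"] \<phi>B[OF that] B vpos[of "\<phi> s"] by (auto simp: v_def)
  have im: "\<delta> ` J = \<gamma> ` B"
    using \<phi> by (auto simp: \<delta>_def J_def homeomorphism_def image_image)
  from regular_param_subset[OF reg B(3,1,2)]
  obtain g where g: "homeomorphism B (\<gamma> ` B) \<gamma> g" and op: "openin (top_of_set M) (\<gamma> ` B)"
    by (auto simp: regular_param_def)
  have "homeomorphism J (\<delta> ` J) \<delta> (L \<circ> g)"
    using homeomorphism_compose[OF _ g, of J \<phi> L] homeomorphism_symD[OF \<phi>]
    unfolding im by (simp add: \<delta>_def o_def J_def)
  moreover have "vector_derivative \<delta> (at s) \<noteq> 0" if "s \<in> J" for s using n1[OF that] by auto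
  ultimately have "unit_speed_param M J \<delta>"
    using J sm n1 op unfolding im[symmetric] unit_speed_param_def regular_param_def by blast
  with J(3) \<phi>0 show ?thesis by (intro that[of J \<delta>]) (auto simp: \<delta>_def)
qed

lemma unit_speed_paramD:
  assumes "unit_speed_param M I \<gamma>"
  shows "open I" "connected I" "smooth_on I \<gamma>" "openin (top_of_set M) (\<gamma> ` I)"
    "\<exists>g. homeomorphism I (\<gamma> ` I) \<gamma> g" "regular_param M I \<gamma>"
    "\<And>t. t \<in> I \<Longrightarrow> norm (nth_vector_deriv 1 \<gamma> t) = 1"
    "\<And>t. t \<in> I \<Longrightarrow> (\<gamma> has_vector_derivative nth_vector_deriv 1 \<gamma> t) (at t)"
    "\<And>t. t \<in> I \<Longrightarrow> \<gamma> t \<in> M"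
  using assms has_vector_derivative_nth[of I \<gamma> _ 0] unfolding unit_speed_param_def regular_param_def
  by (auto simp: nth_vector_deriv_Suc dest!: openin_imp_subset)

lemma pm_one_valued_constant:
  fixes f :: "real \<Rightarrow> real"
  assumes "connected I" "continuous_on I f" "\<And>t. t \<in> I \<Longrightarrow> f t = 1 \<or> f t = -1"
  obtains \<sigma> where "\<sigma> \<in> {1,-1::real}" "\<And>t. t \<in> I \<Longrightarrow> f t = \<sigma>"
proof (cases "I = {}")
  case False
  then obtain a where a: "a \<in> I" by auto
  have "finite (f ` I)" by (rule finite_subset[of _ "{1,-1}"]) (use assms(3) in auto)
  hence "f constant_on I"
    using continuous_finite_range_constant[OF assms(1,2)] by blast
  hence "f t = f a" if "t \<in> I" for t using that a by (auto simp: constant_on_def)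
  with assms(3)[OF a] that show ?thesis by blast
qed (auto intro: that)

text \<open>The transition function \<open>\<phi>\<close> is continuous because charts are homeomorphisms onto relatively open sets. Comparing the
components of \<open>\<gamma> \<circ> \<phi> = \<delta>\<close> along the tangent makes it differentiable, and both speeds being \<open>1\<close> forces
\<open>\<phi>' = 1\<close> or \<open>\<phi>' = -1\<close>, with a constant sign by continuity.\<close>

lemma unit_speed_transition:
  assumes \<gamma>: "unit_speed_param M I \<gamma>" and \<delta>: "unit_speed_param M J \<delta>"
    and "t0 \<in> I" "s0 \<in> J" "\<gamma> t0 = \<delta> s0"
  obtains \<sigma> e where "\<sigma> \<in> {1,-1::real}" "e > 0"
    "\<And>s. s \<in> ball s0 e \<Longrightarrow> s \<in> J \<and> t0 + \<sigma> * (s - s0) \<in> I \<and> \<delta> s = \<gamma> (t0 + \<sigma> * (s - s0))"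
proof -
  note \<gamma>D = unit_speed_paramD[OF \<gamma>] and \<delta>D = unit_speed_paramD[OF \<delta>]
  obtain g where g: "homeomorphism I (\<gamma> ` I) \<gamma> g" using \<gamma>D(5) by blast
  have cont_\<delta>: "continuous_on J \<delta>" using continuous_on_nth_vector_deriv[OF \<delta>D(3), of 0] by simp
  have "\<delta> \<in> J \<rightarrow> M" using \<delta>D(9) by auto
  from continuous_openin_preimage[OF cont_\<delta> this \<gamma>D(4)]
  have "openin (top_of_set J) (J \<inter> \<delta> -` \<gamma> ` I)" .
  hence "open (J \<inter> \<delta> -` \<gamma> ` I)" using \<delta>D(1) openin_open_trans by blast
  moreover have "s0 \<in> J \<inter> \<delta> -` \<gamma> ` I" using assms by (auto intro: rev_image_eqI)
  ultimately obtain e where e: "e > 0" "ball s0 e \<subseteq> J \<inter> \<delta> -` \<gamma> ` I"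
    using open_contains_ball by blast
  define \<phi> where "\<phi> = (\<lambda>s. g (\<delta> s))"
  define \<gamma>1 where "\<gamma>1 = nth_vector_deriv 1 \<gamma>"
  define \<delta>1 where "\<delta>1 = nth_vector_deriv 1 \<delta>"
  have \<phi>I: "s \<in> J" "\<phi> s \<in> I" "\<gamma> (\<phi> s) = \<delta> s" if "s \<in> ball s0 e" for s
    using that e(2) g by (auto simp: \<phi>_def homeomorphism_def)
  have cont_\<phi>: "continuous_on (ball s0 e) \<phi>"
    unfolding \<phi>_def
    by (rule continuous_on_compose2[of "\<gamma> ` I" g])
       (use g e(2) in \<open>auto simp: homeomorphism_def intro: continuous_on_subset[OF cont_\<delta>]\<close>)
  have \<phi>_deriv: "(\<phi> has_real_derivative \<delta>1 s \<bullet> \<gamma>1 (\<phi> s)) (at s)" if s: "s \<in> ball s0 e" for s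
  proof -
    define w where "w = \<gamma>1 (\<phi> s)"
    have ww: "w \<bullet> w = 1" using \<gamma>D(7)[OF \<phi>I(2)[OF s]] unfolding w_def \<gamma>1_def
      by (metis norm_eq_1)
    have "((\<lambda>t. \<gamma> t \<bullet> w) has_real_derivative w \<bullet> w) (at (\<phi> s))"
      using bounded_linear.has_vector_derivative[OF bounded_linear_inner_left \<gamma>D(8)[OF \<phi>I(2)[OF s]], of w]
      by (simp add: has_real_derivative_iff_has_vector_derivative w_def \<gamma>1_def)
    \<comment> \<open>The difference quotient of \<open>\<phi>\<close> is that of \<open>\<delta> \<bullet> w\<close> divided by the Caratheodory slope \<open>q\<close> of \<open>\<gamma> \<bullet> w\<close>, and \<open>q \<rightarrow> 1\<close>.\<close>
    then obtain q where q: "\<And>z. \<gamma> z \<bullet> w - \<gamma> (\<phi> s) \<bullet> w = q z * (z - \<phi> s)" "isCont q (\<phi> s)" "q (\<phi> s) = 1"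
      using CARAT_DERIV[of "\<lambda>t. \<gamma> t \<bullet> w"] ww by auto
    have "((\<lambda>s. \<delta> s \<bullet> w) has_real_derivative \<delta>1 s \<bullet> w) (at s)"
      using bounded_linear.has_vector_derivative[OF bounded_linear_inner_left \<delta>D(8)[OF \<phi>I(1)[OF s]], of w]
      by (simp add: has_real_derivative_iff_has_vector_derivative \<delta>1_def)
    hence lim: "((\<lambda>y. (\<delta> y \<bullet> w - \<delta> s \<bullet> w) / (y - s)) \<longlongrightarrow> \<delta>1 s \<bullet> w) (at s)"
      by (simp add: has_field_derivative_iff)
    have "isCont \<phi> s"
      using cont_\<phi> s by (simp add: continuous_on_eq_continuous_at)
    hence qc: "isCont (\<lambda>y. q (\<phi> y)) s" using q(2) isCont_o2 by blast
    hence qlim: "((\<lambda>y. q (\<phi> y)) \<longlongrightarrow> 1) (at s)" using q(3) by (simp add: isCont_def)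
    have "((\<lambda>y. ((\<delta> y \<bullet> w - \<delta> s \<bullet> w) / (y - s)) / q (\<phi> y)) \<longlongrightarrow> (\<delta>1 s \<bullet> w) / 1) (at s)"
      by (intro tendsto_divide lim qlim) auto
    moreover have "\<forall>\<^sub>F y in at s. ((\<delta> y \<bullet> w - \<delta> s \<bullet> w) / (y - s)) / q (\<phi> y) = (\<phi> y - \<phi> s) / (y - s)"
    proof -
      have "\<forall>\<^sub>F y in at s. q (\<phi> y) \<noteq> 0" using tendsto_imp_eventually_ne[OF qlim, of 0] by simp
      moreover have "\<forall>\<^sub>F y in at s. y \<in> ball s0 e" using s by (intro eventually_at_in_open') auto
      ultimately show ?thesis
      proof eventually_elim
        case (elim y)
        have "\<delta> y \<bullet> w - \<delta> s \<bullet> w = q (\<phi> y) * (\<phi> y - \<phi> s)"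
          using q(1)[of "\<phi> y"] \<phi>I(3)[OF elim(2)] \<phi>I(3)[OF s] by simp
        thus ?case using elim(1) by simp
      qed
    qed
    ultimately have "((\<lambda>y. (\<phi> y - \<phi> s) / (y - s)) \<longlongrightarrow> (\<delta>1 s \<bullet> w)) (at s)"
      using Lim_transform_eventually by fastforce
    thus ?thesis by (simp add: has_field_derivative_iff w_def)
  qed
  have \<delta>1_eq: "\<delta>1 s = (\<delta>1 s \<bullet> \<gamma>1 (\<phi> s)) *\<^sub>R \<gamma>1 (\<phi> s)" if s: "s \<in> ball s0 e" for s
  proof -
    have "((\<lambda>s. \<gamma> (\<phi> s)) has_vector_derivative (\<delta>1 s \<bullet> \<gamma>1 (\<phi> s)) *\<^sub>R \<gamma>1 (\<phi> s)) (at s)"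
      using vector_diff_chain_at[of \<phi> _ s \<gamma>] \<phi>_deriv[OF s] \<gamma>D(8)[OF \<phi>I(2)[OF s]]
      unfolding o_def has_real_derivative_iff_has_vector_derivative \<gamma>1_def by blast
    hence "(\<delta> has_vector_derivative (\<delta>1 s \<bullet> \<gamma>1 (\<phi> s)) *\<^sub>R \<gamma>1 (\<phi> s)) (at s)"
      by (rule has_vector_derivative_transform_within_open[OF _ open_ball s]) (use \<phi>I in auto)
    with \<delta>D(8)[OF \<phi>I(1)[OF s]] show ?thesis
      unfolding \<delta>1_def by (rule vector_derivative_unique_at)
  qed
  have pm: "\<delta>1 s \<bullet> \<gamma>1 (\<phi> s) = 1 \<or> \<delta>1 s \<bullet> \<gamma>1 (\<phi> s) = -1" if s: "s \<in> ball s0 e" for s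
  proof -
    have "\<bar>\<delta>1 s \<bullet> \<gamma>1 (\<phi> s)\<bar> * norm (\<gamma>1 (\<phi> s)) = norm (\<delta>1 s)"
      using \<delta>1_eq[OF s] by (metis norm_scaleR)
    thus ?thesis using \<gamma>D(7)[OF \<phi>I(2)[OF s]] \<delta>D(7)[OF \<phi>I(1)[OF s]]
      by (simp add: \<gamma>1_def \<delta>1_def) linarith
  qed
  have "continuous_on (ball s0 e) (\<lambda>s. \<delta>1 s \<bullet> \<gamma>1 (\<phi> s))"
    unfolding \<gamma>1_def \<delta>1_def
    by (intro continuous_intros continuous_on_compose2[OF continuous_on_nth_vector_deriv[OF \<gamma>D(3)] cont_\<phi>]
          continuous_on_subset[OF continuous_on_nth_vector_deriv[OF \<delta>D(3)]])
       (use \<phi>I in auto)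
  then obtain \<sigma> where \<sigma>: "\<sigma> \<in> {1,-1::real}" "\<And>s. s \<in> ball s0 e \<Longrightarrow> \<delta>1 s \<bullet> \<gamma>1 (\<phi> s) = \<sigma>"
    using pm_one_valued_constant[of "ball s0 e" "\<lambda>s. \<delta>1 s \<bullet> \<gamma>1 (\<phi> s)"] pm by blast
  have \<phi>0: "\<phi> s0 = t0" using assms g by (metis \<phi>_def homeomorphism_apply1)
  have "\<phi> s = t0 + \<sigma> * (s - s0)" if s: "s \<in> ball s0 e" for s
  proof -
    have "(\<phi> s - \<sigma> * s) = (\<phi> s0 - \<sigma> * s0)"
    proof (rule has_field_derivative_zero_constant[of "ball s0 e" "\<lambda>s. \<phi> s - \<sigma> * s", THEN exE])
      fix x assume x: "x \<in> ball s0 e"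
      have "((\<lambda>s. \<phi> s - \<sigma> * s) has_real_derivative 0) (at x)"
        using \<phi>_deriv[OF x] \<sigma>(2)[OF x] by (auto intro!: derivative_eq_intros)
      thus "((\<lambda>s. \<phi> s - \<sigma> * s) has_real_derivative 0) (at x within ball s0 e)"
        by (rule has_field_derivative_at_within)
    next
      fix c assume "\<forall>x\<in>ball s0 e. \<phi> x - \<sigma> * x = c"
      thus ?thesis using s e(1) by simp
    qed auto
    thus ?thesis using \<phi>0 by (simp add: algebra_simps)
  qed
  with \<sigma>(1) e(1) \<phi>I show ?thesis by (intro that[of \<sigma> e]) metis+
qed

section \<open>Frame and curvature along a unit speed chart\<close>

definition rot :: "real^2 \<Rightarrow> real^2" where "rot v = vector [- (v$2), v$1]"

lemma rot_nth [simp]: "rot v $ 1 = - (v $ 2)" "rot v $ 2 = v $ 1"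
  by (simp_all add: rot_def)

lemma inner_real2: "(v::real^2) \<bullet> w = v$1 * w$1 + v$2 * w$2"
  by (simp add: inner_vec_def sum_2)

lemma bounded_linear_rot: "bounded_linear rot"
proof -
  have "linear rot" by (rule linearI) (auto simp: vec_eq_iff forall_2)
  thus ?thesis by (simp add: linear_conv_bounded_linear)
qed

lemma rot_rot [simp]: "rot (rot v) = - v"
  by (simp add: vec_eq_iff forall_2)

lemma rot_scaleR [simp]: "rot (c *\<^sub>R v) = c *\<^sub>R rot v"
  by (simp add: vec_eq_iff forall_2)

lemma inner_rot_rot [simp]: "rot v \<bullet> rot w = v \<bullet> w"
  by (simp add: inner_real2)

lemma inner_rot_self [simp]: "v \<bullet> rot v = 0" "rot v \<bullet> v = 0"
  by (simp_all add: inner_real2)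

lemma inner_rot_left: "rot v \<bullet> w = - (v \<bullet> rot w)"
  by (simp add: inner_real2)

lemma frame_expansion:
  fixes v T :: "real^2"
  assumes "T \<bullet> T = 1"
  shows "v = (v \<bullet> T) *\<^sub>R T + (v \<bullet> rot T) *\<^sub>R rot T"
proof -
  have 1: "T$1 * T$1 + T$2 * T$2 = 1" using assms by (simp add: inner_real2)
  have "v$1 = (v$1 * T$1 + v$2 * T$2) * T$1 + (v$1 * - (T$2) + v$2 * T$1) * - (T$2)"
    "v$2 = (v$1 * T$1 + v$2 * T$2) * T$2 + (v$1 * - (T$2) + v$2 * T$1) * T$1"
    using 1 by algebra+
  thus ?thesis by (simp add: vec_eq_iff forall_2 inner_real2)
qed

lemma inner_frame:
  fixes v w T :: "real^2"
  assumes "T \<bullet> T = 1"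
  shows "v \<bullet> w = (v \<bullet> T) * (w \<bullet> T) + (v \<bullet> rot T) * (w \<bullet> rot T)"
proof -
  have "v \<bullet> w = ((v \<bullet> T) *\<^sub>R T + (v \<bullet> rot T) *\<^sub>R rot T) \<bullet> w"
    using frame_expansion[OF assms, of v] by simp
  also have "\<dots> = (v \<bullet> T) * (w \<bullet> T) + (v \<bullet> rot T) * (w \<bullet> rot T)"
    by (simp only: inner_add_left inner_scaleR_left inner_commute[of w])
  finally show ?thesis .
qed

text \<open>Tangent, normal and curvature in a unit speed chart. Because the given normal field is continuous, along a chart it
is \<open>rot T\<close> up to one global sign (\<open>normal_sign\<close>), and is therefore as smooth as the tangent.\<close>

locale unit_speed_chart =
  fixes M :: "(real^2) set" and \<nu> :: "real^2 \<Rightarrow> real^2" and I :: "real set" and \<gamma> :: "real \<Rightarrow> real^2"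
  assumes \<nu>: "outward_unit_normal M \<nu>" and \<gamma>: "unit_speed_param M I \<gamma>"
begin

lemmas chart = unit_speed_paramD[OF \<gamma>]

definition T :: "real \<Rightarrow> real^2" where "T = nth_vector_deriv 1 \<gamma>"
definition k :: "nat \<Rightarrow> real \<Rightarrow> real" where "k n = nth_vector_deriv n (second_fundamental_form \<nu> \<gamma>)"

lemma T_T: "t \<in> I \<Longrightarrow> T t \<bullet> T t = 1"
  using chart(7)[of t] by (simp add: T_def norm_eq_1)

lemma \<gamma>_deriv: "t \<in> I \<Longrightarrow> (\<gamma> has_vector_derivative T t) (at t)"
  using chart(8)[of t] by (simp add: T_def)

lemma cont_\<gamma>: "continuous_on I \<gamma>"
  using continuous_on_nth_vector_deriv[OF chart(3), of 0] by simp

lemma cont_T: "continuous_on I T"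
  using continuous_on_nth_vector_deriv[OF chart(3), of 1] by (simp add: T_def)

lemma T_deriv: "t \<in> I \<Longrightarrow> (T has_vector_derivative nth_vector_deriv 2 \<gamma> t) (at t)"
  using has_vector_derivative_nth[OF chart(3), of t 1] by (simp add: T_def numeral_2_eq_2)

lemma normal_sign:
  obtains \<sigma> where "\<sigma> \<in> {1,-1::real}" "\<And>t. t \<in> I \<Longrightarrow> \<nu> (\<gamma> t) = \<sigma> *\<^sub>R rot (T t)"
proof -
  have perp: "\<nu> (\<gamma> t) \<bullet> T t = 0" if "t \<in> I" for t
    using \<nu> chart(6) that by (auto simp: outward_unit_normal_def T_def nth_vector_deriv_Suc)
  have eq: "\<nu> (\<gamma> t) = (\<nu> (\<gamma> t) \<bullet> rot (T t)) *\<^sub>R rot (T t)" if "t \<in> I" for t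
    using frame_expansion[OF T_T[OF that], of "\<nu> (\<gamma> t)"] perp[OF that] by simp
  have pm: "\<nu> (\<gamma> t) \<bullet> rot (T t) = 1 \<or> \<nu> (\<gamma> t) \<bullet> rot (T t) = -1" if "t \<in> I" for t
  proof -
    have "norm (\<nu> (\<gamma> t)) = 1" using \<nu> chart(9)[OF that] by (auto simp: outward_unit_normal_def)
    hence "\<nu> (\<gamma> t) \<bullet> \<nu> (\<gamma> t) = 1" by (simp add: norm_eq_1)
    hence "(\<nu> (\<gamma> t) \<bullet> rot (T t))\<^sup>2 = 1"
      using inner_frame[OF T_T[OF that], of "\<nu> (\<gamma> t)" "\<nu> (\<gamma> t)"] perp[OF that] by (simp add: power2_eq_square)
    thus ?thesis by (simp add: power2_eq_1_iff)
  qed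
  have "continuous_on I (\<lambda>t. \<nu> (\<gamma> t))"
    by (rule continuous_on_compose2[of M]) (use \<nu> cont_\<gamma> chart(9) in \<open>auto simp: outward_unit_normal_def\<close>)
  moreover have "continuous_on I (\<lambda>t. rot (T t))"
    by (rule bounded_linear.continuous_on[OF bounded_linear_rot cont_T])
  ultimately have "continuous_on I (\<lambda>t. \<nu> (\<gamma> t) \<bullet> rot (T t))" by (intro continuous_intros)
  from pm_one_valued_constant[OF chart(2) this] pm obtain \<sigma> where
    "\<sigma> \<in> {1,-1}" "\<And>t. t \<in> I \<Longrightarrow> \<nu> (\<gamma> t) \<bullet> rot (T t) = \<sigma>" by blast
  with eq that show ?thesis by metis
qed

definition N :: "real \<Rightarrow> real^2" where "N t = \<nu> (\<gamma> t)"

lemma N_perp: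
  assumes "t \<in> I"
  shows "N t \<bullet> T t = 0" "T t \<bullet> N t = 0"
proof -
  obtain \<sigma> where \<sigma>: "\<sigma> \<in> {1,-1::real}" "\<And>t. t \<in> I \<Longrightarrow> N t = \<sigma> *\<^sub>R rot (T t)"
    using normal_sign unfolding N_def by blast
  show "N t \<bullet> T t = 0" "T t \<bullet> N t = 0" using \<sigma>(2)[OF assms] by simp_all
qed

lemma N_N: "t \<in> I \<Longrightarrow> N t \<bullet> N t = 1"
proof -
  assume "t \<in> I"
  hence "norm (N t) = 1" using \<nu> chart(9) by (auto simp: outward_unit_normal_def N_def)
  thus ?thesis by (simp add: norm_eq_1)
qed

lemma inner_TN:
  assumes "t \<in> I"
  shows "v \<bullet> w = (v \<bullet> T t) * (w \<bullet> T t) + (v \<bullet> N t) * (w \<bullet> N t)"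
proof -
  obtain \<sigma> where "\<sigma> \<in> {1,-1::real}" "\<And>t. t \<in> I \<Longrightarrow> N t = \<sigma> *\<^sub>R rot (T t)"
    using normal_sign unfolding N_def by blast
  thus ?thesis using inner_frame[OF T_T[OF assms], of v w] assms by auto
qed

text \<open>The sign that relates \<open>N\<close> to \<open>rot T\<close> cancels when two points of the chart are compared. So the frame at
\<open>t'\<close>, in coordinates of the frame at \<open>t\<close>, is a rotation matrix, determined by the coordinates of \<open>T t'\<close> alone.\<close>

lemma N_relative:
  assumes "t \<in> I" "t' \<in> I"
  shows "N t' \<bullet> N t = T t' \<bullet> T t" "N t' \<bullet> T t = - (T t' \<bullet> N t)"
proof -
  obtain \<sigma> where \<sigma>: "\<sigma> \<in> {1,-1::real}" "\<And>t. t \<in> I \<Longrightarrow> N t = \<sigma> *\<^sub>R rot (T t)"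
    using normal_sign unfolding N_def by blast
  thus "N t' \<bullet> N t = T t' \<bullet> T t" "N t' \<bullet> T t = - (T t' \<bullet> N t)"
    using assms by (auto simp: inner_rot_left)
qed

lemma k_0: "k 0 t = nth_vector_deriv 2 \<gamma> t \<bullet> N t"
  by (simp add: k_def N_def second_fundamental_form_def)

lemma second_derivative_perp: "t \<in> I \<Longrightarrow> nth_vector_deriv 2 \<gamma> t \<bullet> T t = 0"
proof -
  assume t: "t \<in> I"
  have "((\<lambda>t. T t \<bullet> T t) has_real_derivative T t \<bullet> nth_vector_deriv 2 \<gamma> t + nth_vector_deriv 2 \<gamma> t \<bullet> T t) (at t)"
    unfolding has_real_derivative_iff_has_vector_derivative
    by (intro bounded_bilinear.has_vector_derivative[OF bounded_bilinear_inner] T_deriv t)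
  moreover have "((\<lambda>t. T t \<bullet> T t) has_real_derivative 0) (at t)"
    unfolding has_real_derivative_iff_has_vector_derivative
    by (rule has_vector_derivative_transform_within_open[of "\<lambda>_. 1", OF _ chart(1) t])
       (auto simp: T_T)
  ultimately show ?thesis using DERIV_unique by (fastforce simp: inner_commute)
qed

text \<open>This and \<open>N_deriv\<close> are the Frenet equations; they turn derivatives of \<open>\<gamma>\<close> into polynomials in the
curvature and its derivatives.\<close>

lemma T_deriv': "t \<in> I \<Longrightarrow> (T has_vector_derivative k 0 t *\<^sub>R N t) (at t)"
proof -
  assume t: "t \<in> I"
  have "nth_vector_deriv 2 \<gamma> t = k 0 t *\<^sub>R N t"
  proof (rule vector_eq_ldot[THEN iffD1], rule allI)
    fix v
    show "v \<bullet> nth_vector_deriv 2 \<gamma> t = v \<bullet> k 0 t *\<^sub>R N t"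
      using inner_TN[OF t, of v "nth_vector_deriv 2 \<gamma> t"] second_derivative_perp[OF t] by (simp add: k_0)
  qed
  with T_deriv[OF t] show ?thesis by simp
qed

lemma N_deriv: "t \<in> I \<Longrightarrow> (N has_vector_derivative - k 0 t *\<^sub>R T t) (at t)"
proof -
  assume t: "t \<in> I"
  obtain \<sigma> where \<sigma>: "\<sigma> \<in> {1,-1::real}" "\<And>t. t \<in> I \<Longrightarrow> N t = \<sigma> *\<^sub>R rot (T t)"
    using normal_sign unfolding N_def by blast
  have "((\<lambda>t. \<sigma> *\<^sub>R rot (T t)) has_vector_derivative \<sigma> *\<^sub>R rot (k 0 t *\<^sub>R N t)) (at t)"
    by (rule bounded_linear.has_vector_derivative[OF bounded_linear_scaleR_right
         bounded_linear.has_vector_derivative[OF bounded_linear_rot T_deriv'[OF t]]])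
  also have "\<sigma> *\<^sub>R rot (k 0 t *\<^sub>R N t) = - k 0 t *\<^sub>R T t"
    using \<sigma>(1) by (auto simp: \<sigma>(2)[OF t])
  finally show ?thesis
    by (rule has_vector_derivative_transform_within_open[OF _ chart(1) t]) (simp add: \<sigma>(2))
qed

lemma cont_N: "continuous_on I N"
  using N_deriv by (meson continuous_at_imp_continuous_on has_vector_derivative_continuous)

lemma smooth_N: "smooth_on I N"
proof -
  obtain \<sigma> where \<sigma>: "\<sigma> \<in> {1,-1::real}" "\<And>t. t \<in> I \<Longrightarrow> N t = \<sigma> *\<^sub>R rot (T t)"
    using normal_sign unfolding N_def by blast
  have "bounded_bilinear (\<lambda>c v. c *\<^sub>R rot v)"
    by (rule bounded_bilinear.comp[OF bounded_bilinear_scaleR bounded_linear_ident bounded_linear_rot])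
  moreover have "smooth_on I (\<lambda>_. \<sigma>)" using nth_diff_on_const by (auto simp: smooth_on_iff[OF chart(1)])
  moreover have "smooth_on I T" unfolding T_def by (rule smooth_on_nth[OF chart(3)])
  ultimately have "smooth_on I (\<lambda>t. \<sigma> *\<^sub>R rot (T t))" using smooth_on_bilinear chart(1) by blast
  thus ?thesis by (rule smooth_on_cong[OF chart(1), rotated]) (simp add: \<sigma>(2))
qed

lemma smooth_curvature: "smooth_on I (second_fundamental_form \<nu> \<gamma>)"
proof -
  have "smooth_on I (\<lambda>t. nth_vector_deriv 2 \<gamma> t \<bullet> N t)"
    by (rule smooth_on_bilinear[OF bounded_bilinear_inner chart(1) smooth_on_nth[OF chart(3)] smooth_N])
  thus ?thesis by (simp add: second_fundamental_form_def[abs_def] N_def)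
qed

lemma k_deriv: "t \<in> I \<Longrightarrow> (k n has_real_derivative k (Suc n) t) (at t)"
  using has_vector_derivative_nth[OF smooth_curvature]
  by (simp add: k_def has_real_derivative_iff_has_vector_derivative)

lemma cont_k: "continuous_on I (k n)"
  unfolding k_def by (rule continuous_on_nth_vector_deriv[OF smooth_curvature])

text \<open>The parametrization chosen at a point agrees near that point with the chart up to a shift and a reversal \<open>\<sigma>\<close>. Each derivative
picks up one factor \<open>\<sigma>\<close>, while the curvature itself, a second derivative against a fixed normal, picks up
\<open>\<sigma>\<^sup>2 = 1\<close>.\<close>

lemma curvature_deriv_chart:
  assumes t0: "t0 \<in> I"
  obtains \<sigma> where "\<sigma> \<in> {1,-1::real}" "\<And>n. curvature_deriv M \<nu> n (\<gamma> t0) = \<sigma> ^ n * k n t0"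
proof -
  define \<delta> where "\<delta> = unit_speed_at M (\<gamma> t0)"
  have "\<exists>\<delta> J. unit_speed_param M J \<delta> \<and> 0 \<in> J \<and> \<delta> 0 = \<gamma> t0"
    using regular_param_imp_unit_speed_param[OF chart(6) t0] by metis
  from someI_ex[OF this] obtain J where J: "unit_speed_param M J \<delta>" "0 \<in> J" "\<delta> 0 = \<gamma> t0"
    unfolding \<delta>_def unit_speed_at_def by blast
  obtain \<sigma> e where \<sigma>: "\<sigma> \<in> {1,-1::real}" "e > 0" and
    "\<And>s. s \<in> ball 0 e \<Longrightarrow> s \<in> J \<and> t0 + \<sigma> * (s - 0) \<in> I \<and> \<delta> s = \<gamma> (t0 + \<sigma> * (s - 0))"
    using unit_speed_transition[OF \<gamma> J(1) t0 J(2) J(3)[symmetric]] by metis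
  hence tr: "t0 + \<sigma> * s \<in> I" "\<delta> s = \<gamma> (t0 + \<sigma> * s)" if "s \<in> ball 0 e" for s using that by force+
  have sff: "second_fundamental_form \<nu> \<delta> s = second_fundamental_form \<nu> \<gamma> (t0 + \<sigma> * s)" if s: "s \<in> ball 0 e" for s
  proof -
    have "nth_vector_deriv 2 \<delta> s = nth_vector_deriv 2 (\<lambda>s. \<gamma> (t0 + \<sigma> * s)) s"
      by (rule nth_vector_deriv_cong[OF open_ball s]) (rule tr)
    also have "\<dots> = \<sigma>^2 *\<^sub>R nth_vector_deriv 2 \<gamma> (t0 + \<sigma> * s)"
      by (rule nth_vector_deriv_affine[OF chart(3) open_ball tr(1) s])
    also have "\<dots> = nth_vector_deriv 2 \<gamma> (t0 + \<sigma> * s)" using \<sigma>(1) by auto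
    finally show ?thesis using tr(2)[OF s] by (simp add: second_fundamental_form_def)
  qed
  have "curvature_deriv M \<nu> n (\<gamma> t0) = \<sigma> ^ n * k n t0" for n
  proof -
    have 0: "0 \<in> ball 0 e" using \<sigma>(2) by simp
    have "curvature_deriv M \<nu> n (\<gamma> t0) = nth_vector_deriv n (second_fundamental_form \<nu> \<delta>) 0"
      by (simp add: curvature_deriv_def \<delta>_def)
    also have "\<dots> = nth_vector_deriv n (\<lambda>s. second_fundamental_form \<nu> \<gamma> (t0 + \<sigma> * s)) 0"
      by (rule nth_vector_deriv_cong[OF open_ball 0 sff])
    also have "\<dots> = \<sigma>^n *\<^sub>R nth_vector_deriv n (second_fundamental_form \<nu> \<gamma>) (t0 + \<sigma> * 0)"
      by (rule nth_vector_deriv_affine[OF smooth_curvature open_ball tr(1) 0])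
    finally show ?thesis by (simp add: k_def)
  qed
  with \<sigma>(1) that show ?thesis by blast
qed

end

section \<open>Arc length on the curve and its decomposition into arcs\<close>

locale measured_curve =
  fixes M :: "(real^2) set" and \<nu> :: "real^2 \<Rightarrow> real^2" and A :: "(real^2) measure"
  assumes M: "compact_smooth_curve M" and A: "arclength_measure M A" and \<nu>: "outward_unit_normal M \<nu>"
begin

lemma compact_M: "compact M" and closed_M: "closed M"
  using M by (auto simp: compact_smooth_curve_def compact_imp_closed)

lemma space_A [simp]: "space A = M"
  using A by (simp add: arclength_measure_def)

lemma sets_A: "B \<in> sets A \<longleftrightarrow> B \<in> sets borel \<and> B \<subseteq> M"
  using A closed_M by (auto simp: arclength_measure_def sets_restrict_space_iff)

lemma sets_A_eq [measurable_cong]: "sets A = sets (restrict_space borel M)"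
  using A by (simp add: arclength_measure_def)

lemma chart_image_in_sets:
  assumes "unit_speed_param M I \<gamma>" "S \<in> sets borel" "S \<subseteq> I"
  shows "\<gamma> ` S \<in> sets A"
proof -
  note D = unit_speed_paramD[OF assms(1)]
  obtain g where g: "homeomorphism I (\<gamma> ` I) \<gamma> g" using D(5) by blast
  obtain U where U: "open U" "\<gamma> ` I = M \<inter> U" using D(4) by (auto simp: openin_open)
  have im: "\<gamma> ` I \<in> sets borel" unfolding U(2) using U(1) closed_M by auto
  have "g \<in> borel_measurable (restrict_space borel (\<gamma> ` I))"
    using g by (intro borel_measurable_continuous_on_restrict) (auto simp: homeomorphism_def)
  from measurable_sets[OF this assms(2)]
  have "g -` S \<inter> \<gamma> ` I \<in> sets borel"
    using im by (simp add: sets_restrict_space_iff space_restrict_space)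
  also have "g -` S \<inter> \<gamma> ` I = \<gamma> ` S"
    using g assms(3) by (auto simp: homeomorphism_def image_iff subset_eq) 
  finally show ?thesis using D(9) assms(3) by (auto simp: sets_A)
qed

lemma emeasure_chart_image:
  assumes "unit_speed_param M I \<gamma>" "S \<in> sets borel" "S \<subseteq> I"
  shows "emeasure A (\<gamma> ` S) = emeasure lborel S"
proof -
  have "emeasure A (\<gamma> ` S) = (\<integral>\<^sup>+ t\<in>S. ennreal (norm (vector_derivative \<gamma> (at t))) \<partial>lborel)"
    using A assms unfolding arclength_measure_def unit_speed_param_def by blast
  also have "\<dots> = (\<integral>\<^sup>+ t. indicator S t \<partial>lborel)"
    by (rule nn_integral_cong) (use assms in \<open>auto simp: unit_speed_param_def indicator_def\<close>)
  also have "\<dots> = emeasure lborel S" using assms(2) by simp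
  finally show ?thesis .
qed

lemma cont_param: "unit_speed_param M I \<gamma> \<Longrightarrow> continuous_on I \<gamma>"
  using continuous_on_nth_vector_deriv[OF unit_speed_paramD(3), of M I \<gamma> 0] by simp

text \<open>Arc length is prescribed on images of Borel parameter sets as an integral of the speed. At unit speed this is Lebesgue
measure, and such images exhaust the Borel subsets of the image of a chart.\<close>

lemma distr_chart:
  assumes \<gamma>: "unit_speed_param M I \<gamma>" and S: "S \<in> sets borel" "S \<subseteq> I"
  shows "\<gamma> \<in> restrict_space lborel S \<rightarrow>\<^sub>M restrict_space A (\<gamma> ` S)"
    "distr (restrict_space lborel S) (restrict_space A (\<gamma> ` S)) \<gamma> = restrict_space A (\<gamma> ` S)"
proof -
  note im = chart_image_in_sets[OF assms]
  have "\<gamma> \<in> borel_measurable (restrict_space borel S)"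
    by (intro borel_measurable_continuous_on_restrict continuous_on_subset[OF cont_param[OF \<gamma>] S(2)])
  hence "\<gamma> \<in> borel_measurable (restrict_space lborel S)"
    by (simp cong: measurable_cong_sets add: sets_restrict_space)
  thus meas: "\<gamma> \<in> restrict_space lborel S \<rightarrow>\<^sub>M restrict_space A (\<gamma> ` S)"
    using unit_speed_paramD(9)[OF \<gamma>] S(2)
    by (intro measurable_restrict_space2)
       (auto simp: space_restrict_space measurable_cong_sets[OF refl sets_A_eq] intro!: measurable_restrict_space2)
  show "distr (restrict_space lborel S) (restrict_space A (\<gamma> ` S)) \<gamma> = restrict_space A (\<gamma> ` S)"
  proof (rule measure_eqI)
    fix B assume "B \<in> sets (distr (restrict_space lborel S) (restrict_space A (\<gamma> ` S)) \<gamma>)"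
    hence B: "B \<in> sets (restrict_space A (\<gamma> ` S))" by simp
    hence B': "B \<in> sets A" "B \<subseteq> \<gamma> ` S"
      using sets_restrict_space_iff[of "\<gamma> ` S" A B] sets.Int[OF im sets.top] by blast+
    have pre: "\<gamma> -` B \<inter> S \<in> sets borel"
      using measurable_sets[OF meas B] S(1) by (simp add: sets_restrict_space_iff space_restrict_space)
    have "emeasure (distr (restrict_space lborel S) (restrict_space A (\<gamma> ` S)) \<gamma>) B =
        emeasure (restrict_space lborel S) (\<gamma> -` B \<inter> S)"
      by (simp add: emeasure_distr[OF meas B] space_restrict_space)
    also have "\<dots> = emeasure lborel (\<gamma> -` B \<inter> S)"
      using S(1) by (intro emeasure_restrict_space) auto
    also have "\<dots> = emeasure A (\<gamma> ` (\<gamma> -` B \<inter> S))"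
      using S(2) by (intro emeasure_chart_image[OF \<gamma> pre, symmetric]) auto
    also have "\<gamma> ` (\<gamma> -` B \<inter> S) = B" using B'(2) by auto
    also have "emeasure A B = emeasure (restrict_space A (\<gamma> ` S)) B"
      using B'(2) sets.Int[OF im sets.top] by (intro emeasure_restrict_space[symmetric]) auto
    finally show "emeasure (distr (restrict_space lborel S) (restrict_space A (\<gamma> ` S)) \<gamma>) B = emeasure (restrict_space A (\<gamma> ` S)) B" .
  qed simp
qed

lemma param_measurable:
  assumes "unit_speed_param M I \<gamma>" "S \<in> sets borel" "S \<subseteq> I"
  shows "\<gamma> \<in> restrict_space lborel S \<rightarrow>\<^sub>M A"
  using distr_chart(1)[OF assms] by (simp add: measurable_restrict_space2_iff)

lemma integral_chart:
  fixes f :: "real^2 \<Rightarrow> 'b::{banach, second_countable_topology}"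
  assumes \<gamma>: "unit_speed_param M I \<gamma>" and S: "S \<in> sets borel" "S \<subseteq> I"
    and f': "f \<in> borel_measurable (restrict_space A (\<gamma> ` S))"
  shows "set_integrable A (\<gamma> ` S) f \<longleftrightarrow> set_integrable lborel S (\<lambda>t. f (\<gamma> t))"
    "(LINT u:\<gamma> ` S|A. f u) = (LINT t:S|lborel. f (\<gamma> t))"
proof -
  note d = distr_chart[OF \<gamma> S] and im = chart_image_in_sets[OF \<gamma> S]
  have "set_integrable A (\<gamma> ` S) f \<longleftrightarrow> integrable (restrict_space A (\<gamma> ` S)) f"
    unfolding set_integrable_def using sets.Int[OF im sets.top] by (intro integrable_restrict_space[symmetric])
  also have "\<dots> \<longleftrightarrow> integrable (restrict_space lborel S) (\<lambda>t. f (\<gamma> t))"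
    by (subst d(2)[symmetric], rule integrable_distr_eq[OF d(1) f'])
  also have "\<dots> \<longleftrightarrow> set_integrable lborel S (\<lambda>t. f (\<gamma> t))"
    unfolding set_integrable_def using S by (intro integrable_restrict_space) auto
  finally show "set_integrable A (\<gamma> ` S) f \<longleftrightarrow> set_integrable lborel S (\<lambda>t. f (\<gamma> t))" .
  have "(LINT u:\<gamma> ` S|A. f u) = integral\<^sup>L (restrict_space A (\<gamma> ` S)) f"
    unfolding set_lebesgue_integral_def using sets.Int[OF im sets.top] by (intro integral_restrict_space[symmetric])
  also have "\<dots> = integral\<^sup>L (restrict_space lborel S) (\<lambda>t. f (\<gamma> t))"
    by (subst d(2)[symmetric], rule integral_distr[OF d(1) f'])
  also have "\<dots> = (LINT t:S|lborel. f (\<gamma> t))"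
    unfolding set_lebesgue_integral_def using S by (intro integral_restrict_space) auto
  finally show "(LINT u:\<gamma> ` S|A. f u) = (LINT t:S|lborel. f (\<gamma> t))" .
qed

text \<open>Arcs are compact so that everything continuous along a chart is bounded on them.\<close>

definition is_arc :: "(real^2) set \<Rightarrow> bool" where
  "is_arc E \<longleftrightarrow> (\<exists>I \<gamma> a b. unit_speed_param M I \<gamma> \<and> a \<le> b \<and> {a..b} \<subseteq> I \<and> E = \<gamma> ` {a..b})"

lemma arc_around:
  assumes "p \<in> M"
  obtains U E where "is_arc E" "openin (top_of_set M) U" "p \<in> U" "U \<subseteq> E"
proof -
  have "\<exists>I \<gamma>. regular_param M I \<gamma> \<and> p \<in> \<gamma> ` I"
    using M assms unfolding compact_smooth_curve_def by blast
  then obtain I \<gamma> t where t: "regular_param M I \<gamma>" "t \<in> I" "\<gamma> t = p" by blast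
  obtain J \<delta> where J: "unit_speed_param M J \<delta>" "0 \<in> J" "\<delta> 0 = \<gamma> t"
    by (rule regular_param_imp_unit_speed_param[OF t(1,2)])
  note D = unit_speed_paramD[OF J(1)]
  obtain e where e: "e > 0" "cball 0 e \<subseteq> J" using D(1) J(2) open_contains_cball by blast
  have J': "ball 0 e \<subseteq> J" "{-e..e} \<subseteq> J" "ball 0 e \<subseteq> {-e..e}"
  proof -
    show "ball 0 e \<subseteq> J" using e(2) ball_subset_cball by (rule order_trans[rotated])
    show "{-e..e} \<subseteq> J" using e(2) by (simp add: cball_eq_atLeastAtMost)
  qed (auto simp: dist_real_def)
  have "openin (top_of_set M) (\<delta> ` ball 0 e)"
    using regular_param_subset[OF D(6) J'(1)] by (auto simp: regular_param_def)
  moreover have "is_arc (\<delta> ` {-e..e})"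
    unfolding is_arc_def using J(1) J'(2) e(1)
    by (intro exI[of _ J] exI[of _ \<delta>] exI[of _ "-e"] exI[of _ e]) auto
  moreover have "p \<in> \<delta> ` ball 0 e" using J(3) t(3) e(1) by (intro image_eqI[of _ _ 0]) auto
  ultimately show ?thesis using that J'(3) by blast
qed

lemma finite_arc_cover:
  obtains D where "finite D" "\<And>E. E \<in> D \<Longrightarrow> is_arc E" "M \<subseteq> \<Union>D"
proof -
  define C where "C = {U. openin (top_of_set M) U \<and> (\<exists>E. is_arc E \<and> U \<subseteq> E)}"
  have "M \<subseteq> \<Union>C"
  proof
    fix p assume "p \<in> M"
    then obtain U E where "is_arc E" "openin (top_of_set M) U" "p \<in> U" "U \<subseteq> E" by (rule arc_around)
    thus "p \<in> \<Union>C" unfolding C_def by blast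
  qed
  moreover have "\<forall>c\<in>C. openin (top_of_set M) c" by (auto simp: C_def)
  ultimately obtain D where D: "D \<subseteq> C" "finite D" "M \<subseteq> \<Union>D"
    using compact_M unfolding compact_eq_openin_cover by meson
  have "\<forall>U\<in>D. \<exists>E. is_arc E \<and> U \<subseteq> E" using D(1) by (auto simp: C_def)
  then obtain F where F: "\<And>U. U \<in> D \<Longrightarrow> is_arc (F U) \<and> U \<subseteq> F U" by metis
  show ?thesis
  proof (rule that[of "F ` D"])
    show "M \<subseteq> \<Union> (F ` D)"
    proof
      fix x assume "x \<in> M"
      then obtain U where "U \<in> D" "x \<in> U" using D(3) by blast
      thus "x \<in> \<Union> (F ` D)" using F[of U] by blast
    qed
  qed (use D(2) F in auto)
qed

lemma arc_in_sets: "is_arc E \<Longrightarrow> E \<in> sets A"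
  unfolding is_arc_def by (auto intro!: chart_image_in_sets)

lemma emeasure_arc: "is_arc E \<Longrightarrow> emeasure A E < \<infinity>"
  unfolding is_arc_def by (auto simp: emeasure_chart_image)

lemma finite_measure_A: "finite_measure A"
proof
  obtain D where D: "finite D" "\<And>E. E \<in> D \<Longrightarrow> is_arc E" "M \<subseteq> \<Union>D"
    by (rule finite_arc_cover) blast
  have "(\<Union>E\<in>D. E) \<in> sets A" using D arc_in_sets by (intro sets.finite_UN) auto
  hence "emeasure A M \<le> emeasure A (\<Union>E\<in>D. E)" using D(3) by (intro emeasure_mono) auto
  also have "\<dots> \<le> (\<Sum>E\<in>D. emeasure A E)"
    using D arc_in_sets by (intro emeasure_subadditive_finite) auto
  also have "\<dots> < \<infinity>" using D emeasure_arc by simp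
  finally show "emeasure A (space A) \<noteq> \<infinity>" by simp
qed

lemma singleton_null:
  assumes "p \<in> M"
  shows "{p} \<in> null_sets A"
proof -
  obtain U E where "is_arc E" "p \<in> U" "U \<subseteq> E" by (rule arc_around[OF assms]) blast
  then obtain I \<gamma> t where t: "unit_speed_param M I \<gamma>" "t \<in> I" "p = \<gamma> t"
    unfolding is_arc_def by blast
  have "\<gamma> ` {t} \<in> sets A" "emeasure A (\<gamma> ` {t}) = 0"
    using chart_image_in_sets[OF t(1), of "{t}"] emeasure_chart_image[OF t(1), of "{t}"] t(2) by auto
  thus ?thesis by (simp add: t(3) null_sets_def)
qed

lemma cont_\<nu>: "continuous_on M \<nu>" using \<nu> by (simp add: outward_unit_normal_def)

lemma \<nu>_measurable [measurable]: "\<nu> \<in> borel_measurable A"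
  unfolding measurable_cong_sets[OF sets_A_eq refl]
  by (rule borel_measurable_continuous_on_restrict[OF cont_\<nu>])

lemma id_measurable [measurable]: "(\<lambda>x. x) \<in> borel_measurable A"
  unfolding measurable_cong_sets[OF sets_A_eq refl]
  by (rule borel_measurable_continuous_on_restrict) auto

text \<open>Cutting the arcs of a finite cover off one after the other splits the curve into disjoint Borel pieces, each
contained in a single arc.\<close>

lemma additive_induct:
  assumes arc: "\<And>E B. is_arc E \<Longrightarrow> B \<in> sets A \<Longrightarrow> B \<subseteq> E \<Longrightarrow> P B"
    and Un: "\<And>B C. B \<in> sets A \<Longrightarrow> C \<in> sets A \<Longrightarrow> B \<inter> C = {} \<Longrightarrow> P B \<Longrightarrow> P C \<Longrightarrow> P (B \<union> C)"
  shows "P M"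
proof -
  obtain D where D: "finite D" "\<And>E. E \<in> D \<Longrightarrow> is_arc E" "M \<subseteq> \<Union>D"
    by (rule finite_arc_cover) blast
  have "P B" if "B \<in> sets A" "B \<subseteq> \<Union>D" for B
    using D(1,2) that
  proof (induction D arbitrary: B rule: finite_induct)
    case empty
    obtain p where "p \<in> M" using M by (auto simp: compact_smooth_curve_def)
    then obtain E where "is_arc E" by (rule arc_around) blast
    thus ?case using arc[of E B] empty by auto
  next
    case (insert E D)
    have E: "is_arc E" "E \<in> sets A" using insert.prems arc_in_sets by auto
    have "P ((B \<inter> E) \<union> (B - E))"
    proof (rule Un)
      show "P (B \<inter> E)" using E insert.prems by (intro arc[of E]) auto
      show "P (B - E)" using E insert.prems by (intro insert.IH) auto
    qed (use E insert.prems in auto)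
    thus ?case by (simp add: Int_Diff_Un)
  qed
  moreover have "M \<in> sets A" using sets.top[of A] by simp
  ultimately show ?thesis using D(3) by blast
qed

end

section \<open>Holomorphic dependence of integrals on a parameter\<close>

text \<open>Cauchy's inequality bounds the derivative on the smaller disc, hence also the difference quotients. This supplies the dominating
constant for differentiation under the integral.\<close>

lemma difference_quotient_bound:
  assumes holo: "g holomorphic_on ball s0 r" and r: "r > 0" and b: "\<And>s. s \<in> ball s0 r \<Longrightarrow> norm (g s) \<le> C"
    and s: "s \<in> ball s0 (r/2)" "s \<noteq> s0"
  shows "norm ((g s - g s0) / (s - s0)) \<le> 4 * C / r"
proof -
  have d: "norm (deriv g z) \<le> 4 * C / r" if z: "z \<in> ball s0 (r/2)" for z
  proof -
    have sub: "cball z (r/4) \<subseteq> ball s0 r"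
    proof
      fix x assume "x \<in> cball z (r/4)"
      thus "x \<in> ball s0 r" using z r dist_triangle[of s0 x z] by auto
    qed
    have "norm ((deriv ^^ 1) g z) \<le> fact 1 * C / (r/4) ^ 1"
    proof (rule Cauchy_inequality)
      show "g holomorphic_on ball z (r/4)"
        using holo holomorphic_on_subset sub ball_subset_cball by (metis order_trans)
      show "continuous_on (cball z (r/4)) g"
        using holo sub holomorphic_on_imp_continuous_on continuous_on_subset by metis
      show "norm (g x) \<le> C" if "norm (z - x) = r/4" for x
        using that sub by (intro b) (auto simp: dist_norm subset_eq)
    qed (use r in auto)
    thus ?thesis by (simp add: mult.commute)
  qed
  have "norm (g s - g s0) \<le> 4 * C / r * norm (s - s0)"
  proof (rule field_differentiable_bound[of "ball s0 (r/2)" g "deriv g"])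
    fix z assume z: "z \<in> ball s0 (r/2)"
    hence "z \<in> ball s0 r" using r by auto
    thus "(g has_field_derivative deriv g z) (at z within ball s0 (r/2))"
      using holo holomorphic_derivI[OF holo open_ball] has_field_derivative_at_within by blast
  qed (use d s r in auto)
  thus ?thesis using s by (simp add: norm_divide field_simps)
qed

text \<open>Local boundedness of the integrand already bounds its difference quotients, and dominated convergence then gives the
complex derivative of the integral.\<close>

lemma holomorphic_on_lebesgue_integral:
  fixes f :: "complex \<Rightarrow> 'a \<Rightarrow> complex"
  assumes fin: "finite_measure M" and U: "open U"
    and meas: "\<And>s. s \<in> U \<Longrightarrow> f s \<in> borel_measurable M"
    and holo: "\<And>x. x \<in> space M \<Longrightarrow> (\<lambda>s. f s x) holomorphic_on U"
    and bound: "\<And>s0. s0 \<in> U \<Longrightarrow> \<exists>r>0. \<exists>C. \<forall>s\<in>ball s0 r. \<forall>x\<in>space M. norm (f s x) \<le> C"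
  shows "(\<lambda>s. \<integral>x. f s x \<partial>M) holomorphic_on U"
  unfolding holomorphic_on_open[OF U]
proof
  interpret finite_measure M by fact
  fix s0 assume s0: "s0 \<in> U"
  obtain r1 C where r1: "r1 > 0" "\<And>s x. s \<in> ball s0 r1 \<Longrightarrow> x \<in> space M \<Longrightarrow> norm (f s x) \<le> C"
    using bound[OF s0] by blast
  obtain r2 where r2: "r2 > 0" "ball s0 r2 \<subseteq> U" using U s0 open_contains_ball by blast
  define r where "r = min r1 r2"
  have r: "r > 0" "ball s0 r \<subseteq> U" "\<And>s x. s \<in> ball s0 r \<Longrightarrow> x \<in> space M \<Longrightarrow> norm (f s x) \<le> C"
    using r1 r2 by (auto simp: r_def subset_eq)
  have s0r: "s0 \<in> ball s0 r" using r by simp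
  have integ: "integrable M (f s)" if "s \<in> ball s0 r" for s
    by (rule integrable_const_bound[of _ C]) (use that r meas in \<open>auto intro!: AE_I2\<close>)
  define q where "q = (\<lambda>s x. (f s x - f s0 x) / (s - s0))"
  define f' where "f' = (\<lambda>x. deriv (\<lambda>s. f s x) s0)"
  have f': "((\<lambda>s. q s x) \<longlongrightarrow> f' x) (at s0)" if "x \<in> space M" for x
    using holomorphic_derivI[OF holo[OF that] U s0] by (simp add: q_def f'_def has_field_derivative_iff)
  have lim: "(\<lambda>n. \<integral>x. q (X n) x \<partial>M) \<longlonglongrightarrow> (\<integral>x. f' x \<partial>M)"
    if X: "\<And>n. X n \<in> ball s0 (r/2)" "\<And>n. X n \<noteq> s0" "X \<longlonglongrightarrow> s0" for X
  proof (rule integral_dominated_convergence[where w="\<lambda>_. 4 * C / r"])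
    have l: "(\<lambda>n. q (X n) x) \<longlonglongrightarrow> f' x" if "x \<in> space M" for x
      using f'[OF that] X(2,3) by (auto simp: tendsto_at_iff_sequentially o_def)
    show mq: "q (X n) \<in> borel_measurable M" for n
    proof -
      have "X n \<in> U" using X(1)[of n] r by (auto simp: subset_eq)
      thus ?thesis unfolding q_def using meas s0 by (intro borel_measurable_divide borel_measurable_diff) auto
    qed
    show "f' \<in> borel_measurable M"
      by (rule borel_measurable_LIMSEQ_metric[of "\<lambda>n. q (X n)"]) (use mq l in auto)
    show "AE x in M. (\<lambda>n. q (X n) x) \<longlonglongrightarrow> f' x" using l by (rule AE_I2)
    show "AE x in M. norm (q (X n) x) \<le> 4 * C / r" for n
    proof (rule AE_I2)
      fix x assume x: "x \<in> space M"
      show "norm (q (X n) x) \<le> 4 * C / r" unfolding q_def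
        by (rule difference_quotient_bound[OF holomorphic_on_subset[OF holo[OF x] r(2)] r(1) r(3)[OF _ x] X(1,2)])
    qed
  qed auto
  have "((\<lambda>s. ((\<integral>x. f s x \<partial>M) - (\<integral>x. f s0 x \<partial>M)) / (s - s0)) \<longlongrightarrow> (\<integral>x. f' x \<partial>M)) (at s0)"
    unfolding tendsto_at_iff_sequentially
  proof safe
    fix X :: "nat \<Rightarrow> complex" assume X: "\<forall>i. X i \<in> UNIV - {s0}" "X \<longlonglongrightarrow> s0"
    have "\<forall>\<^sub>F n in sequentially. X n \<in> ball s0 (r/2)"
      using X(2) r(1) by (intro topological_tendstoD) auto
    then obtain n0 where n0: "\<And>n. n \<ge> n0 \<Longrightarrow> X n \<in> ball s0 (r/2)" by (auto simp: eventually_sequentially)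
    have "(\<lambda>n. \<integral>x. q (X (n + n0)) x \<partial>M) \<longlonglongrightarrow> (\<integral>x. f' x \<partial>M)"
      by (rule lim) (use X n0 LIMSEQ_ignore_initial_segment[OF X(2)] in auto)
    moreover have "(\<integral>x. q (X (n + n0)) x \<partial>M) = ((\<integral>x. f (X (n+n0)) x \<partial>M) - (\<integral>x. f s0 x \<partial>M)) / (X (n+n0) - s0)" for n
    proof -
      have "X (n + n0) \<in> ball s0 r" using n0[of "n + n0"] r(1) by auto
      thus ?thesis unfolding q_def by (simp add: integ s0r r(1))
    qed
    ultimately have "(\<lambda>n. ((\<integral>x. f (X (n+n0)) x \<partial>M) - (\<integral>x. f s0 x \<partial>M)) / (X (n+n0) - s0)) \<longlonglongrightarrow> (\<integral>x. f' x \<partial>M)"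
      by simp
    from LIMSEQ_offset[OF this]
    show "((\<lambda>s. ((\<integral>x. f s x \<partial>M) - (\<integral>x. f s0 x \<partial>M)) / (s - s0)) \<circ> X) \<longlonglongrightarrow> (\<integral>x. f' x \<partial>M)"
      by (simp add: o_def)
  qed
  thus "\<exists>f'. ((\<lambda>s. \<integral>x. f s x \<partial>M) has_field_derivative f') (at s0)"
    by (auto simp: has_field_derivative_iff)
qed

section \<open>Uniform Taylor expansions with power series coefficients\<close>

text \<open>From here on \<open>$\<close> denotes coefficients of formal power series.\<close>

no_notation vec_nth (infixl \<open>$\<close> 90)

text \<open>Functions of \<open>s\<close>, \<open>t\<close> and \<open>h\<close>, bounded uniformly in \<open>t \<in> X\<close> and \<open>0 < \<bar>h\<bar> < \<epsilon>\<close> as long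
as \<open>s\<close> stays in a bounded set. The point \<open>h = 0\<close> is left out because quotients by powers of \<open>h\<close> occur.\<close>

definition loc_bounded :: "real set \<Rightarrow> real \<Rightarrow> (complex \<Rightarrow> real \<Rightarrow> real \<Rightarrow> complex) \<Rightarrow> bool" where
  "loc_bounded X \<epsilon> g \<longleftrightarrow>
     (\<forall>r. \<exists>C. \<forall>s\<in>ball 0 r. \<forall>t\<in>X. \<forall>h. 0 < \<bar>h\<bar> \<and> \<bar>h\<bar> < \<epsilon> \<longrightarrow> norm (g s t h) \<le> C)"

text \<open>What is asked of the Taylor coefficients: enough regularity in \<open>t\<close> to integrate them and in \<open>s\<close> to get holomorphic
integrals.\<close>

definition entire_family :: "real set \<Rightarrow> (complex \<Rightarrow> real \<Rightarrow> complex) \<Rightarrow> bool" where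
  "entire_family X c \<longleftrightarrow>
     (\<forall>s. continuous_on X (c s)) \<and> (\<forall>t\<in>X. (\<lambda>s. c s t) holomorphic_on UNIV) \<and>
     (\<forall>r. \<exists>C. \<forall>s\<in>ball 0 r. \<forall>t\<in>X. norm (c s t) \<le> C)"

definition taylor_remainder ::
  "nat \<Rightarrow> (complex \<Rightarrow> real \<Rightarrow> real \<Rightarrow> complex) \<Rightarrow> (complex \<Rightarrow> real \<Rightarrow> complex fps) \<Rightarrow> complex \<Rightarrow> real \<Rightarrow> real \<Rightarrow> complex" where
  "taylor_remainder n f F s t h = (f s t h - (\<Sum>k<n. F s t $ k * of_real h ^ k)) / of_real h ^ n"

text \<open>The formal power series \<open>F\<close> is an asymptotic expansion of \<open>f\<close> at \<open>h = 0\<close> up to \<open>O(h\<^sup>n)\<close>, uniformly in the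
parameters. Recording the coefficients in a formal power series makes the expansion of a product the product of the expansions.\<close>

definition expands ::
  "nat \<Rightarrow> real set \<Rightarrow> real \<Rightarrow> (complex \<Rightarrow> real \<Rightarrow> real \<Rightarrow> complex) \<Rightarrow> (complex \<Rightarrow> real \<Rightarrow> complex fps) \<Rightarrow> bool" where
  "expands n X \<epsilon> f F \<longleftrightarrow>
     (\<forall>k. entire_family X (\<lambda>s t. F s t $ k)) \<and>
     loc_bounded X \<epsilon> (taylor_remainder n f F)"

lemma loc_bounded_D:
  assumes "loc_bounded X \<epsilon> g"
  obtains C where "C \<ge> 0" "\<And>s t h. \<lbrakk>s \<in> ball 0 r; t \<in> X; 0 < \<bar>h\<bar>; \<bar>h\<bar> < \<epsilon>\<rbrakk> \<Longrightarrow> norm (g s t h) \<le> C"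
proof -
  obtain C where C: "\<forall>s\<in>ball 0 r. \<forall>t\<in>X. \<forall>h. 0 < \<bar>h\<bar> \<and> \<bar>h\<bar> < \<epsilon> \<longrightarrow> norm (g s t h) \<le> C"
    using assms unfolding loc_bounded_def by blast
  show ?thesis by (rule that[of "max 0 C"]) (use C in \<open>auto simp: le_max_iff_disj\<close>)
qed

lemma loc_bounded_mono:
  assumes "loc_bounded X \<epsilon> g"
    and "\<And>s t h. \<lbrakk>t \<in> X; 0 < \<bar>h\<bar>; \<bar>h\<bar> < \<epsilon>\<rbrakk> \<Longrightarrow> norm (f s t h) \<le> norm (g s t h)"
  shows "loc_bounded X \<epsilon> f"
  unfolding loc_bounded_def
proof
  fix r
  obtain C where C: "\<And>s t h. \<lbrakk>s \<in> ball 0 r; t \<in> X; 0 < \<bar>h\<bar>; \<bar>h\<bar> < \<epsilon>\<rbrakk> \<Longrightarrow> norm (g s t h) \<le> C"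
    using loc_bounded_D[OF assms(1)] by metis
  show "\<exists>C. \<forall>s\<in>ball 0 r. \<forall>t\<in>X. \<forall>h. 0 < \<bar>h\<bar> \<and> \<bar>h\<bar> < \<epsilon> \<longrightarrow> norm (f s t h) \<le> C"
    using C assms(2) order_trans by (intro exI[of _ C]) blast
qed

lemma loc_bounded_cong:
  assumes "\<And>s t h. \<lbrakk>t \<in> X; 0 < \<bar>h\<bar>; \<bar>h\<bar> < \<epsilon>\<rbrakk> \<Longrightarrow> f s t h = g s t h" "loc_bounded X \<epsilon> g"
  shows "loc_bounded X \<epsilon> f"
  by (rule loc_bounded_mono[OF assms(2)]) (simp add: assms(1))

lemma loc_bounded_add:
  assumes "loc_bounded X \<epsilon> f" "loc_bounded X \<epsilon> g"
  shows "loc_bounded X \<epsilon> (\<lambda>s t h. f s t h + g s t h)"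
  unfolding loc_bounded_def
proof
  fix r
  obtain C where C: "\<And>s t h. \<lbrakk>s \<in> ball 0 r; t \<in> X; 0 < \<bar>h\<bar>; \<bar>h\<bar> < \<epsilon>\<rbrakk> \<Longrightarrow> norm (f s t h) \<le> C"
    using loc_bounded_D[OF assms(1)] by metis
  obtain D where D: "\<And>s t h. \<lbrakk>s \<in> ball 0 r; t \<in> X; 0 < \<bar>h\<bar>; \<bar>h\<bar> < \<epsilon>\<rbrakk> \<Longrightarrow> norm (g s t h) \<le> D"
    using loc_bounded_D[OF assms(2)] by metis
  show "\<exists>C. \<forall>s\<in>ball 0 r. \<forall>t\<in>X. \<forall>h. 0 < \<bar>h\<bar> \<and> \<bar>h\<bar> < \<epsilon> \<longrightarrow> norm (f s t h + g s t h) \<le> C"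
    by (intro exI[of _ "C + D"] ballI allI impI norm_triangle_le add_mono C D) auto
qed

lemma loc_bounded_mult:
  assumes "loc_bounded X \<epsilon> f" "loc_bounded X \<epsilon> g"
  shows "loc_bounded X \<epsilon> (\<lambda>s t h. f s t h * g s t h)"
  unfolding loc_bounded_def
proof
  fix r
  obtain C where C: "C \<ge> 0" "\<And>s t h. \<lbrakk>s \<in> ball 0 r; t \<in> X; 0 < \<bar>h\<bar>; \<bar>h\<bar> < \<epsilon>\<rbrakk> \<Longrightarrow> norm (f s t h) \<le> C"
    using loc_bounded_D[OF assms(1)] by metis
  obtain D where D: "\<And>s t h. \<lbrakk>s \<in> ball 0 r; t \<in> X; 0 < \<bar>h\<bar>; \<bar>h\<bar> < \<epsilon>\<rbrakk> \<Longrightarrow> norm (g s t h) \<le> D"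
    using loc_bounded_D[OF assms(2)] by metis
  show "\<exists>C. \<forall>s\<in>ball 0 r. \<forall>t\<in>X. \<forall>h. 0 < \<bar>h\<bar> \<and> \<bar>h\<bar> < \<epsilon> \<longrightarrow> norm (f s t h * g s t h) \<le> C"
    by (intro exI[of _ "C * D"] ballI allI impI) (auto simp: norm_mult intro!: mult_mono C D)
qed

lemma loc_bounded_entire:
  assumes "entire_family X c"
  shows "loc_bounded X \<epsilon> (\<lambda>s t h. c s t)"
  using assms unfolding entire_family_def loc_bounded_def by meson

lemma entire_family_const: "entire_family X (\<lambda>s t. c)"
  by (auto simp: entire_family_def)

lemma loc_bounded_const: "loc_bounded X \<epsilon> (\<lambda>s t h. c)"
  by (rule loc_bounded_entire[OF entire_family_const])

lemma loc_bounded_sum: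
  assumes "\<And>i. i \<in> A \<Longrightarrow> loc_bounded X \<epsilon> (f i)"
  shows "loc_bounded X \<epsilon> (\<lambda>s t h. \<Sum>i\<in>A. f i s t h)"
  using assms
proof (induction A rule: infinite_finite_induct)
  case (insert x F)
  then show ?case by (simp add: loc_bounded_add)
qed (simp_all add: loc_bounded_const)

lemma loc_bounded_h: "loc_bounded X \<epsilon> (\<lambda>s t h. of_real h)"
  unfolding loc_bounded_def by (auto intro!: exI[of _ \<epsilon>])

lemma loc_bounded_power:
  "loc_bounded X \<epsilon> f \<Longrightarrow> loc_bounded X \<epsilon> (\<lambda>s t h. f s t h ^ n)"
  by (induction n) (simp_all add: loc_bounded_const loc_bounded_mult)

lemma entire_family_add:
  assumes "entire_family X c" "entire_family X d"
  shows "entire_family X (\<lambda>s t. c s t + d s t)"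
proof -
  have "\<exists>C. \<forall>s\<in>ball 0 r. \<forall>t\<in>X. norm (c s t + d s t) \<le> C" for r
  proof -
    obtain C where C: "\<And>s t. s \<in> ball 0 r \<Longrightarrow> t \<in> X \<Longrightarrow> norm (c s t) \<le> C"
      using assms(1) unfolding entire_family_def by meson
    obtain D where D: "\<And>s t. s \<in> ball 0 r \<Longrightarrow> t \<in> X \<Longrightarrow> norm (d s t) \<le> D"
      using assms(2) unfolding entire_family_def by meson
    show ?thesis by (intro exI[of _ "C + D"] ballI norm_triangle_le add_mono C D) auto
  qed
  with assms show ?thesis unfolding entire_family_def by (auto intro!: continuous_intros holomorphic_intros)
qed

lemma entire_family_mult:
  assumes "entire_family X c" "entire_family X d"
  shows "entire_family X (\<lambda>s t. c s t * d s t)"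
proof -
  have "\<exists>C. \<forall>s\<in>ball 0 r. \<forall>t\<in>X. norm (c s t * d s t) \<le> C" for r
  proof -
    obtain C where C: "\<And>s t. s \<in> ball 0 r \<Longrightarrow> t \<in> X \<Longrightarrow> norm (c s t) \<le> C"
      using assms(1) unfolding entire_family_def by meson
    obtain D where D: "\<And>s t. s \<in> ball 0 r \<Longrightarrow> t \<in> X \<Longrightarrow> norm (d s t) \<le> D"
      using assms(2) unfolding entire_family_def by meson
    have "norm (c s t * d s t) \<le> C * D" if "s \<in> ball 0 r" "t \<in> X" for s t
      unfolding norm_mult using C[OF that] D[OF that] by (intro mult_mono) (auto intro: order_trans[OF norm_ge_zero])
    thus ?thesis by blast
  qed
  with assms show ?thesis unfolding entire_family_def by (auto intro!: continuous_intros holomorphic_intros)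
qed

lemma entire_family_sum:
  "(\<And>i. i \<in> A \<Longrightarrow> entire_family X (c i)) \<Longrightarrow> entire_family X (\<lambda>s t. \<Sum>i\<in>A. c i s t)"
  by (induction A rule: infinite_finite_induct) (simp_all add: entire_family_const entire_family_add)

lemma entire_family_of_s:
  assumes "a holomorphic_on UNIV"
  shows "entire_family X (\<lambda>s t. a s)"
proof -
  have "\<exists>C. \<forall>s\<in>ball 0 r. norm (a s) \<le> C" for r
  proof -
    have "compact (a ` cball 0 r)"
      by (intro compact_continuous_image continuous_on_subset[OF holomorphic_on_imp_continuous_on[OF assms]]) auto
    then obtain C where "\<And>x. x \<in> a ` cball 0 r \<Longrightarrow> norm x \<le> C"
      using compact_imp_bounded bounded_iff by metis
    thus ?thesis by (intro exI[of _ C]) auto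
  qed
  thus ?thesis using assms unfolding entire_family_def by auto
qed

lemma entire_family_of_t:
  assumes "continuous_on X c" "compact X"
  shows "entire_family X (\<lambda>s t. c t)"
proof -
  have "compact (c ` X)" by (intro compact_continuous_image assms)
  then obtain C where "\<And>x. x \<in> c ` X \<Longrightarrow> norm x \<le> C"
    using compact_imp_bounded bounded_iff by metis
  thus ?thesis using assms unfolding entire_family_def by auto
qed

lemma expandsI:
  assumes "\<And>k. entire_family X (\<lambda>s t. F s t $ k)" "loc_bounded X \<epsilon> R"
    and "\<And>s t h. \<lbrakk>t \<in> X; 0 < \<bar>h\<bar>; \<bar>h\<bar> < \<epsilon>\<rbrakk> \<Longrightarrow>
       f s t h = (\<Sum>k<n. F s t $ k * of_real h ^ k) + of_real h ^ n * R s t h"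
  shows "expands n X \<epsilon> f F"
  unfolding expands_def
proof (intro conjI allI assms(1))
  show "loc_bounded X \<epsilon> (taylor_remainder n f F)"
    by (rule loc_bounded_cong[OF _ assms(2)]) (auto simp: assms(3) taylor_remainder_def)
qed

lemma expands_eq:
  assumes "0 < \<bar>h\<bar>"
  shows "f s t h = (\<Sum>k<n. F s t $ k * of_real h ^ k) + of_real h ^ n * taylor_remainder n f F s t h"
  using assms by (simp add: taylor_remainder_def)

lemma expandsD:
  assumes "expands n X \<epsilon> f F"
  shows "entire_family X (\<lambda>s t. F s t $ k)" "loc_bounded X \<epsilon> (taylor_remainder n f F)"
  using assms by (auto simp: expands_def)

lemma loc_bounded_expands:
  assumes "expands n X \<epsilon> f F"
  shows "loc_bounded X \<epsilon> f"
proof -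
  note R = expandsD[OF assms]
  show ?thesis
    by (rule loc_bounded_cong[OF expands_eq[where n=n and F=F]]) (auto intro!: loc_bounded_add loc_bounded_mult loc_bounded_sum loc_bounded_power loc_bounded_h R(2) loc_bounded_entire R(1))
qed

lemma expands_add:
  assumes "expands n X \<epsilon> f F" "expands n X \<epsilon> g G"
  shows "expands n X \<epsilon> (\<lambda>s t h. f s t h + g s t h) (\<lambda>s t. F s t + G s t)"
proof -
  note R = expandsD[OF assms(1)]
  note S = expandsD[OF assms(2)]
  show ?thesis
  proof (rule expandsI[OF _ loc_bounded_add[OF R(2) S(2)]])
    show "f s t h + g s t h = (\<Sum>k<n. (F s t + G s t) $ k * of_real h ^ k) +
      of_real h ^ n * (taylor_remainder n f F s t h + taylor_remainder n g G s t h)" if h: "0 < \<bar>h\<bar>" for s t h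
      by (subst expands_eq[OF h, of f s t F n], subst expands_eq[OF h, of g s t G n])
        (simp add: algebra_simps sum.distrib)
  qed (simp add: entire_family_add R(1) S(1))
qed

text \<open>The pairs \<open>(i, j)\<close> with \<open>i + j < n\<close> form the truncated Cauchy product; all others carry a factor \<open>h ^ n\<close>.\<close>

lemma truncated_product:
  fixes a b :: "nat \<Rightarrow> 'a::comm_ring_1"
  shows "(\<Sum>i<n. a i * h ^ i) * (\<Sum>j<n. b j * h ^ j) =
    (\<Sum>k<n. (\<Sum>i\<le>k. a i * b (k - i)) * h ^ k) +
    h ^ n * (\<Sum>(i,j)\<in>{(i,j). i < n \<and> j < n \<and> i + j \<ge> n}. a i * b j * h ^ (i + j - n))"
proof -
  have fin: "finite {(i::nat,j::nat). i < n \<and> j < n}"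
    by (rule finite_subset[of _ "{..<n} \<times> {..<n}"]) auto
  have "(\<Sum>i<n. a i * h ^ i) * (\<Sum>j<n. b j * h ^ j) = (\<Sum>(i,j)\<in>{..<n}\<times>{..<n}. a i * b j * h ^ (i + j))"
    by (simp add: sum_product sum.cartesian_product power_add mult_ac)
  also have "{..<n}\<times>{..<n} = {(i,j). i + j < n} \<union> {(i,j). i < n \<and> j < n \<and> i + j \<ge> n}" by auto
  also have "(\<Sum>(i,j)\<in>\<dots>. a i * b j * h ^ (i + j)) =
      (\<Sum>(i,j)\<in>{(i,j). i + j < n}. a i * b j * h ^ (i + j)) +
      (\<Sum>(i,j)\<in>{(i,j). i < n \<and> j < n \<and> i + j \<ge> n}. a i * b j * h ^ (i + j))"
    by (rule sum.union_disjoint) (auto intro: finite_subset[OF _ fin])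
  also have "(\<Sum>(i,j)\<in>{(i,j). i + j < n}. a i * b j * h ^ (i + j)) = (\<Sum>k<n. (\<Sum>i\<le>k. a i * b (k - i)) * h ^ k)"
    by (simp add: sum.triangle_reindex sum_distrib_right)
  also have "(\<Sum>(i,j)\<in>{(i,j). i < n \<and> j < n \<and> i + j \<ge> n}. a i * b j * h ^ (i + j)) =
     h ^ n * (\<Sum>(i,j)\<in>{(i,j). i < n \<and> j < n \<and> i + j \<ge> n}. a i * b j * h ^ (i + j - n))"
    unfolding sum_distrib_left
    by (rule sum.cong) (auto simp: power_add[symmetric] mult_ac)
  finally show ?thesis .
qed

lemma expands_mult:
  assumes "expands n X \<epsilon> f F" "expands n X \<epsilon> g G"
  shows "expands n X \<epsilon> (\<lambda>s t h. f s t h * g s t h) (\<lambda>s t. F s t * G s t)"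
proof -
  note R = expandsD[OF assms(1)]
  note S = expandsD[OF assms(2)]
  define Z where "Z = {(i::nat,j::nat). i < n \<and> j < n \<and> i + j \<ge> n}"
  define W where "W = (\<lambda>s t h. (\<Sum>p\<in>Z. F s t $ fst p * G s t $ snd p * of_real h ^ (fst p + snd p - n)) +
     taylor_remainder n f F s t h * g s t h + (\<Sum>k<n. F s t $ k * of_real h ^ k) * taylor_remainder n g G s t h)"
  show ?thesis
  proof (rule expandsI[where R=W])
    show "entire_family X (\<lambda>s t. (F s t * G s t) $ k)" for k
      unfolding fps_mult_nth by (intro entire_family_sum entire_family_mult R(1) S(1))
    show "loc_bounded X \<epsilon> W"
      unfolding W_def
      by (intro loc_bounded_add loc_bounded_mult loc_bounded_sum loc_bounded_power loc_bounded_h R(2) S(2) loc_bounded_entire R(1) S(1) loc_bounded_expands[OF assms(2)])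
    fix s t h assume th: "t \<in> X" "0 < \<bar>h\<bar>" "\<bar>h\<bar> < \<epsilon>"
    let ?P = "\<Sum>k<n. F s t $ k * of_real h ^ k" and ?Q = "\<Sum>k<n. G s t $ k * of_real h ^ k"
    have "f s t h = ?P + of_real h ^ n * taylor_remainder n f F s t h" "g s t h = ?Q + of_real h ^ n * taylor_remainder n g G s t h"
      using expands_eq[OF th(2)] by blast+
    hence "f s t h * g s t h = ?P * ?Q + of_real h ^ n * (taylor_remainder n f F s t h * g s t h + ?P * taylor_remainder n g G s t h)"
      by (simp add: ring_distribs mult_ac)
    also have "?P * ?Q = (\<Sum>k<n. (F s t * G s t) $ k * of_real h ^ k) +
      of_real h ^ n * (\<Sum>p\<in>Z. F s t $ fst p * G s t $ snd p * of_real h ^ (fst p + snd p - n))"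
      unfolding truncated_product Z_def fps_mult_nth by (simp add: atMost_atLeast0 case_prod_unfold)
    finally show "f s t h * g s t h = (\<Sum>k<n. (F s t * G s t) $ k * of_real h ^ k) + of_real h ^ n * W s t h"
      unfolding W_def by (simp add: algebra_simps)
  qed
qed

lemma expands_entire:
  assumes "entire_family X c" "n > 0"
  shows "expands n X \<epsilon> (\<lambda>s t h. c s t) (\<lambda>s t. fps_const (c s t))"
proof (rule expandsI[where R="\<lambda>_ _ _. 0"])
  show "entire_family X (\<lambda>s t. fps_const (c s t) $ k)" for k
    using assms by (cases k) (auto intro: entire_family_const)
  show "c s t = (\<Sum>k<n. fps_const (c s t) $ k * of_real h ^ k) + of_real h ^ n * 0" for s t h
    using assms(2) by (subst sum.remove[of _ 0]) auto
qed (rule loc_bounded_const)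

lemma expands_power:
  assumes "expands n X \<epsilon> f F" "n > 0"
  shows "expands n X \<epsilon> (\<lambda>s t h. f s t h ^ m) (\<lambda>s t. F s t ^ m)"
proof (induction m)
  case 0
  show ?case using expands_entire[OF entire_family_const assms(2), of X \<epsilon> 1] by simp
next
  case (Suc m)
  show ?case using expands_mult[OF assms(1) Suc] by simp
qed

lemma expands_sum:
  assumes "finite A" "n > 0" "\<And>i. i \<in> A \<Longrightarrow> expands n X \<epsilon> (f i) (F i)"
  shows "expands n X \<epsilon> (\<lambda>s t h. \<Sum>i\<in>A. f i s t h) (\<lambda>s t. \<Sum>i\<in>A. F i s t)"
  using assms(1,3)
proof (induction A rule: finite_induct)
  case empty
  show ?case using expands_entire[OF entire_family_const assms(2), of X \<epsilon> 0] by simp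
next
  case (insert x F)
  then show ?case by (simp add: expands_add)
qed

lemma expands_divide_h:
  assumes "expands (Suc n) X \<epsilon> f F" "\<And>s t. t \<in> X \<Longrightarrow> F s t $ 0 = 0"
  shows "expands n X \<epsilon> (\<lambda>s t h. f s t h / of_real h) (\<lambda>s t. fps_shift 1 (F s t))"
proof -
  note R = expandsD[OF assms(1)]
  show ?thesis
  proof (rule expandsI[OF _ R(2)])
    show "entire_family X (\<lambda>s t. fps_shift 1 (F s t) $ k)" for k by (simp add: R(1))
    show "f s t h / of_real h = (\<Sum>k<n. fps_shift 1 (F s t) $ k * of_real h ^ k) + of_real h ^ n * taylor_remainder (Suc n) f F s t h"
      if th: "t \<in> X" "0 < \<bar>h\<bar>" "\<bar>h\<bar> < \<epsilon>" for s t h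
      using th by (subst expands_eq[OF th(2), of f s t F "Suc n"], subst sum.lessThan_Suc_shift) (simp add: assms(2) sum_distrib_left add_divide_distrib sum_divide_distrib)
  qed
qed

text \<open>The Lagrange form of the remainder is bounded by \<open>C / fact n\<close> for all \<open>t\<close> at once; this is where uniformity in the base
point enters.\<close>

lemma expands_taylor:
  fixes D :: "nat \<Rightarrow> real \<Rightarrow> real \<Rightarrow> real"
  assumes X: "compact X" and n: "n > 0"
    and deriv: "\<And>j t h. \<lbrakk>j < n; t \<in> X; \<bar>h\<bar> < \<epsilon>\<rbrakk> \<Longrightarrow> (D j t has_real_derivative D (Suc j) t h) (at h)"
    and cont: "\<And>j. j < n \<Longrightarrow> continuous_on X (\<lambda>t. D j t 0)"
    and bound: "\<And>t h. \<lbrakk>t \<in> X; \<bar>h\<bar> < \<epsilon>\<rbrakk> \<Longrightarrow> \<bar>D n t h\<bar> \<le> C"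
  shows "expands n X \<epsilon> (\<lambda>s t h. of_real (D 0 t h))
    (\<lambda>s t. Abs_fps (\<lambda>j. if j < n then of_real (D j t 0 / fact j) else 0))"
proof (rule expandsI)
  show "entire_family X (\<lambda>s t. Abs_fps (\<lambda>j. if j < n then of_real (D j t 0 / fact j) else 0) $ k)" for k
    by (cases "k < n") (auto intro!: entire_family_of_t X continuous_intros cont entire_family_const)
  define R where "R = (\<lambda>t h. (D 0 t h - (\<Sum>m<n. D m t 0 / fact m * h ^ m)) / h ^ n)"
  have "norm (complex_of_real (R t h)) \<le> C / fact n" if th: "t \<in> X" "0 < \<bar>h\<bar>" "\<bar>h\<bar> < \<epsilon>" for t h
  proof -
    have "\<exists>u. \<bar>u\<bar> \<le> \<bar>h\<bar> \<and> D 0 t h = (\<Sum>m<n. D m t 0 / fact m * h ^ m) + D n t u / fact n * h ^ n"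
      by (rule Maclaurin_bi_le) (use deriv th in auto)
    then obtain u where u: "\<bar>u\<bar> \<le> \<bar>h\<bar>" "D 0 t h = (\<Sum>m<n. D m t 0 / fact m * h ^ m) + D n t u / fact n * h ^ n"
      by blast
    have "R t h = D n t u / fact n" unfolding R_def u(2) using th by simp
    thus ?thesis using bound[OF th(1), of u] u(1) th(3) by (simp add: norm_divide divide_right_mono)
  qed
  thus "loc_bounded X \<epsilon> (\<lambda>s t h. of_real (R t h))"
    unfolding loc_bounded_def by blast
  show "complex_of_real (D 0 t h) = (\<Sum>k<n. Abs_fps (\<lambda>j. if j < n then complex_of_real (D j t 0 / fact j) else 0) $ k * of_real h ^ k) +
       of_real h ^ n * of_real (R t h)" if "0 < \<bar>h\<bar>" for s t h
  proof -
    have "(\<Sum>k<n. Abs_fps (\<lambda>j. if j < n then of_real (D j t 0 / fact j) else 0) $ k * of_real h ^ k)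
       = complex_of_real (\<Sum>m<n. D m t 0 / fact m * h ^ m)" by simp
    moreover have "D 0 t h = (\<Sum>m<n. D m t 0 / fact m * h ^ m) + h ^ n * R t h"
      using that by (simp add: R_def)
    ultimately show ?thesis by (simp only: of_real_add of_real_mult of_real_power)
  qed
qed

text \<open>The right-hand side is the binomial coefficient of \<open>-r\<close> up to sign, so the binomial series of exponent \<open>-r\<close> dominates all series
with exponents of norm at most \<open>r\<close>.\<close>

lemma norm_gbinomial_le:
  fixes a :: complex
  assumes "norm a \<le> r"
  shows "norm (a gchoose n) \<le> pochhammer r n / fact n"
proof -
  have "norm (pochhammer (- a) n) \<le> pochhammer r n"
  proof (induction n)
    case (Suc n)
    have "norm (- a + of_nat n) \<le> r + n"
      using norm_triangle_ineq[of "- a" "of_nat n"] assms by simp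
    with Suc show ?case by (auto simp: pochhammer_Suc norm_mult intro!: mult_mono intro: order_trans[OF norm_ge_zero])
  qed auto
  thus ?thesis by (simp add: gbinomial_pochhammer norm_divide norm_mult norm_power divide_right_mono)
qed

text \<open>The point is that \<open>C\<close> depends on \<open>r\<close> only: it comes from the tail at \<open>-1/2\<close> of the dominating binomial series of exponent \<open>-r\<close>.\<close>

lemma binomial_series_remainder:
  assumes "r \<ge> 0"
  obtains C where "C \<ge> 0"
    "\<And>(a::complex) e. \<lbrakk>norm a \<le> r; \<bar>e\<bar> \<le> 1/2\<rbrakk> \<Longrightarrow>
       norm (of_real (1 + e) powr a - (\<Sum>j<m. (a gchoose j) * of_real e ^ j)) \<le> C * \<bar>e\<bar> ^ m"
proof -
  define p where "p = (\<lambda>n. pochhammer r n / fact n)"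
  have p0: "p n \<ge> 0" for n using assms by (auto simp: p_def pochhammer_prod intro!: divide_nonneg_nonneg prod_nonneg)
  have "(\<lambda>n. (-r gchoose n) * (-1/2) ^ n) sums (1 + (-1/2)) powr (-r)"
    by (rule gen_binomial_real) auto
  hence "summable (\<lambda>n. (-r gchoose n) * (-1/2) ^ n)" by (rule sums_summable)
  also have "(\<lambda>n. (-r gchoose n) * (-1/2) ^ n) = (\<lambda>n. p n * (1/2) ^ n)"
    by (auto simp: p_def gbinomial_pochhammer power_mult_distrib[symmetric] fun_eq_iff)
  finally have sp: "summable (\<lambda>n. p n * (1/2) ^ n)" .
  define C where "C = (\<Sum>n. p (n + m) * (1/2) ^ (n + m)) * 2 ^ m"
  have sp': "summable (\<lambda>n. p (n + m) * (1/2) ^ (n + m))" using summable_ignore_initial_segment[OF sp] .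
  have C0: "C \<ge> 0" unfolding C_def using p0 by (intro mult_nonneg_nonneg suminf_nonneg sp') auto
  show ?thesis
  proof (rule that[OF C0])
    fix a :: complex and e :: real
    assume a: "norm a \<le> r" and e: "\<bar>e\<bar> \<le> 1/2"
    let ?c = "\<lambda>n. (a gchoose n) * of_real e ^ n"
    have s: "?c sums ((1 + of_real e) powr a)"
      by (rule gen_binomial_complex) (use e in auto)
    have eq: "of_real (1 + e) powr a - (\<Sum>j<m. ?c j) = (\<Sum>n. ?c (n + m))"
      using sums_split_initial_segment[OF s, of m] by (simp add: sums_iff)
    have b: "norm (?c (n + m)) \<le> p (n + m) * (1/2) ^ (n + m) * (2 ^ m * \<bar>e\<bar> ^ m)" for n
    proof -
      have "norm (?c (n + m)) \<le> p (n + m) * (\<bar>e\<bar> ^ n * \<bar>e\<bar> ^ m)"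
        unfolding norm_mult norm_power p_def power_add
        by (intro mult_mono norm_gbinomial_le a) (use p0 assms in \<open>auto simp: pochhammer_prod intro!: divide_nonneg_nonneg prod_nonneg\<close>)
      also have "\<dots> \<le> p (n + m) * ((1/2) ^ n * \<bar>e\<bar> ^ m)"
        using p0 e by (intro mult_left_mono mult_right_mono power_mono) auto
      finally show ?thesis by (simp add: power_add power_divide)
    qed
    have sb: "summable (\<lambda>n. p (n + m) * (1/2) ^ (n + m) * (2 ^ m * \<bar>e\<bar> ^ m))"
      by (rule summable_mult2[OF sp'])
    have "norm (of_real (1 + e) powr a - (\<Sum>j<m. ?c j)) \<le> (\<Sum>n. p (n + m) * (1/2) ^ (n + m) * (2 ^ m * \<bar>e\<bar> ^ m))"
      unfolding eq by (rule norm_suminf_le[OF b sb])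
    also have "\<dots> = C * \<bar>e\<bar> ^ m" by (simp add: suminf_mult2[OF sp', symmetric] C_def)
    finally show "norm (of_real (1 + e) powr a - (\<Sum>j<m. ?c j)) \<le> C * \<bar>e\<bar> ^ m" .
  qed
qed

text \<open>Since \<open>g - 1 = O(h\<^sup>2)\<close>, four terms of the binomial series of \<open>g powr a = (1 + (g - 1)) powr a\<close> already give an error
\<open>O(h\<^sup>8)\<close>.\<close>

lemma expands_powr:
  fixes g :: "real \<Rightarrow> real \<Rightarrow> real"
  assumes g: "expands 8 X \<epsilon> (\<lambda>s t h. of_real (g t h)) G"
    and G: "\<And>s t. t \<in> X \<Longrightarrow> G s t $ 0 = 1" "\<And>s t. t \<in> X \<Longrightarrow> G s t $ 1 = 0"
    and close: "\<And>t h. \<lbrakk>t \<in> X; 0 < \<bar>h\<bar>; \<bar>h\<bar> < \<epsilon>\<rbrakk> \<Longrightarrow> \<bar>g t h - 1\<bar> \<le> 1/2"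
    and a: "a holomorphic_on UNIV"
  shows "expands 8 X \<epsilon> (\<lambda>s t h. of_real (g t h) powr a s)
    (\<lambda>s t. \<Sum>j<4. fps_const (a s gchoose j) * (G s t - 1) ^ j)"
proof -
  have e: "expands 8 X \<epsilon> (\<lambda>s t h. of_real (g t h - 1)) (\<lambda>s t. G s t - 1)"
    using expands_add[OF g expands_entire[OF entire_family_const, of 8 X \<epsilon> "-1"]]
    by (simp add: fps_const_neg[symmetric] del: fps_const_neg)
  have "expands 8 X \<epsilon> (\<lambda>s t h. \<Sum>j<4. (a s gchoose j) * of_real (g t h - 1) ^ j)
    (\<lambda>s t. \<Sum>j<4. fps_const (a s gchoose j) * (G s t - 1) ^ j)"
    by (intro expands_sum expands_mult expands_entire expands_power[OF e] entire_family_of_s)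
       (auto intro!: holomorphic_intros a simp: gbinomial_prod_rev)
  note R = expandsD[OF this]
  define S where "S = (\<lambda>s t h. (of_real (g t h) powr a s - (\<Sum>j<4. (a s gchoose j) * of_real (g t h - 1) ^ j)) / of_real h ^ 8)"
  \<comment> \<open>The binomial remainder is \<open>O((g - 1)\<^sup>4)\<close>; the vanishing of two coefficients of \<open>G - 1\<close> turns this into \<open>O(h\<^sup>8)\<close>.\<close>
  have e2: "loc_bounded X \<epsilon> (\<lambda>s t h. of_real ((g t h - 1) / h ^ 2))"
  proof -
    note E = expandsD[OF e]
    show ?thesis
    proof (rule loc_bounded_cong)
      show "loc_bounded X \<epsilon> (\<lambda>s t h. (\<Sum>k<6. (G s t - 1) $ (k + 2) * of_real h ^ k) + of_real h ^ 6 * taylor_remainder 8 (\<lambda>s t h. of_real (g t h - 1)) (\<lambda>s t. G s t - 1) s t h)"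
        by (intro loc_bounded_add loc_bounded_mult loc_bounded_sum loc_bounded_power loc_bounded_h E(2) loc_bounded_entire E(1))
      fix s t h assume th: "t \<in> X" "0 < \<bar>h\<bar>" "\<bar>h\<bar> < \<epsilon>"
      have "(\<Sum>k<8. (G s t - 1) $ k * of_real h ^ k) = (\<Sum>k<6. (G s t - 1) $ (k + 2) * of_real h ^ (k + 2))"
        using G[OF th(1)] by (simp add: eval_nat_numeral lessThan_Suc)
      hence "of_real (g t h - 1) = (\<Sum>k<6. (G s t - 1) $ (k + 2) * of_real h ^ (k + 2)) +
          of_real h ^ 8 * taylor_remainder 8 (\<lambda>s t h. of_real (g t h - 1)) (\<lambda>s t. G s t - 1) s t h"
        using expands_eq[OF th(2), of "\<lambda>s t h. of_real (g t h - 1)" s t "\<lambda>s t. G s t - 1" 8] by simp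
      moreover have "(\<Sum>k<6. (G s t - 1) $ (k + 2) * complex_of_real h ^ (k + 2)) =
          of_real h ^ 2 * (\<Sum>k<6. (G s t - 1) $ (k + 2) * of_real h ^ k)"
        by (simp only: sum_distrib_left power_add mult_ac)
      moreover have "complex_of_real h ^ 8 = of_real h ^ 2 * of_real h ^ 6"
        by (simp flip: power_add)
      ultimately have "of_real (g t h - 1) = of_real h ^ 2 * ((\<Sum>k<6. (G s t - 1) $ (k + 2) * of_real h ^ k) +
          of_real h ^ 6 * taylor_remainder 8 (\<lambda>s t h. of_real (g t h - 1)) (\<lambda>s t. G s t - 1) s t h)"
        by (simp only: distrib_left mult.assoc)
      thus "of_real ((g t h - 1) / h ^ 2) = (\<Sum>k<6. (G s t - 1) $ (k + 2) * of_real h ^ k) + of_real h ^ 6 * taylor_remainder 8 (\<lambda>s t h. of_real (g t h - 1)) (\<lambda>s t. G s t - 1) s t h"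
        using th by (simp only: of_real_divide of_real_power) (simp add: nonzero_divide_eq_eq)
    qed
  qed
  have S: "loc_bounded X \<epsilon> S"
    unfolding loc_bounded_def
  proof
    fix r :: real
    have "entire_family X (\<lambda>s t. a s)" by (rule entire_family_of_s[OF a])
    hence "loc_bounded X \<epsilon> (\<lambda>s t h. a s)" by (rule loc_bounded_entire)
    then obtain A where A: "A \<ge> 0" "\<And>s t h. \<lbrakk>s \<in> ball 0 r; t \<in> X; 0 < \<bar>h\<bar>; \<bar>h\<bar> < \<epsilon>\<rbrakk> \<Longrightarrow> norm (a s) \<le> A"
      using loc_bounded_D by metis
    obtain D where D: "D \<ge> 0" "\<And>s t h. \<lbrakk>s \<in> ball (0::complex) r; t \<in> X; 0 < \<bar>h\<bar>; \<bar>h\<bar> < \<epsilon>\<rbrakk> \<Longrightarrow>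
        norm (complex_of_real ((g t h - 1) / h ^ 2)) \<le> D"
      using loc_bounded_D[OF e2] by metis
    obtain C where C: "C \<ge> 0" "\<And>(a::complex) e. \<lbrakk>norm a \<le> A; \<bar>e\<bar> \<le> 1/2\<rbrakk> \<Longrightarrow>
       norm (of_real (1 + e) powr a - (\<Sum>j<4. (a gchoose j) * of_real e ^ j)) \<le> C * \<bar>e\<bar> ^ 4"
      using binomial_series_remainder[OF A(1)] by metis
    have "norm (S s t h) \<le> C * D ^ 4" if th: "s \<in> ball 0 r" "t \<in> X" "0 < \<bar>h\<bar>" "\<bar>h\<bar> < \<epsilon>" for s t h
    proof -
      have "norm (S s t h) \<le> C * \<bar>g t h - 1\<bar> ^ 4 / \<bar>h\<bar> ^ 8"
        using C(2)[OF A(2)[OF th] close[OF th(2-4)]] unfolding S_def norm_divide norm_power norm_of_real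
        by (intro divide_right_mono) auto
      also have "\<dots> = C * (\<bar>(g t h - 1) / h ^ 2\<bar>) ^ 4"
        by (simp add: power_divide power_abs)
      also have "\<dots> \<le> C * D ^ 4"
        using D(2)[OF th] C(1) by (intro mult_left_mono power_mono) (auto simp del: of_real_divide)
      finally show ?thesis .
    qed
    thus "\<exists>C. \<forall>s\<in>ball 0 r. \<forall>t\<in>X. \<forall>h. 0 < \<bar>h\<bar> \<and> \<bar>h\<bar> < \<epsilon> \<longrightarrow> norm (S s t h) \<le> C" by blast
  qed
  show ?thesis
  proof (rule expandsI[OF R(1) loc_bounded_add[OF R(2) S]])
    fix s t h assume th: "t \<in> X" "0 < \<bar>h\<bar>" "\<bar>h\<bar> < \<epsilon>"
    have "of_real (g t h) powr a s = (\<Sum>j<4. (a s gchoose j) * of_real (g t h - 1) ^ j) + of_real h ^ 8 * S s t h"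
      using th by (simp add: S_def)
    thus "of_real (g t h) powr a s = (\<Sum>k<8. (\<Sum>j<4. fps_const (a s gchoose j) * (G s t - 1) ^ j) $ k * of_real h ^ k)
       + of_real h ^ 8 * (taylor_remainder 8 (\<lambda>s t h. \<Sum>j<4. (a s gchoose j) * of_real (g t h - 1) ^ j)
         (\<lambda>s t. \<Sum>j<4. fps_const (a s gchoose j) * (G s t - 1) ^ j) s t h + S s t h)"
      using expands_eq[OF th(2), of "\<lambda>s t h. \<Sum>j<4. (a s gchoose j) * of_real (g t h - 1) ^ j" s t
        "\<lambda>s t. \<Sum>j<4. fps_const (a s gchoose j) * (G s t - 1) ^ j" 8] by (simp only: distrib_left add.assoc)
  qed
qed

section \<open>The power series of the kernel at the four poles\<close>

lemma fps_mult_low_coeffs: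
  fixes f g :: "'a::comm_ring_1 fps"
  shows
    "(f * g) $ 0 = f $ 0 * g $ 0"
    "(f * g) $ Suc 0 = f $ 0 * g $ Suc 0 + f $ Suc 0 * g $ 0"
    "(f * g) $ 2 = f $ 0 * g $ 2 + f $ Suc 0 * g $ Suc 0 + f $ 2 * g $ 0"
    "(f * g) $ 3 = f $ 0 * g $ 3 + f $ Suc 0 * g $ 2 + f $ 2 * g $ Suc 0 + f $ 3 * g $ 0"
    "(f * g) $ 4 = f $ 0 * g $ 4 + f $ Suc 0 * g $ 3 + f $ 2 * g $ 2 + f $ 3 * g $ Suc 0 + f $ 4 * g $ 0"
    "(f * g) $ 5 = f $ 0 * g $ 5 + f $ Suc 0 * g $ 4 + f $ 2 * g $ 3 + f $ 3 * g $ 2 + f $ 4 * g $ Suc 0 + f $ 5 * g $ 0"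
    "(f * g) $ 6 = f $ 0 * g $ 6 + f $ Suc 0 * g $ 5 + f $ 2 * g $ 4 + f $ 3 * g $ 3 + f $ 4 * g $ 2 + f $ 5 * g $ Suc 0 + f $ 6 * g $ 0"
  by (simp_all add: fps_mult_nth eval_nat_numeral)

text \<open>The binomial series of \<open>(1 + U) powr a\<close>, cut after the cubic term; this is exact below order \<open>8\<close> when \<open>U\<close> starts in
order \<open>2\<close>.\<close>

definition binomial_series :: "complex \<Rightarrow> complex fps \<Rightarrow> complex fps" where
  "binomial_series a U = (\<Sum>j<4. fps_const (a gchoose j) * U ^ j)"

text \<open>The power series of \<open>\<Phi>\<close>, in terms of the series \<open>X, Y\<close> of \<open>\<xi>, \<eta>\<close> and \<open>X', Y'\<close> of the coordinates of the moving
tangent.\<close>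

definition kernel_series :: "complex fps \<Rightarrow> complex fps \<Rightarrow> complex fps \<Rightarrow> complex fps \<Rightarrow> complex \<Rightarrow> complex fps" where
  "kernel_series X Y X' Y' s = fps_const (- s) *
     (fps_const (s - 2) * (binomial_series ((s - 4) / 2) (X * X + Y * Y - 1) * - (Y * (X * Y' - Y * X'))) +
      binomial_series ((s - 2) / 2) (X * X + Y * Y - 1) * X')"

text \<open>The coefficients dictated by the Frenet equations for a curve with curvature \<open>k0\<close> and successive curvature derivatives
\<open>k1, k2, \<dots>\<close>. The relation between \<open>X'\<close> and \<open>X\<close> says that \<open>X'\<close> is the derivative of \<open>h \<mapsto> h X(h)\<close>. The lemmas below work up
the factors of \<open>kernel_series\<close> one by one, so that each step is a small polynomial identity. The last four results are half
the integrands of the theorem.\<close>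

locale frenet_series =
  fixes X Y X' Y' :: "complex fps" and k0 k1 k2 k3 k4 :: complex
  assumes X: "X $ 0 = 1"
      "X $ Suc 0 = 0"
      "X $ 2 = - 1/6 * k0^2"
      "X $ 3 = - 1/8 * k0 * k1"
      "X $ 4 = 1/120 * k0^4 - 1/30 * k0 * k2 - 1/40 * k1^2"
      "X $ 5 = 1/72 * k0^3 * k1 - 1/144 * k0 * k3 - 1/72 * k1 * k2"
      "X $ 6 = - 1/5040 * k0^6 + 1/252 * k0^3 * k2 + 1/112 * k0^2 * k1^2 - 1/840 * k0 * k4 - 1/336 * k1 * k3 - 1/504 * k2^2"
    and Y: "Y $ 0 = 0"
      "Y $ Suc 0 = 1/2 * k0"
      "Y $ 2 = 1/6 * k1"
      "Y $ 3 = - 1/24 * k0^3 + 1/24 * k2"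
      "Y $ 4 = - 1/20 * k0^2 * k1 + 1/120 * k3"
      "Y $ 5 = 1/720 * k0^5 - 1/72 * k0^2 * k2 - 1/48 * k0 * k1^2 + 1/720 * k4"
    and X': "\<And>j. j < 7 \<Longrightarrow> X' $ j = of_nat (Suc j) * X $ j"
    and Y': "\<And>j. j < 7 \<Longrightarrow> Y' $ j = of_nat (Suc j) * Y $ j"
begin

definition U where "U = X * X + Y * Y - 1"
definition W where "W = X * Y' - Y * X'"
definition Q where "Q = Y * W"

lemma X'_coeffs: "X' $ 0 = 1"
    "X' $ Suc 0 = 0"
    "X' $ 2 = - 1/2 * k0^2"
    "X' $ 3 = - 1/2 * k0 * k1"
    "X' $ 4 = 1/24 * k0^4 - 1/6 * k0 * k2 - 1/8 * k1^2"
    "X' $ 5 = 1/12 * k0^3 * k1 - 1/24 * k0 * k3 - 1/12 * k1 * k2"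
    "X' $ 6 = - 1/720 * k0^6 + 1/36 * k0^3 * k2 + 1/16 * k0^2 * k1^2 - 1/120 * k0 * k4 - 1/48 * k1 * k3 - 1/72 * k2^2"
  by (simp_all add: X' X) (simp_all add: field_simps eval_nat_numeral)?

lemma Y'_coeffs: "Y' $ 0 = 0"
    "Y' $ Suc 0 = k0"
    "Y' $ 2 = 1/2 * k1"
    "Y' $ 3 = - 1/6 * k0^3 + 1/6 * k2"
    "Y' $ 4 = - 1/4 * k0^2 * k1 + 1/24 * k3"
    "Y' $ 5 = 1/120 * k0^5 - 1/12 * k0^2 * k2 - 1/8 * k0 * k1^2 + 1/120 * k4"
  by (simp_all add: Y' Y) (simp_all add: field_simps eval_nat_numeral)?

lemma U_coeffs: "U $ 0 = 0"
    "U $ Suc 0 = 0"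
    "U $ 2 = - 1/12 * k0^2"
    "U $ 3 = - 1/12 * k0 * k1"
    "U $ 4 = 1/360 * k0^4 - 1/40 * k0 * k2 - 1/45 * k1^2"
    "U $ 5 = 1/180 * k0^3 * k1 - 1/180 * k0 * k3 - 1/72 * k1 * k2"
    "U $ 6 = - 1/20160 * k0^6 + 17/10080 * k0^3 * k2 + 29/6720 * k0^2 * k1^2 - 1/1008 * k0 * k4 - 1/315 * k1 * k3 - 1/448 * k2^2"
  unfolding U_def by (simp_all add: fps_mult_low_coeffs X Y) (simp_all add: field_simps eval_nat_numeral)

lemma W_coeffs: "W $ 0 = 0"
    "W $ Suc 0 = 1/2 * k0"
    "W $ 2 = 1/3 * k1"
    "W $ 3 = - 1/24 * k0^3 + 1/8 * k2"
    "W $ 4 = - 3/40 * k0^2 * k1 + 1/30 * k3"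
    "W $ 5 = 1/720 * k0^5 - 19/720 * k0^2 * k2 - 11/240 * k0 * k1^2 + 1/144 * k4"
  unfolding W_def by (simp_all add: fps_mult_low_coeffs X Y X'_coeffs Y'_coeffs) (simp_all add: field_simps eval_nat_numeral)?

lemma Q_coeffs: "Q $ 0 = 0"
    "Q $ Suc 0 = 0"
    "Q $ 2 = 1/4 * k0^2"
    "Q $ 3 = 1/4 * k0 * k1"
    "Q $ 4 = - 1/24 * k0^4 + 1/12 * k0 * k2 + 1/18 * k1^2"
    "Q $ 5 = - 1/12 * k0^3 * k1 + 1/48 * k0 * k3 + 5/144 * k1 * k2"
    "Q $ 6 = 1/320 * k0^6 - 13/480 * k0^3 * k2 - 1/16 * k0^2 * k1^2 + 1/240 * k0 * k4 + 1/120 * k1 * k3 + 1/192 * k2^2"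
  unfolding Q_def by (simp_all add: fps_mult_low_coeffs W_coeffs Y) (simp_all add: field_simps eval_nat_numeral)?

lemma U2_coeffs: "(U * U) $ 0 = 0"
    "(U * U) $ Suc 0 = 0"
    "(U * U) $ 2 = 0"
    "(U * U) $ 3 = 0"
    "(U * U) $ 4 = 1/144 * k0^4"
    "(U * U) $ 5 = 1/72 * k0^3 * k1"
    "(U * U) $ 6 = - 1/2160 * k0^6 + 1/240 * k0^3 * k2 + 23/2160 * k0^2 * k1^2"
  by (simp_all add: fps_mult_low_coeffs U_coeffs) (simp_all add: field_simps eval_nat_numeral)?

lemma U3_coeffs: "(U * (U * U)) $ 0 = 0"
    "(U * (U * U)) $ Suc 0 = 0"
    "(U * (U * U)) $ 2 = 0"
    "(U * (U * U)) $ 3 = 0"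
    "(U * (U * U)) $ 4 = 0"
    "(U * (U * U)) $ 5 = 0"
    "(U * (U * U)) $ 6 = - 1/1728 * k0^6"
  by (simp_all add: fps_mult_low_coeffs(1-7)[of U "U * U"] U_coeffs U2_coeffs) (simp_all add: field_simps eval_nat_numeral)?

definition E where "E a = binomial_series a U"

lemma E_eq: "E a = 1 + fps_const a * U + fps_const (a * (a - 1) / 2) * (U * U) + fps_const (a * (a - 1) * (a - 2) / 6) * (U * (U * U))"
proof -
  have *: "a gchoose (Suc (Suc 0)) = a * (a - 1) / 2"
      "a gchoose (Suc (Suc (Suc 0))) = a * (a - 1) * (a - 2) / 6"
    by (simp_all add: gbinomial_prod_rev eval_nat_numeral)
  show ?thesis by (simp add: E_def binomial_series_def eval_nat_numeral lessThan_Suc *)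
qed

lemma kernel_series_eq:
  "kernel_series X Y X' Y' s = fps_const (- s) * (fps_const (s - 2) * (E ((s - 4) / 2) * (- Q)) + E ((s - 2) / 2) * X')"
  by (simp add: kernel_series_def E_def U_def Q_def W_def)

lemma E_coeffs:

  shows "E a $ 0 = 1 + a * U $ 0 + a * (a - 1) / 2 * (U * U) $ 0 + a * (a - 1) * (a - 2) / 6 * (U * (U * U)) $ 0"
    "E a $ Suc 0 = a * U $ Suc 0 + a * (a - 1) / 2 * (U * U) $ Suc 0 + a * (a - 1) * (a - 2) / 6 * (U * (U * U)) $ Suc 0"
    "E a $ 2 = a * U $ 2 + a * (a - 1) / 2 * (U * U) $ 2 + a * (a - 1) * (a - 2) / 6 * (U * (U * U)) $ 2"
    "E a $ 3 = a * U $ 3 + a * (a - 1) / 2 * (U * U) $ 3 + a * (a - 1) * (a - 2) / 6 * (U * (U * U)) $ 3"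
    "E a $ 4 = a * U $ 4 + a * (a - 1) / 2 * (U * U) $ 4 + a * (a - 1) * (a - 2) / 6 * (U * (U * U)) $ 4"
    "E a $ 5 = a * U $ 5 + a * (a - 1) / 2 * (U * U) $ 5 + a * (a - 1) * (a - 2) / 6 * (U * (U * U)) $ 5"
    "E a $ 6 = a * U $ 6 + a * (a - 1) / 2 * (U * U) $ 6 + a * (a - 1) * (a - 2) / 6 * (U * (U * U)) $ 6"
  by (simp_all add: E_eq)

lemma kernel_series_residue_0:
  "kernel_series X Y X' Y' 1 $ 0 = - 1"
  by (simp add: kernel_series_eq fps_mult_low_coeffs(1)[of "E _"] E_coeffs U_coeffs U2_coeffs U3_coeffs Q_coeffs X'_coeffs)

lemma kernel_series_residue_2:
  "kernel_series X Y X' Y' (-1) $ 2 = 3/8 * k0^2"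
  by (simp add: kernel_series_eq fps_mult_low_coeffs(3)[of "E _"] E_coeffs U_coeffs U2_coeffs U3_coeffs Q_coeffs X'_coeffs)

lemma kernel_series_residue_4:
  "kernel_series X Y X' Y' (-3) $ 4 = 45/128 * k0^4 + 15/16 * k0 * k2 + 5/8 * k1^2"
  by (simp add: kernel_series_eq fps_mult_low_coeffs(5)[of "E _"] E_coeffs U_coeffs U2_coeffs U3_coeffs Q_coeffs X'_coeffs) (simp add: field_simps eval_nat_numeral)

lemma kernel_series_residue_6:
  "kernel_series X Y X' Y' (-5) $ 6 = 175/1024 * k0^6 + 1085/1152 * k0^3 * k2 + 1295/576 * k0^2 * k1^2 + 35/288 * k0 * k4 + 35/144 * k1 * k3 + 175/1152 * k2^2"
  by (simp add: kernel_series_eq fps_mult_low_coeffs(7)[of "E _"] E_coeffs U_coeffs U2_coeffs U3_coeffs Q_coeffs X'_coeffs) (simp add: field_simps eval_nat_numeral)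

end

section \<open>The double layer kernel in a unit speed chart\<close>

text \<open>Passing to the inner product replaces the norm, which is not differentiable at the origin, by a quadratic polynomial.\<close>

lemma norm_powr_conv_inner:
  fixes x :: "'a::real_inner"
  assumes "x \<noteq> 0"
  shows "complex_of_real (norm x) powr s = complex_of_real (x \<bullet> x) powr (s / 2)"
proof -
  have "ln (x \<bullet> x) = 2 * ln (norm x)" using assms by (simp add: ln_realpow flip: power2_norm_eq_inner)
  moreover have "x \<bullet> x > 0" using assms by simp
  ultimately show ?thesis using assms by (simp add: powr_def Ln_of_real)
qed

lemma norm_powr_has_vector_derivative:
  fixes x w :: "'a::real_inner"
  assumes "x \<noteq> 0"
  shows "((\<lambda>h. complex_of_real (norm (x + h *\<^sub>R w)) powr s) has_vector_derivative
           s * complex_of_real (norm x) powr (s - 2) * complex_of_real (x \<bullet> w)) (at 0)"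
proof -
  have q: "((\<lambda>h. (x + h *\<^sub>R w) \<bullet> (x + h *\<^sub>R w)) has_vector_derivative 2 * (x \<bullet> w)) (at 0)"
    by (auto intro!: derivative_eq_intros simp: has_vector_derivative_def inner_commute algebra_simps)
  have "((\<lambda>h. complex_of_real ((x + h *\<^sub>R w) \<bullet> (x + h *\<^sub>R w))) has_vector_derivative complex_of_real (2 * (x \<bullet> w))) (at 0)"
    by (rule bounded_linear.has_vector_derivative[OF bounded_linear_of_real q])
  moreover have "((\<lambda>z. z powr (s/2)) has_field_derivative (s/2) * complex_of_real (x \<bullet> x) powr (s/2 - 1))
     (at (complex_of_real ((x + 0 *\<^sub>R w) \<bullet> (x + 0 *\<^sub>R w))))"
    using has_field_derivative_powr[of "complex_of_real (x \<bullet> x)" "s/2"] inner_gt_zero_iff[of x] assms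
    by (simp add: complex_nonpos_Reals_iff not_le)
  ultimately have "((\<lambda>z. z powr (s/2)) \<circ> (\<lambda>h. complex_of_real ((x + h *\<^sub>R w) \<bullet> (x + h *\<^sub>R w)))
     has_vector_derivative complex_of_real (2 * (x \<bullet> w)) * ((s/2) * complex_of_real (x \<bullet> x) powr (s/2 - 1))) (at 0)"
    by (rule field_vector_diff_chain_at)
  hence 1: "((\<lambda>h. complex_of_real ((x + h *\<^sub>R w) \<bullet> (x + h *\<^sub>R w)) powr (s/2)) has_vector_derivative
     s * complex_of_real (norm x) powr (s - 2) * complex_of_real (x \<bullet> w)) (at 0)"
    using norm_powr_conv_inner[OF assms, of "s - 2"] by (simp add: o_def diff_divide_distrib mult_ac)
  have op: "open {h. x + h *\<^sub>R w \<noteq> 0}"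
    by (intro open_Collect_neq continuous_intros)
  show ?thesis
    by (rule has_vector_derivative_transform_within_open[OF 1 op])
       (use assms in \<open>auto simp: norm_powr_conv_inner\<close>)
qed

lemma dir_deriv_N_pow:
  assumes "u \<noteq> v"
  shows "dir_deriv (N_pow s u) v n = - s * complex_of_real (norm (u - v)) powr (s - 2) * complex_of_real ((u - v) \<bullet> n)"
proof -
  have "((\<lambda>h. complex_of_real (norm (u - (v + h *\<^sub>R n))) powr s) has_vector_derivative
     s * complex_of_real (norm (u - v)) powr (s - 2) * complex_of_real ((u - v) \<bullet> (- n))) (at 0)"
    using norm_powr_has_vector_derivative[of "u - v" "- n" s] assms by (simp add: algebra_simps)
  thus ?thesis by (simp add: dir_deriv_def N_pow_def vector_derivative_at)
qed

lemma double_layer_kernel_eq: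
  assumes "u \<noteq> v"
  shows "double_layer_kernel \<nu> s u v = - s *
    ((s - 2) * complex_of_real (norm (u - v)) powr (s - 4) * complex_of_real (((u - v) \<bullet> \<nu> u) * ((u - v) \<bullet> \<nu> v)) +
     complex_of_real (norm (u - v)) powr (s - 2) * complex_of_real (\<nu> u \<bullet> \<nu> v))"
proof -
  define w where "w = u - v"
  have w: "w \<noteq> 0" using assms by (simp add: w_def)
  define f where "f = (\<lambda>h. - s * (complex_of_real (norm (w + h *\<^sub>R \<nu> u)) powr (s - 2) * complex_of_real ((w + h *\<^sub>R \<nu> u) \<bullet> \<nu> v)))"
  have "((\<lambda>h. (w + h *\<^sub>R \<nu> u) \<bullet> \<nu> v) has_vector_derivative \<nu> u \<bullet> \<nu> v) (at 0)"
    by (auto intro!: derivative_eq_intros simp: has_vector_derivative_def inner_commute algebra_simps)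
  from bounded_linear.has_vector_derivative[OF bounded_linear_of_real this]
  have "((\<lambda>h. complex_of_real ((w + h *\<^sub>R \<nu> u) \<bullet> \<nu> v)) has_vector_derivative complex_of_real (\<nu> u \<bullet> \<nu> v)) (at 0)" .
  from has_vector_derivative_mult[OF norm_powr_has_vector_derivative[OF w, of "\<nu> u" "s - 2"] this]
  have "(f has_vector_derivative - s *
    ((s - 2) * complex_of_real (norm w) powr (s - 4) * complex_of_real ((w \<bullet> \<nu> u) * (w \<bullet> \<nu> v)) +
     complex_of_real (norm w) powr (s - 2) * complex_of_real (\<nu> u \<bullet> \<nu> v))) (at 0)"
    unfolding f_def by (intro has_vector_derivative_mult_right) (simp add: algebra_simps)
  moreover have "\<forall>\<^sub>F h in nhds 0. dir_deriv (\<lambda>v'. N_pow s (u + h *\<^sub>R \<nu> u) v') v (\<nu> v) = f h"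
  proof -
    have "open {h. u + h *\<^sub>R \<nu> u \<noteq> v}" by (intro open_Collect_neq continuous_intros)
    hence "\<forall>\<^sub>F h in nhds 0. u + h *\<^sub>R \<nu> u \<noteq> v"
      using assms by (auto simp: eventually_nhds intro!: exI[of _ "{h. u + h *\<^sub>R \<nu> u \<noteq> v}"])
    thus ?thesis
      by eventually_elim (simp add: dir_deriv_N_pow f_def w_def algebra_simps)
  qed
  hence "vector_derivative (\<lambda>h. dir_deriv (\<lambda>v'. N_pow s (u + h *\<^sub>R \<nu> u) v') v (\<nu> v)) (at 0) = vector_derivative f (at 0)"
    by (intro vector_derivative_cong_eq) auto
  ultimately show ?thesis
    unfolding double_layer_kernel_def dir_deriv_def[of "\<lambda>u'. dir_deriv (\<lambda>v'. N_pow s u' v') v (\<nu> v)"]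
    by (simp add: vector_derivative_at w_def)
qed

context unit_speed_chart
begin

abbreviation \<Gamma> :: "nat \<Rightarrow> real \<Rightarrow> real^2" where "\<Gamma> j \<equiv> nth_vector_deriv j \<gamma>"

text \<open>When the components of \<open>\<Gamma> j\<close> in the moving frame are differentiated, the frame turns as well; this contributes the terms
with \<open>k 0\<close>. Starting from \<open>\<Gamma> 1 = T\<close>, six steps give all components up to \<open>\<Gamma> 7\<close>.\<close>

lemma frenet_step:
  assumes p: "\<And>t. t \<in> I \<Longrightarrow> \<Gamma> j t \<bullet> T t = p t" and q: "\<And>t. t \<in> I \<Longrightarrow> \<Gamma> j t \<bullet> N t = q t"
    and p': "\<And>t. t \<in> I \<Longrightarrow> (p has_real_derivative p' t) (at t)"
    and q': "\<And>t. t \<in> I \<Longrightarrow> (q has_real_derivative q' t) (at t)" and t: "t \<in> I"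
  shows "\<Gamma> (Suc j) t \<bullet> T t = p' t - k 0 t * q t" "\<Gamma> (Suc j) t \<bullet> N t = q' t + k 0 t * p t"
proof -
  note \<Gamma>' = has_vector_derivative_nth[OF chart(3) t, of j]
  have "((\<lambda>t. \<Gamma> j t \<bullet> T t) has_vector_derivative \<Gamma> j t \<bullet> (k 0 t *\<^sub>R N t) + \<Gamma> (Suc j) t \<bullet> T t) (at t)"
    by (rule bounded_bilinear.has_vector_derivative[OF bounded_bilinear_inner \<Gamma>' T_deriv'[OF t]])
  hence "(p has_real_derivative \<Gamma> j t \<bullet> (k 0 t *\<^sub>R N t) + \<Gamma> (Suc j) t \<bullet> T t) (at t)"
    unfolding has_real_derivative_iff_has_vector_derivative
    by (rule has_vector_derivative_transform_within_open[OF _ chart(1) t p])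
  from DERIV_unique[OF this p'[OF t]] show "\<Gamma> (Suc j) t \<bullet> T t = p' t - k 0 t * q t"
    using q[OF t] by simp
  have "((\<lambda>t. \<Gamma> j t \<bullet> N t) has_vector_derivative \<Gamma> j t \<bullet> (- k 0 t *\<^sub>R T t) + \<Gamma> (Suc j) t \<bullet> N t) (at t)"
    by (rule bounded_bilinear.has_vector_derivative[OF bounded_bilinear_inner \<Gamma>' N_deriv[OF t]])
  hence "(q has_real_derivative \<Gamma> j t \<bullet> (- k 0 t *\<^sub>R T t) + \<Gamma> (Suc j) t \<bullet> N t) (at t)"
    unfolding has_real_derivative_iff_has_vector_derivative
    by (rule has_vector_derivative_transform_within_open[OF _ chart(1) t q])
  from DERIV_unique[OF this q'[OF t]] show "\<Gamma> (Suc j) t \<bullet> N t = q' t + k 0 t * p t"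
    using p[OF t] by simp
qed

lemma frenet_components_1: "t \<in> I \<Longrightarrow> \<Gamma> 1 t \<bullet> T t = 1" "t \<in> I \<Longrightarrow> \<Gamma> 1 t \<bullet> N t = 0"
  using T_T N_perp by (simp_all add: T_def)

lemmas k_derivs = k_deriv[of _ 0, simplified] k_deriv[of _ 1, simplified, folded numeral_2_eq_2]
  k_deriv[of _ 2, simplified, folded numeral_3_eq_3] k_deriv[of _ 3, simplified] k_deriv[of _ 4, simplified]

lemma frenet_components_2:
  assumes "t \<in> I"
  shows "\<Gamma> 2 t \<bullet> T t = 0"
    "\<Gamma> 2 t \<bullet> N t = k 0 t"
proof -
  have "\<Gamma> (Suc 1) t \<bullet> T t = (0) - k 0 t * (0)"
    "\<Gamma> (Suc 1) t \<bullet> N t = (0) + k 0 t * (1)"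
    by (rule frenet_step[OF frenet_components_1 _ _ assms];
        auto intro!: derivative_eq_intros k_derivs simp: algebra_simps power2_eq_square power3_eq_cube)+
  thus "\<Gamma> 2 t \<bullet> T t = 0"
    "\<Gamma> 2 t \<bullet> N t = k 0 t"
    by (simp_all add: algebra_simps eval_nat_numeral)
qed

lemma frenet_components_3:
  assumes "t \<in> I"
  shows "\<Gamma> 3 t \<bullet> T t = - ((k 0 t)^2)"
    "\<Gamma> 3 t \<bullet> N t = k 1 t"
proof -
  have "\<Gamma> (Suc 2) t \<bullet> T t = (0) - k 0 t * (k 0 t)"
    "\<Gamma> (Suc 2) t \<bullet> N t = (k 1 t) + k 0 t * (0)"
    by (rule frenet_step[OF frenet_components_2 _ _ assms];
        auto intro!: derivative_eq_intros k_derivs simp: algebra_simps power2_eq_square power3_eq_cube)+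
  thus "\<Gamma> 3 t \<bullet> T t = - ((k 0 t)^2)"
    "\<Gamma> 3 t \<bullet> N t = k 1 t"
    by (simp_all add: algebra_simps eval_nat_numeral)
qed

lemma frenet_components_4:
  assumes "t \<in> I"
  shows "\<Gamma> 4 t \<bullet> T t = - 3 * k 0 t * k 1 t"
    "\<Gamma> 4 t \<bullet> N t = - ((k 0 t)^3) + k 2 t"
proof -
  have "\<Gamma> (Suc 3) t \<bullet> T t = (- 2 * k 0 t * k 1 t) - k 0 t * (k 1 t)"
    "\<Gamma> (Suc 3) t \<bullet> N t = (k 2 t) + k 0 t * (- ((k 0 t)^2))"
    by (rule frenet_step[OF frenet_components_3 _ _ assms];
        auto intro!: derivative_eq_intros k_derivs simp: algebra_simps power2_eq_square power3_eq_cube)+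
  thus "\<Gamma> 4 t \<bullet> T t = - 3 * k 0 t * k 1 t"
    "\<Gamma> 4 t \<bullet> N t = - ((k 0 t)^3) + k 2 t"
    by (simp_all add: algebra_simps eval_nat_numeral)
qed

lemma frenet_components_5:
  assumes "t \<in> I"
  shows "\<Gamma> 5 t \<bullet> T t = (k 0 t)^4 - 4 * k 0 t * k 2 t - 3 * (k 1 t)^2"
    "\<Gamma> 5 t \<bullet> N t = - 6 * (k 0 t)^2 * k 1 t + k 3 t"
proof -
  have "\<Gamma> (Suc 4) t \<bullet> T t = (- 3 * k 0 t * k 2 t - 3 * (k 1 t)^2) - k 0 t * (- ((k 0 t)^3) + k 2 t)"
    "\<Gamma> (Suc 4) t \<bullet> N t = (- 3 * (k 0 t)^2 * k 1 t + k 3 t) + k 0 t * (- 3 * k 0 t * k 1 t)"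
    by (rule frenet_step[OF frenet_components_4 _ _ assms];
        auto intro!: derivative_eq_intros k_derivs simp: algebra_simps power2_eq_square power3_eq_cube)+
  thus "\<Gamma> 5 t \<bullet> T t = (k 0 t)^4 - 4 * k 0 t * k 2 t - 3 * (k 1 t)^2"
    "\<Gamma> 5 t \<bullet> N t = - 6 * (k 0 t)^2 * k 1 t + k 3 t"
    by (simp_all add: algebra_simps eval_nat_numeral)
qed

lemma frenet_components_6:
  assumes "t \<in> I"
  shows "\<Gamma> 6 t \<bullet> T t = 10 * (k 0 t)^3 * k 1 t - 5 * k 0 t * k 3 t - 10 * k 1 t * k 2 t"
    "\<Gamma> 6 t \<bullet> N t = (k 0 t)^5 - 10 * (k 0 t)^2 * k 2 t - 15 * k 0 t * (k 1 t)^2 + k 4 t"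
proof -
  have "\<Gamma> (Suc 5) t \<bullet> T t = (4 * (k 0 t)^3 * k 1 t - 4 * k 0 t * k 3 t - 10 * k 1 t * k 2 t) - k 0 t * (- 6 * (k 0 t)^2 * k 1 t + k 3 t)"
    "\<Gamma> (Suc 5) t \<bullet> N t = (- 6 * (k 0 t)^2 * k 2 t - 12 * k 0 t * (k 1 t)^2 + k 4 t) + k 0 t * ((k 0 t)^4 - 4 * k 0 t * k 2 t - 3 * (k 1 t)^2)"
    by (rule frenet_step[OF frenet_components_5 _ _ assms];
        auto intro!: derivative_eq_intros k_derivs simp: algebra_simps power2_eq_square power3_eq_cube)+
  thus "\<Gamma> 6 t \<bullet> T t = 10 * (k 0 t)^3 * k 1 t - 5 * k 0 t * k 3 t - 10 * k 1 t * k 2 t"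
    "\<Gamma> 6 t \<bullet> N t = (k 0 t)^5 - 10 * (k 0 t)^2 * k 2 t - 15 * k 0 t * (k 1 t)^2 + k 4 t"
    by (simp_all add: algebra_simps eval_nat_numeral)
qed

lemma frenet_components_7:
  assumes "t \<in> I"
  shows "\<Gamma> 7 t \<bullet> T t = - ((k 0 t)^6) + 20 * (k 0 t)^3 * k 2 t + 45 * (k 0 t)^2 * (k 1 t)^2 - 6 * k 0 t * k 4 t - 15 * k 1 t * k 3 t - 10 * (k 2 t)^2"
    "\<Gamma> 7 t \<bullet> N t = 15 * (k 0 t)^4 * k 1 t - 15 * (k 0 t)^2 * k 3 t - 60 * k 0 t * k 1 t * k 2 t - 15 * (k 1 t)^3 + k 5 t"
proof -
  have "\<Gamma> (Suc 6) t \<bullet> T t = (10 * (k 0 t)^3 * k 2 t + 30 * (k 0 t)^2 * (k 1 t)^2 - 5 * k 0 t * k 4 t - 15 * k 1 t * k 3 t - 10 * (k 2 t)^2) - k 0 t * ((k 0 t)^5 - 10 * (k 0 t)^2 * k 2 t - 15 * k 0 t * (k 1 t)^2 + k 4 t)"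
    "\<Gamma> (Suc 6) t \<bullet> N t = (5 * (k 0 t)^4 * k 1 t - 10 * (k 0 t)^2 * k 3 t - 50 * k 0 t * k 1 t * k 2 t - 15 * (k 1 t)^3 + k 5 t) + k 0 t * (10 * (k 0 t)^3 * k 1 t - 5 * k 0 t * k 3 t - 10 * k 1 t * k 2 t)"
    by (rule frenet_step[OF frenet_components_6 _ _ assms];
        auto intro!: derivative_eq_intros k_derivs simp: algebra_simps power2_eq_square power3_eq_cube)+
  thus "\<Gamma> 7 t \<bullet> T t = - ((k 0 t)^6) + 20 * (k 0 t)^3 * k 2 t + 45 * (k 0 t)^2 * (k 1 t)^2 - 6 * k 0 t * k 4 t - 15 * k 1 t * k 3 t - 10 * (k 2 t)^2"
    "\<Gamma> 7 t \<bullet> N t = 15 * (k 0 t)^4 * k 1 t - 15 * (k 0 t)^2 * k 3 t - 60 * k 0 t * k 1 t * k 2 t - 15 * (k 1 t)^3 + k 5 t"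
    by (simp_all add: algebra_simps eval_nat_numeral)
qed

end

text \<open>The coordinates \<open>\<xi>, \<eta>\<close> of the difference quotient of \<open>\<gamma>\<close> in the frame at the base point \<open>t\<close>, the coordinates
\<open>\<xi>', \<eta>'\<close> of the tangent at \<open>t + h\<close>, and the kernel \<open>\<Phi>\<close> without its singular factor. All expansions hold
uniformly for \<open>t \<in> {a..b}\<close>.\<close>

locale chart_arc = unit_speed_chart +
  fixes a b :: real
  assumes ab: "a \<le> b" "{a..b} \<subseteq> I"
begin

definition xi :: "real \<Rightarrow> real \<Rightarrow> real" where "xi t h = (\<gamma> (t + h) - \<gamma> t) \<bullet> T t / h"
definition eta :: "real \<Rightarrow> real \<Rightarrow> real" where "eta t h = (\<gamma> (t + h) - \<gamma> t) \<bullet> N t / h"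
definition xi' :: "real \<Rightarrow> real \<Rightarrow> real" where "xi' t h = T (t + h) \<bullet> T t"
definition eta' :: "real \<Rightarrow> real \<Rightarrow> real" where "eta' t h = T (t + h) \<bullet> N t"
definition g where "g t h = xi t h ^ 2 + eta t h ^ 2"

definition \<Phi> :: "complex \<Rightarrow> real \<Rightarrow> real \<Rightarrow> complex" where
  "\<Phi> s t h = - s * ((s - 2) * (of_real (g t h) powr ((s - 4) / 2) *
      - (of_real (eta t h) * (of_real (xi t h) * of_real (eta' t h) - of_real (eta t h) * of_real (xi' t h)))) +
     of_real (g t h) powr ((s - 2) / 2) * of_real (xi' t h))"

definition tangent_series :: "(real \<Rightarrow> real^2) \<Rightarrow> real \<Rightarrow> complex fps" where
  "tangent_series w t = Abs_fps (\<lambda>j. if j < 8 then of_real (\<Gamma> (Suc j) t \<bullet> w t / fact j) else 0)"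

definition chord_series :: "(real \<Rightarrow> real^2) \<Rightarrow> real \<Rightarrow> complex fps" where
  "chord_series w t = Abs_fps (\<lambda>j. if j < 8 then of_real (\<Gamma> (Suc j) t \<bullet> w t / fact (Suc j)) else 0)"

definition c :: "complex \<Rightarrow> real \<Rightarrow> complex fps" where
  "c s t = kernel_series (chord_series T t) (chord_series N t) (tangent_series T t) (tangent_series N t) s"

lemma margin:
  obtains \<epsilon> where "\<epsilon> > 0" "{a - \<epsilon>..b + \<epsilon>} \<subseteq> I"
proof -
  obtain e where e: "e > 0" "(\<Union>x\<in>{a..b}. cball x e) \<subseteq> I"
    using compact_subset_open_imp_cball_epsilon_subset[OF compact_Icc chart(1) ab(2)] by metis
  have "{a - e..b + e} \<subseteq> (\<Union>x\<in>{a..b}. cball x e)"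
  proof
    fix y assume y: "y \<in> {a - e..b + e}"
    have "max a (min b y) \<in> {a..b}" "y \<in> cball (max a (min b y)) e"
      using y ab(1) e(1) by (auto simp: dist_real_def)
    thus "y \<in> (\<Union>x\<in>{a..b}. cball x e)" by blast
  qed
  with e that show ?thesis by blast
qed

lemma frame_bound:
  assumes "{a - \<epsilon>..b + \<epsilon>} \<subseteq> I" "\<epsilon> > 0"
  obtains C where "\<And>t h w. \<lbrakk>t \<in> {a..b}; \<bar>h\<bar> < \<epsilon>; norm w = 1\<rbrakk> \<Longrightarrow> \<bar>\<Gamma> n (t + h) \<bullet> w\<bar> \<le> C"
proof -
  have "compact (\<Gamma> n ` {a - \<epsilon>..b + \<epsilon>})"
    by (intro compact_continuous_image continuous_on_subset[OF continuous_on_nth_vector_deriv[OF chart(3)] assms(1)]) auto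
  then obtain C where C: "\<And>x. x \<in> \<Gamma> n ` {a - \<epsilon>..b + \<epsilon>} \<Longrightarrow> norm x \<le> C"
    using compact_imp_bounded bounded_iff by metis
  show ?thesis
  proof (rule that)
    fix t h :: real and w :: "real^2" assume *: "t \<in> {a..b}" "\<bar>h\<bar> < \<epsilon>" "norm w = 1"
    have "\<bar>\<Gamma> n (t + h) \<bullet> w\<bar> \<le> norm (\<Gamma> n (t + h)) * norm w" by (rule Cauchy_Schwarz_ineq2)
    also have "t + h \<in> {a - \<epsilon>..b + \<epsilon>}" using * by (auto simp: abs_less_iff)
    hence "norm (\<Gamma> n (t + h)) * norm w \<le> C" using *(3) by (auto intro!: C)
    finally show "\<bar>\<Gamma> n (t + h) \<bullet> w\<bar> \<le> C" .
  qed
qed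

lemma norm_frame: "t \<in> I \<Longrightarrow> norm (T t) = 1" "t \<in> I \<Longrightarrow> norm (N t) = 1"
  using T_T N_N by (simp_all add: norm_eq_1)

lemma \<Gamma>_inner_deriv:
  assumes "{a - \<epsilon>..b + \<epsilon>} \<subseteq> I" "t \<in> {a..b}" "\<bar>h\<bar> < \<epsilon>"
  shows "((\<lambda>h. \<Gamma> j (t + h) \<bullet> w) has_real_derivative \<Gamma> (Suc j) (t + h) \<bullet> w) (at h)"
proof -
  have "t + h \<in> {a - \<epsilon>..b + \<epsilon>}" using assms by (auto simp: abs_less_iff)
  hence th: "t + h \<in> I" using assms by blast
  have "((\<lambda>h. t + h) has_vector_derivative 1) (at h)"
    by (auto intro!: derivative_eq_intros simp flip: has_real_derivative_iff_has_vector_derivative)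
  from vector_diff_chain_at[OF this has_vector_derivative_nth[OF chart(3) th, of j]]
  have "((\<lambda>h. \<Gamma> j (t + h)) has_vector_derivative \<Gamma> (Suc j) (t + h)) (at h)" by (simp add: o_def)
  from bounded_linear.has_vector_derivative[OF bounded_linear_inner_left this]
  show ?thesis by (simp add: has_real_derivative_iff_has_vector_derivative)
qed

lemma expands_tangent:
  assumes \<epsilon>: "{a - \<epsilon>..b + \<epsilon>} \<subseteq> I" "\<epsilon> > 0" and w: "continuous_on I w" "\<And>t. t \<in> I \<Longrightarrow> norm (w t) = 1"
  shows "expands 8 {a..b} \<epsilon> (\<lambda>s t h. of_real (T (t + h) \<bullet> w t)) (\<lambda>s t. tangent_series w t)"
proof -
  obtain C where C: "\<And>t h w. \<lbrakk>t \<in> {a..b}; \<bar>h\<bar> < \<epsilon>; norm w = 1\<rbrakk> \<Longrightarrow> \<bar>\<Gamma> 9 (t + h) \<bullet> w\<bar> \<le> C"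
    using frame_bound[OF \<epsilon>] by blast
  have "expands 8 {a..b} \<epsilon> (\<lambda>s t h. of_real (\<Gamma> (Suc 0) (t + h) \<bullet> w t))
     (\<lambda>s t. Abs_fps (\<lambda>j. if j < 8 then of_real (\<Gamma> (Suc j) (t + 0) \<bullet> w t / fact j) else 0))"
  proof (rule expands_taylor[where D="\<lambda>j t h. \<Gamma> (Suc j) (t + h) \<bullet> w t" and C=C])
    show "continuous_on {a..b} (\<lambda>t. \<Gamma> (Suc j) (t + 0) \<bullet> w t)" for j
      by (simp, intro continuous_on_inner continuous_on_subset[OF continuous_on_nth_vector_deriv[OF chart(3)] ab(2)]
          continuous_on_subset[OF w(1) ab(2)])
    show "\<bar>\<Gamma> (Suc 8) (t + h) \<bullet> w t\<bar> \<le> C" if "t \<in> {a..b}" "\<bar>h\<bar> < \<epsilon>" for t h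
      using C[OF that w(2)] that ab by auto
  qed (use \<Gamma>_inner_deriv[OF \<epsilon>(1)] in auto)
  thus ?thesis unfolding add_0_right tangent_series_def T_def One_nat_def .
qed

text \<open>The Taylor expansion of the displacement is taken to order \<open>9\<close> because dividing by \<open>h\<close> costs one order.\<close>

lemma expands_chord:
  assumes \<epsilon>: "{a - \<epsilon>..b + \<epsilon>} \<subseteq> I" "\<epsilon> > 0" and w: "continuous_on I w" "\<And>t. t \<in> I \<Longrightarrow> norm (w t) = 1"
  shows "expands 8 {a..b} \<epsilon> (\<lambda>s t h. of_real ((\<gamma> (t + h) - \<gamma> t) \<bullet> w t / h)) (\<lambda>s t. chord_series w t)"
proof -
  obtain C where C: "\<And>t h w. \<lbrakk>t \<in> {a..b}; \<bar>h\<bar> < \<epsilon>; norm w = 1\<rbrakk> \<Longrightarrow> \<bar>\<Gamma> 9 (t + h) \<bullet> w\<bar> \<le> C"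
    using frame_bound[OF \<epsilon>] by blast
  define D where "D = (\<lambda>j t h. if j = 0 then (\<gamma> (t + h) - \<gamma> t) \<bullet> w t else \<Gamma> j (t + h) \<bullet> w t)"
  have "expands 9 {a..b} \<epsilon> (\<lambda>s t h. of_real (D 0 t h))
     (\<lambda>s t. Abs_fps (\<lambda>j. if j < 9 then of_real (D j t 0 / fact j) else 0))"
  proof (rule expands_taylor[where C=C])
    show "continuous_on {a..b} (\<lambda>t. D j t 0)" for j
      unfolding D_def
      by (cases j) (auto intro!: continuous_on_inner continuous_on_subset[OF continuous_on_nth_vector_deriv[OF chart(3)] ab(2)]
          continuous_on_subset[OF w(1) ab(2)])
    show "\<bar>D 9 t h\<bar> \<le> C" if "t \<in> {a..b}" "\<bar>h\<bar> < \<epsilon>" for t h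
      using C[OF that w(2)] that ab by (auto simp: D_def)
    show "(D j t has_real_derivative D (Suc j) t h) (at h)" if "t \<in> {a..b}" "\<bar>h\<bar> < \<epsilon>" for j t h
      using DERIV_diff[OF \<Gamma>_inner_deriv[OF \<epsilon>(1) that, of 0 "w t"] DERIV_const[of "\<gamma> t \<bullet> w t"]]
        \<Gamma>_inner_deriv[OF \<epsilon>(1) that, of j "w t"]
      by (cases "j = 0") (simp_all add: D_def inner_diff_left)
  qed auto
  from expands_divide_h[of 8, simplified, OF this]
  have "expands 8 {a..b} \<epsilon> (\<lambda>s t h. of_real (D 0 t h) / of_real h)
     (\<lambda>s t. fps_shift 1 (Abs_fps (\<lambda>j. if j < 9 then of_real (D j t 0 / fact j) else 0)))"
    by (simp add: D_def)
  moreover have "fps_shift 1 (Abs_fps (\<lambda>j. if j < 9 then complex_of_real (D j t 0 / fact j) else 0)) = chord_series w t" for t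
    by (rule fps_ext) (auto simp: chord_series_def D_def)
  ultimately show ?thesis by (simp add: D_def)
qed

lemmas expands_components =
  expands_chord[OF _ _ cont_T norm_frame(1), folded xi_def]
  expands_chord[OF _ _ cont_N norm_frame(2), folded eta_def]
  expands_tangent[OF _ _ cont_T norm_frame(1), folded xi'_def]
  expands_tangent[OF _ _ cont_N norm_frame(2), folded eta'_def]

lemma frenet_series_chart:
  assumes "t \<in> I"
  shows "frenet_series (chord_series T t) (chord_series N t) (tangent_series T t) (tangent_series N t)
    (of_real (k 0 t)) (of_real (k 1 t)) (of_real (k 2 t)) (of_real (k 3 t)) (of_real (k 4 t))"
proof -
  note fc = frenet_components_1[OF assms] frenet_components_2[OF assms] frenet_components_3[OF assms]
    frenet_components_4[OF assms] frenet_components_5[OF assms] frenet_components_6[OF assms] frenet_components_7[OF assms]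
  have 0: "Suc 2 = 3" "Suc 3 = 4" "Suc 4 = 5" "Suc 5 = 6" "Suc 6 = 7" "Suc (Suc 0) = 2" by simp_all
  show ?thesis
    by unfold_locales
       (simp_all add: chord_series_def tangent_series_def 0 fc[unfolded One_nat_def] fact_numeral,
        (simp_all add: field_simps eval_nat_numeral)?, (auto simp flip: of_nat_Suc)?)
qed

lemma expands_g:
  assumes \<epsilon>: "{a - \<epsilon>..b + \<epsilon>} \<subseteq> I" "\<epsilon> > 0"
  shows "expands 8 {a..b} \<epsilon> (\<lambda>s t h. of_real (g t h))
    (\<lambda>s t. chord_series T t * chord_series T t + chord_series N t * chord_series N t)"
  using expands_add[OF expands_mult[OF expands_components(1)[OF \<epsilon>] expands_components(1)[OF \<epsilon>]]
       expands_mult[OF expands_components(2)[OF \<epsilon>] expands_components(2)[OF \<epsilon>]]]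
  by (simp add: g_def power2_eq_square)

lemma g_series_low:
  assumes "t \<in> I"
  shows "(chord_series T t * chord_series T t + chord_series N t * chord_series N t) $ 0 = 1"
    "(chord_series T t * chord_series T t + chord_series N t * chord_series N t) $ 1 = 0"
  using frenet_series.U_coeffs(1,2)[OF frenet_series_chart[OF assms]]
  by (simp_all add: frenet_series.U_def[OF frenet_series_chart[OF assms]])

text \<open>The radius \<open>\<epsilon>\<close> keeps \<open>g\<close> in the range where the binomial series is used and, as \<open>g > 0\<close>, also makes the chart injective
near the diagonal in a quantitative way.\<close>

lemma g_close_to_1:
  obtains \<epsilon> where "\<epsilon> > 0" "{a - \<epsilon>..b + \<epsilon>} \<subseteq> I"
    "\<And>t h. \<lbrakk>t \<in> {a..b}; 0 < \<bar>h\<bar>; \<bar>h\<bar> < \<epsilon>\<rbrakk> \<Longrightarrow> \<bar>g t h - 1\<bar> \<le> 1/2"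
proof -
  obtain e where e: "e > 0" "{a - e..b + e} \<subseteq> I" using margin by blast
  let ?G = "\<lambda>t. chord_series T t * chord_series T t + chord_series N t * chord_series N t"
  note G = expandsD[OF expands_g[OF e(2,1)]]
  let ?R = "\<lambda>s t h. (\<Sum>k<7. ?G t $ Suc k * of_real h ^ k) + of_real h ^ 7 *
     taylor_remainder 8 (\<lambda>s t h. of_real (g t h)) (\<lambda>s t. ?G t) s t h"
  have "loc_bounded {a..b} e ?R"
    by (intro loc_bounded_add loc_bounded_mult loc_bounded_sum loc_bounded_power loc_bounded_h G(2) loc_bounded_entire G(1))
  then obtain C where C: "C \<ge> 0" "\<And>s t h. \<lbrakk>s \<in> ball 0 1; t \<in> {a..b}; 0 < \<bar>h\<bar>; \<bar>h\<bar> < e\<rbrakk> \<Longrightarrow> norm (?R s t h) \<le> C"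
    by (rule loc_bounded_D[of _ _ _ 1]) blast
  have g: "\<bar>g t h - 1\<bar> \<le> \<bar>h\<bar> * C" if th: "t \<in> {a..b}" "0 < \<bar>h\<bar>" "\<bar>h\<bar> < e" for t h
  proof -
    have tI: "t \<in> I" using th ab by auto
    have "complex_of_real (g t h) = (\<Sum>k<Suc 7. ?G t $ k * of_real h ^ k) + of_real h ^ 8 *
     taylor_remainder 8 (\<lambda>s t h. of_real (g t h)) (\<lambda>s t. ?G t) 0 t h"
      using expands_eq[OF th(2), of "\<lambda>s t h. of_real (g t h)" 0 t "\<lambda>s t. ?G t" 8] by simp
    also have "(\<Sum>k<Suc 7. ?G t $ k * of_real h ^ k) = 1 + of_real h * (\<Sum>k<7. ?G t $ Suc k * of_real h ^ k)"
      unfolding sum.lessThan_Suc_shift sum_distrib_left using g_series_low(1)[OF tI] by (simp add: mult_ac)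
    also have "of_real h ^ 8 * taylor_remainder 8 (\<lambda>s t h. of_real (g t h)) (\<lambda>s t. ?G t) 0 t h =
       of_real h * (of_real h ^ 7 * taylor_remainder 8 (\<lambda>s t h. of_real (g t h)) (\<lambda>s t. ?G t) 0 t h)"
      by (simp add: eval_nat_numeral)
    finally have "complex_of_real (g t h - 1) = of_real h * ?R 0 t h"
      by (simp only: of_real_diff distrib_left) simp
    hence "norm (complex_of_real (g t h - 1)) = \<bar>h\<bar> * norm (?R 0 t h)" by (simp only: norm_mult norm_of_real)
    also have "\<dots> \<le> \<bar>h\<bar> * C" by (intro mult_left_mono C(2) th) auto
    finally show ?thesis by (simp only: norm_of_real)
  qed
  \<comment> \<open>Chosen so that \<open>\<bar>h\<bar> C \<le> 1/2\<close>.\<close>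
  define \<epsilon> where "\<epsilon> = min e (1 / (2 * (C + 1)))"
  show ?thesis
  proof (rule that[of \<epsilon>])
    show "\<epsilon> > 0" "{a - \<epsilon>..b + \<epsilon>} \<subseteq> I" using e C(1) by (auto simp: \<epsilon>_def min_def)
    show "\<bar>g t h - 1\<bar> \<le> 1/2" if th: "t \<in> {a..b}" "0 < \<bar>h\<bar>" "\<bar>h\<bar> < \<epsilon>" for t h
    proof -
      have "\<bar>h\<bar> * C \<le> 1 / (2 * (C + 1)) * (C + 1)" using th C(1) by (intro mult_mono) (auto simp: \<epsilon>_def)
      also have "\<dots> = 1/2" using C(1) by simp
      finally show ?thesis using g[of t h] th by (auto simp: \<epsilon>_def)
    qed
  qed
qed

lemma expands_\<Phi>:
  assumes \<epsilon>: "{a - \<epsilon>..b + \<epsilon>} \<subseteq> I" "\<epsilon> > 0"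
    and close: "\<And>t h. \<lbrakk>t \<in> {a..b}; 0 < \<bar>h\<bar>; \<bar>h\<bar> < \<epsilon>\<rbrakk> \<Longrightarrow> \<bar>g t h - 1\<bar> \<le> 1/2"
  shows "expands 8 {a..b} \<epsilon> \<Phi> c"
proof -
  note E = expands_components[OF \<epsilon>]
  have g: "expands 8 {a..b} \<epsilon> (\<lambda>s t h. of_real (g t h) powr z s)
    (\<lambda>s t. binomial_series (z s) (chord_series T t * chord_series T t + chord_series N t * chord_series N t - 1))"
    if "z holomorphic_on UNIV" for z
    unfolding binomial_series_def
    by (rule expands_powr[OF expands_g[OF \<epsilon>] _ _ close that]) (use g_series_low ab in blast)+
  have m: "expands 8 {a..b} \<epsilon> (\<lambda>s t h. - f s t h) (\<lambda>s t. - F s t)" if "expands 8 {a..b} \<epsilon> f F" for f F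
    using expands_mult[OF expands_entire[OF entire_family_const, of 8 "{a..b}" \<epsilon> "-1"] that]
    by (simp del: fps_const_neg add: fps_const_neg[symmetric])
  have en: "expands 8 {a..b} \<epsilon> (\<lambda>s t h. z s) (\<lambda>s t. fps_const (z s))" if "z holomorphic_on UNIV" for z
    by (intro expands_entire entire_family_of_s that) auto
  have d: "expands 8 {a..b} \<epsilon> (\<lambda>s t h. f s t h - f' s t h) (\<lambda>s t. F s t - F' s t)"
    if "expands 8 {a..b} \<epsilon> f F" "expands 8 {a..b} \<epsilon> f' F'" for f F f' F'
    using expands_add[OF that(1) m[OF that(2)]] by simp
  show ?thesis
    unfolding \<Phi>_def[abs_def] c_def[abs_def] kernel_series_def
    by (intro expands_add expands_mult en m d g E holomorphic_intros) auto
qed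

text \<open>With \<open>w = \<gamma> t - \<gamma> (t + h)\<close> one has \<open>w \<bullet> w = h\<^sup>2 g\<close>, so both powers of the norm split into a power of
\<open>\<bar>h\<bar>\<close> and a power of \<open>g\<close>. The products of \<open>w\<close> with the two normals supply the factor \<open>h\<^sup>2\<close> that brings the more
singular term to the same power \<open>\<bar>h\<bar> powr (s - 2)\<close>.\<close>

lemma kernel_chart:
  assumes t: "t \<in> I" "t + h \<in> I" and h: "h \<noteq> 0" and g0: "g t h > 0"
  shows "\<gamma> t \<noteq> \<gamma> (t + h)"
    "double_layer_kernel \<nu> s (\<gamma> t) (\<gamma> (t + h)) = of_real \<bar>h\<bar> powr (s - 2) * \<Phi> s t h"
proof -
  define w where "w = \<gamma> t - \<gamma> (t + h)"
  have wT: "w \<bullet> T t = - (h * xi t h)" and wN: "w \<bullet> N t = - (h * eta t h)"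
    using h by (simp_all add: w_def xi_def eta_def inner_diff_left)
  have ww: "w \<bullet> w = (h * h) * g t h"
    using inner_TN[OF t(1), of w w] by (simp add: wT wN g_def algebra_simps power2_eq_square)
  hence "w \<noteq> 0" using h g0 by auto
  thus ne: "\<gamma> t \<noteq> \<gamma> (t + h)" by (simp add: w_def)
  have wN': "w \<bullet> N (t + h) = h * (xi t h * eta' t h - eta t h * xi' t h)"
    using inner_TN[OF t(1), of w "N (t + h)"] N_relative[OF t]
    by (simp add: wT wN xi'_def eta'_def algebra_simps)
  have pw: "of_real (norm w) powr z = of_real \<bar>h\<bar> powr z * of_real (g t h) powr (z / 2)" for z :: complex
  proof -
    have "of_real (norm w) powr z = of_real ((h * h) * g t h) powr (z / 2)"
      using norm_powr_conv_inner[OF \<open>w \<noteq> 0\<close>] ww by simp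
    also have "\<dots> = of_real (h * h) powr (z/2) * of_real (g t h) powr (z / 2)"
      unfolding of_real_mult[of "h * h"] using g0 by (intro powr_times_real) auto
    also have "of_real (h * h) powr (z/2) = of_real \<bar>h\<bar> powr z"
      using norm_powr_conv_inner[OF h, of z] by simp
    finally show ?thesis .
  qed
  have h2: "complex_of_real \<bar>h\<bar> powr (s - 2) = of_real \<bar>h\<bar> powr (s - 4) * of_real (h * h)"
  proof -
    have "complex_of_real \<bar>h\<bar> powr (s - 2) = of_real \<bar>h\<bar> powr (s - 4) * of_real \<bar>h\<bar> powr (of_nat 2)"
      by (subst powr_add[symmetric]) simp
    also have "complex_of_real \<bar>h\<bar> powr (of_nat 2) = of_real \<bar>h\<bar> ^ 2" using h by (intro powr_nat') auto
    also have "\<dots> = of_real (h * h)"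
      by (simp only: of_real_power[symmetric] power2_abs) (simp only: power2_eq_square)
    finally show ?thesis .
  qed
  show "double_layer_kernel \<nu> s (\<gamma> t) (\<gamma> (t + h)) = of_real \<bar>h\<bar> powr (s - 2) * \<Phi> s t h"
    unfolding double_layer_kernel_eq[OF ne] w_def[symmetric] N_def[symmetric] pw wN wN'
    unfolding N_relative(1)[OF t] inner_commute[of "N t"] h2 \<Phi>_def xi'_def[symmetric]
    by (simp add: algebra_simps diff_divide_distrib)
qed

end

section \<open>Simple poles, moments and meromorphic continuation\<close>

lemma of_real_powr_real:
  assumes "r \<ge> 0"
  shows "complex_of_real r powr z = (if r = 0 then 0 else exp (z * of_real (ln r)))"
  using assms by (auto simp: powr_def Ln_of_real)

lemma measurable_of_real_powr [measurable (raw)]: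
  assumes "f \<in> borel_measurable M"
  shows "(\<lambda>x. complex_of_real \<bar>f x :: real\<bar> powr z) \<in> borel_measurable M"
proof -
  have "(\<lambda>x. complex_of_real \<bar>f x\<bar> powr z) = (\<lambda>x. if f x = 0 then 0 else exp (z * of_real (ln \<bar>f x\<bar>)))"
    by (auto simp: of_real_powr_real)
  moreover have "(\<lambda>z. exp z :: complex) \<in> borel_measurable borel"
    by (intro borel_measurable_continuous_onI continuous_intros)
  ultimately show ?thesis using assms by simp
qed

lemma norm_abs_powr_le_1:
  assumes "\<bar>h\<bar> \<le> 1" "Re z \<ge> 0"
  shows "norm (complex_of_real \<bar>h\<bar> powr z) \<le> 1"
proof (cases "h = 0")
  case False
  have "norm (complex_of_real \<bar>h\<bar> powr z) = \<bar>h\<bar> powr Re z" by (simp add: norm_powr_real_powr)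
  also have "\<dots> \<le> 1" using assms False by (intro powr_le1) auto
  finally show ?thesis .
qed simp

text \<open>The primitive \<open>\<bar>h\<bar> powr (s - 2) * h ^ (k + 1) / (s - 1 + k)\<close> serves both signs of \<open>h\<close> and both parities of \<open>k\<close>; it is continuous at
\<open>0\<close>, so the fundamental theorem applies with \<open>0\<close> as an exceptional point.\<close>

lemma moment:
  assumes \<epsilon>: "0 < \<epsilon>" "\<epsilon> \<le> 1" and s: "Re s > 2"
  shows "set_integrable lborel {-\<epsilon><..<\<epsilon>} (\<lambda>h. complex_of_real \<bar>h\<bar> powr (s - 2) * of_real h ^ k)"
    "(LINT h:{-\<epsilon><..<\<epsilon>}|lborel. complex_of_real \<bar>h\<bar> powr (s - 2) * of_real h ^ k) =
      (if even k then 2 * of_real \<epsilon> powr (s - 1 + of_nat k) / (s - 1 + of_nat k) else 0)"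
proof -
  let ?f = "\<lambda>h. complex_of_real \<bar>h\<bar> powr (s - 2) * of_real h ^ k"
  let ?p = "s - 1 + of_nat k"
  have p: "?p \<noteq> 0"
  proof
    assume "?p = 0"
    hence "Re ?p = 0" by simp
    thus False using s by simp
  qed
  show int: "set_integrable lborel {-\<epsilon><..<\<epsilon>} ?f"
    unfolding set_integrable_def
  proof (rule integrableI_bounded_set_indicator[where B=1])
    have "norm (?f h) \<le> 1" if "h \<in> {-\<epsilon><..<\<epsilon>}" for h
    proof -
      have "\<bar>h\<bar> \<le> 1" using that \<epsilon> by auto
      hence "norm (complex_of_real \<bar>h\<bar> powr (s - 2)) * \<bar>h\<bar> ^ k \<le> 1 * 1"
        using s by (intro mult_mono norm_abs_powr_le_1 power_le_one) auto
      thus ?thesis by (simp add: norm_mult norm_power)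
    qed
    thus "AE h in lborel. h \<in> {-\<epsilon><..<\<epsilon>} \<longrightarrow> norm (?f h) \<le> 1" by simp
  qed (use \<epsilon> in auto)
  define F where "F = (\<lambda>h::real. complex_of_real \<bar>h\<bar> powr (s - 2) * of_real h ^ Suc k / ?p)"
  have F': "(F has_vector_derivative ?f h) (at h)" if "h \<noteq> 0" for h
  proof -
    have 1: "((\<lambda>h. complex_of_real \<bar>h\<bar> powr (s - 2)) has_vector_derivative
        (s - 2) * complex_of_real \<bar>h\<bar> powr (s - 4) * complex_of_real h) (at h)"
    proof -
      have "((\<lambda>x. x - h) has_vector_derivative 1) (at h)"
        by (auto intro!: derivative_eq_intros simp flip: has_real_derivative_iff_has_vector_derivative)
      from vector_diff_chain_at[OF this, of "\<lambda>e. complex_of_real (norm (h + e *\<^sub>R 1)) powr (s - 2)"]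
        norm_powr_has_vector_derivative[OF that, of 1 "s - 2"]
      show ?thesis by (simp add: o_def)
    qed
    have 2: "((\<lambda>h. complex_of_real h ^ Suc k) has_vector_derivative of_nat (Suc k) * of_real h ^ k) (at h)"
    proof -
      have "((\<lambda>h. h ^ Suc k) has_vector_derivative real (Suc k) * h ^ k) (at h)"
        using DERIV_pow[of "Suc k" h] unfolding has_real_derivative_iff_has_vector_derivative[symmetric] by simp
      from bounded_linear.has_vector_derivative[OF bounded_linear_of_real this]
      show ?thesis by simp
    qed
    have h2: "complex_of_real \<bar>h\<bar> powr (s - 2) = of_real \<bar>h\<bar> powr (s - 4) * of_real h * of_real h"
    proof -
      have "complex_of_real \<bar>h\<bar> powr (s - 2) = of_real \<bar>h\<bar> powr (s - 4) * of_real \<bar>h\<bar> powr (of_nat 2)"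
        by (subst powr_add[symmetric]) simp
      also have "complex_of_real \<bar>h\<bar> powr (of_nat 2) = of_real \<bar>h\<bar> ^ 2" using that by (intro powr_nat') auto
      also have "\<dots> = of_real h * of_real h"
        by (simp only: of_real_power[symmetric] power2_abs) (simp add: power2_eq_square)
      finally show ?thesis by simp
    qed
    have eq: "complex_of_real \<bar>h\<bar> powr (s - 2) * (of_nat (Suc k) * of_real h ^ k) +
      (s - 2) * complex_of_real \<bar>h\<bar> powr (s - 4) * complex_of_real h * of_real h ^ Suc k = ?p * ?f h"
      unfolding h2 by (simp add: algebra_simps)
    from has_vector_derivative_mult[OF 1 2]
    have "((\<lambda>h. complex_of_real \<bar>h\<bar> powr (s - 2) * of_real h ^ Suc k) has_vector_derivative ?p * ?f h) (at h)"
      unfolding eq .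
    from has_vector_derivative_divide[OF this, of ?p]
    show ?thesis unfolding F_def using p by simp
  qed
  have "isCont F h" for h
  proof (cases "h = 0")
    case False
    thus ?thesis using F' has_vector_derivative_continuous by blast
  next
    case True
    have "((\<lambda>h. complex_of_real \<bar>h\<bar> powr (s - 2) * of_real h ^ Suc k) \<longlongrightarrow> 0) (at 0)"
    proof (rule Lim_null_comparison)
      show "((\<lambda>h::real. \<bar>h\<bar>) \<longlongrightarrow> 0) (at 0)" by (rule tendsto_rabs_zero) (rule tendsto_ident_at)
      have "\<forall>\<^sub>F h in at (0::real). h \<in> ball 0 1" by (intro eventually_at_in_open') auto
      thus "\<forall>\<^sub>F h in at 0. norm (complex_of_real \<bar>h\<bar> powr (s - 2) * of_real h ^ Suc k) \<le> \<bar>h\<bar>"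
      proof eventually_elim
        case (elim h)
        hence "norm (complex_of_real \<bar>h\<bar> powr (s - 2)) * \<bar>h\<bar> ^ k * \<bar>h\<bar> \<le> 1 * 1 * \<bar>h\<bar>"
          using s by (intro mult_mono norm_abs_powr_le_1 power_le_one) auto
        thus ?case by (simp add: norm_mult norm_power mult_ac)
      qed
    qed
    from tendsto_divide[OF this tendsto_const p] show ?thesis
      using True by (simp add: isCont_def F_def)
  qed
  hence "continuous_on {-\<epsilon>..\<epsilon>} F" by (simp add: continuous_at_imp_continuous_on)
  hence "(?f has_integral (F \<epsilon> - F (-\<epsilon>))) {-\<epsilon>..\<epsilon>}"
    using \<epsilon> F' by (intro fundamental_theorem_of_calculus_interior_strong[of "{0}"]) auto
  hence "(?f has_integral (F \<epsilon> - F (-\<epsilon>))) {-\<epsilon><..<\<epsilon>}"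
    by (simp add: has_integral_Icc_iff_Ioo)
  hence "(LINT h:{-\<epsilon><..<\<epsilon>}|lborel. ?f h) = F \<epsilon> - F (-\<epsilon>)"
    using set_borel_integral_eq_integral(2)[OF int] by (simp add: integral_unique)
  also have "complex_of_real \<epsilon> powr (s - 2) * of_real \<epsilon> ^ Suc k = of_real \<epsilon> powr ?p"
  proof -
    have "complex_of_real \<epsilon> ^ Suc k = of_real \<epsilon> powr (of_nat (Suc k))" using \<epsilon> by (intro powr_nat'[symmetric]) auto
    thus ?thesis by (simp only: powr_add[symmetric]) (simp add: algebra_simps)
  qed
  hence "F \<epsilon> - F (-\<epsilon>) = (if even k then 2 * of_real \<epsilon> powr ?p / ?p else 0)"
    using \<epsilon> by (simp add: F_def)
  finally show "(LINT h:{-\<epsilon><..<\<epsilon>}|lborel. ?f h) = (if even k then 2 * of_real \<epsilon> powr ?p / ?p else 0)" .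
qed

text \<open>All four poles lie in this half plane, and an error \<open>O(h\<^sup>8)\<close> against \<open>\<bar>h\<bar> powr (s - 2)\<close> is integrable, even bounded, there.\<close>

definition half_plane :: "complex set" where "half_plane = {s. Re s > -6}"

lemma half_plane: "open half_plane" "connected half_plane"
  by (auto simp: half_plane_def open_halfspace_Re_gt intro!: convex_connected convex_halfspace_Re_gt)

definition pole :: "nat \<Rightarrow> complex" where "pole i = 1 - 2 * of_nat i"

lemma pole_in_half_plane: "i < 4 \<Longrightarrow> pole i \<in> half_plane"
  by (auto simp: pole_def half_plane_def)

lemma pole_inj: "pole i = pole j \<longleftrightarrow> i = j"
  by (simp add: pole_def)

text \<open>A continuation of \<open>f\<close> from \<open>Re s > 2\<close> to the half plane that displays the residues \<open>r i\<close>. In this form it is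
additive in \<open>(f, r)\<close>, which is what assembling the curve from pieces needs.\<close>

definition continues_with_residues :: "(complex \<Rightarrow> complex) \<Rightarrow> (nat \<Rightarrow> complex) \<Rightarrow> bool" where
  "continues_with_residues f r \<longleftrightarrow> (\<exists>H. H holomorphic_on half_plane \<and>
     (\<forall>s. Re s > 2 \<longrightarrow> f s = H s + (\<Sum>i<4. r i / (s - pole i))))"

lemma continues_with_residues_add:
  assumes "continues_with_residues f r" "continues_with_residues f' r'"
  shows "continues_with_residues (\<lambda>s. f s + f' s) (\<lambda>i. r i + r' i)"
proof -
  obtain H where H: "H holomorphic_on half_plane" "\<And>s. Re s > 2 \<Longrightarrow> f s = H s + (\<Sum>i<4. r i / (s - pole i))"
    using assms(1) unfolding continues_with_residues_def by blast
  obtain H' where H': "H' holomorphic_on half_plane" "\<And>s. Re s > 2 \<Longrightarrow> f' s = H' s + (\<Sum>i<4. r' i / (s - pole i))"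
    using assms(2) unfolding continues_with_residues_def by blast
  from H H' show ?thesis unfolding continues_with_residues_def
    by (intro exI[of _ "\<lambda>s. H s + H' s"]) (auto intro!: holomorphic_intros simp: add_divide_distrib sum.distrib)
qed

lemma continues_with_residues_cong:
  assumes "continues_with_residues f r" "\<And>s. Re s > 2 \<Longrightarrow> f s = f' s" "\<And>i. i < 4 \<Longrightarrow> r i = r' i"
  shows "continues_with_residues f' r'"
proof -
  obtain H where H: "H holomorphic_on half_plane" "\<And>s. Re s > 2 \<Longrightarrow> f s = H s + (\<Sum>i<4. r i / (s - pole i))"
    using assms(1) unfolding continues_with_residues_def by blast
  have "f' s = H s + (\<Sum>i<4. r' i / (s - pole i))" if "Re s > 2" for s
    using H(2)[OF that] assms(2)[OF that] assms(3) by simp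
  with H(1) show ?thesis unfolding continues_with_residues_def by blast
qed

lemma continues_with_residues_holomorphic:
  assumes "H holomorphic_on half_plane"
  shows "continues_with_residues H (\<lambda>_. 0)"
  unfolding continues_with_residues_def using assms by (intro exI[of _ H]) auto

lemma continues_with_residues_simple_pole:
  assumes i: "i < 4" and \<phi>: "\<phi> holomorphic_on half_plane"
  shows "continues_with_residues (\<lambda>s. \<phi> s / (s - pole i)) (\<lambda>j. if j = i then \<phi> (pole i) else 0)"
proof -
  let ?H = "\<lambda>z. if z = pole i then deriv \<phi> (pole i) else (\<phi> z - \<phi> (pole i)) / (z - pole i)"
  have "?H holomorphic_on half_plane"
    by (rule pole_lemma[OF \<phi>]) (use pole_in_half_plane[OF i] half_plane in \<open>simp add: interior_open\<close>)
  moreover have "\<phi> s / (s - pole i) = ?H s + (\<Sum>j<4. (if j = i then \<phi> (pole i) else 0) / (s - pole j))" if "Re s > 2" for s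
  proof -
    have "s \<noteq> pole i" using that by (auto simp: pole_def)
    moreover have "(\<Sum>j<4. (if j = i then \<phi> (pole i) else 0) / (s - pole j)) = (\<Sum>j<4. if j = i then \<phi> (pole i) / (s - pole i) else 0)"
      by (intro sum.cong) auto
    ultimately show ?thesis using i by (simp add: diff_divide_distrib)
  qed
  ultimately show ?thesis unfolding continues_with_residues_def by blast
qed

lemma continues_with_residues_sum:
  assumes "finite J" "\<And>j. j \<in> J \<Longrightarrow> continues_with_residues (f j) (r j)"
  shows "continues_with_residues (\<lambda>s. \<Sum>j\<in>J. f j s) (\<lambda>i. \<Sum>j\<in>J. r j i)"
  using assms
proof (induction J rule: finite_induct)
  case empty
  show ?case using continues_with_residues_holomorphic[of "\<lambda>_. 0"] by simp
next
  case (insert x F)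
  then show ?case using continues_with_residues_add[of "f x" "r x"] by simp
qed

text \<open>The difference of two continuations is meromorphic on a connected set and vanishes on \<open>Re s > 2\<close>, so it vanishes
off its removable singularities.\<close>

lemma residue_of_continuation:
  assumes B: "B meromorphic_on UNIV" and cont: "continues_with_residues B r" and i: "i < 4"
  shows "residue B (pole i) = r i"
proof -
  obtain H where H: "H holomorphic_on half_plane" "\<And>s. Re s > 2 \<Longrightarrow> B s = H s + (\<Sum>i<4. r i / (s - pole i))"
    using cont unfolding continues_with_residues_def by blast
  define G where "G = (\<lambda>s. H s + (\<Sum>i<4. r i / (s - pole i)))"
  have "G meromorphic_on half_plane"
    unfolding G_def using H(1) half_plane(1)
    by (intro meromorphic_intros analytic_on_imp_meromorphic_on) (auto simp: analytic_on_open)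
  hence mero: "(\<lambda>s. B s - G s) meromorphic_on half_plane"
    using B by (intro meromorphic_intros) (auto intro: meromorphic_on_subset)
  define f where "f = remove_sings (\<lambda>s. B s - G s)"
  have nice: "f nicely_meromorphic_on half_plane" unfolding f_def by (rule remove_sings_nicely_meromorphic[OF mero])
  have zero: "f w = 0" if "Re w > 2" for w
    unfolding f_def
  proof (rule remove_sings_eqI)
    have "\<forall>\<^sub>F z in at w. z \<in> {s. Re s > 2}"
      using that by (intro eventually_at_in_open' open_halfspace_Re_gt) auto
    hence "\<forall>\<^sub>F z in at w. B z - G z = 0" by eventually_elim (simp add: H(2) G_def)
    thus "((\<lambda>s. B s - G s) \<longlongrightarrow> 0) (at w)" by (rule tendsto_eventually)
  qed
  have "\<forall>\<^sub>F z in at 3. z \<in> {s. Re s > 2}"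
    by (intro eventually_at_in_open' open_halfspace_Re_gt) auto
  hence "\<forall>\<^sub>F z in at 3. f z = 0" by eventually_elim (simp add: zero)
  hence fr: "\<exists>\<^sub>F z in at 3. f z = 0" by (intro eventually_frequently) auto
  have f0: "f w = 0" if "w \<in> half_plane" for w
    by (rule frequently_eq_meromorphic_imp_constant[OF fr nice half_plane _ that]) (simp add: half_plane_def)
  let ?p = "pole i"
  have "isolated_singularity_at (\<lambda>s. B s - G s) ?p"
    using meromorphic_on_isolated_singularity[OF meromorphic_on_subset[OF mero]] pole_in_half_plane[OF i] by blast
  hence "\<forall>\<^sub>F w in at ?p. f w = B w - G w" unfolding f_def by (rule eventually_remove_sings_eq_at)
  moreover have "\<forall>\<^sub>F w in at ?p. w \<in> half_plane"
    using pole_in_half_plane[OF i] half_plane(1) by (intro eventually_at_in_open') auto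
  ultimately have "\<forall>\<^sub>F w in at ?p. B w = G w" by eventually_elim (simp add: f0)
  hence "residue B ?p = residue G ?p" by (rule residue_cong) simp
  also have "residue G ?p = r i"
  proof -
    define K where "K = (\<lambda>s. H s + (\<Sum>j\<in>{..<4}-{i}. r j / (s - pole j)))"
    define U where "U = half_plane - pole ` ({..<4} - {i})"
    have U: "open U" "?p \<in> U"
      unfolding U_def using half_plane(1) pole_in_half_plane[OF i] pole_inj
      by (auto intro!: open_Diff finite_imp_closed)
    have K: "K holomorphic_on U"
      unfolding K_def U_def by (intro holomorphic_intros holomorphic_on_subset[OF H(1)]) auto
    have "residue (\<lambda>s. (K s * (s - ?p) + r i) / (s - ?p)) ?p = K ?p * (?p - ?p) + r i"
      by (rule residue_simple[OF U]) (intro holomorphic_intros K)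
    moreover have "residue G ?p = residue (\<lambda>s. (K s * (s - ?p) + r i) / (s - ?p)) ?p"
    proof (rule residue_cong)
      show "\<forall>\<^sub>F s in at ?p. G s = (K s * (s - ?p) + r i) / (s - ?p)"
        unfolding eventually_at_filter
      proof (intro always_eventually allI impI)
        fix s assume "s \<noteq> ?p"
        thus "G s = (K s * (s - ?p) + r i) / (s - ?p)"
          using i by (simp add: G_def K_def sum.remove[of "{..<4}" i] add_divide_distrib)
      qed
    qed simp
    ultimately show ?thesis by simp
  qed
  finally show ?thesis .
qed

section \<open>The kernel on the whole curve\<close>

context measured_curve
begin

text \<open>The kernel off the diagonal, extended to the diagonal by the value \<open>0\<close> that the convention for \<open>0 powr z\<close> gives. As a point of the curve
has length zero, this changes no inner integral, and it makes joint measurability evident.\<close>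

definition K :: "complex \<Rightarrow> real^2 \<Rightarrow> real^2 \<Rightarrow> complex" where
  "K s u v = - s *
    ((s - 2) * complex_of_real (norm (u - v)) powr (s - 4) * complex_of_real (((u - v) \<bullet> \<nu> u) * ((u - v) \<bullet> \<nu> v)) +
     complex_of_real (norm (u - v)) powr (s - 2) * complex_of_real (\<nu> u \<bullet> \<nu> v))"

lemma K_self [simp]: "K s u u = 0" by (simp add: K_def)

lemma K_eq_kernel: "u \<noteq> v \<Longrightarrow> double_layer_kernel \<nu> s u v = K s u v"
  by (simp add: K_def double_layer_kernel_eq)

lemma K_measurable:
  assumes f: "f \<in> N \<rightarrow>\<^sub>M A" and g: "g \<in> N \<rightarrow>\<^sub>M A"
  shows "(\<lambda>x. K s (f x) (g x)) \<in> borel_measurable N"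
proof -
  have [measurable]: "f \<in> borel_measurable N" "g \<in> borel_measurable N"
    "(\<lambda>x. \<nu> (f x)) \<in> borel_measurable N" "(\<lambda>x. \<nu> (g x)) \<in> borel_measurable N"
    using measurable_compose[OF f id_measurable] measurable_compose[OF g id_measurable]
      measurable_compose[OF f \<nu>_measurable] measurable_compose[OF g \<nu>_measurable] by simp_all
  have "(\<lambda>x. complex_of_real \<bar>norm (f x - g x)\<bar> powr z) \<in> borel_measurable N" for z by measurable
  hence [measurable]: "(\<lambda>x. complex_of_real (norm (f x - g x)) powr z) \<in> borel_measurable N" for z by simp
  show ?thesis unfolding K_def by measurable
qed

lemma K_holomorphic: "(\<lambda>s. K s u v) holomorphic_on S"
proof (cases "u = v")
  case False
  thus ?thesis unfolding K_def by (auto intro!: holomorphic_intros)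
qed simp

lemma K_bound_off_diagonal:
  assumes "\<delta> > 0"
  obtains C where "\<And>s u v. \<lbrakk>u \<in> M; v \<in> M; norm (u - v) \<ge> \<delta>; norm s \<le> r\<rbrakk> \<Longrightarrow> norm (K s u v) \<le> C"
proof -
  obtain D where D: "\<And>u. u \<in> M \<Longrightarrow> norm u \<le> D" using compact_imp_bounded[OF compact_M] bounded_iff by metis
  define d where "d = max \<delta> (2 * D)"
  define L where "L = \<bar>ln \<delta>\<bar> + \<bar>ln d\<bar>"
  define R where "R = \<bar>r\<bar>"
  define E where "E = exp ((R + 4) * L)"
  have E: "norm (complex_of_real x powr z) \<le> E" if "\<delta> \<le> x" "x \<le> d" "norm z \<le> R + 4" for x z
  proof -
    have x: "x > 0" using that assms by simp
    have "ln \<delta> \<le> ln x" "ln x \<le> ln d" using that x assms by simp_all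
    hence lx: "\<bar>ln x\<bar> \<le> L" by (simp add: L_def)
    have "norm (complex_of_real x powr z) = exp (Re z * ln x)"
      using x by (simp add: norm_powr_real_powr powr_def)
    also have "Re z * ln x \<le> \<bar>Re z\<bar> * \<bar>ln x\<bar>" using abs_ge_self[of "Re z * ln x"] by (simp add: abs_mult)
    also have "\<bar>Re z\<bar> * \<bar>ln x\<bar> \<le> (R + 4) * L"
      using abs_Re_le_cmod[of z] that(3) lx by (intro mult_mono) auto
    finally show ?thesis by (simp add: E_def)
  qed
  have E0: "E \<ge> 0" by (simp add: E_def)
  show ?thesis
  proof (rule that[of "R * ((R + 2) * E * (d * d) + E)"])
    fix s :: complex and u v assume *: "u \<in> M" "v \<in> M" "norm (u - v) \<ge> \<delta>" "norm s \<le> r"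
    have s: "norm s \<le> R" "norm (s - 2) \<le> R + 2" "norm (s - 4) \<le> R + 4" "norm (s - 2) \<le> R + 4"
      using *(4) norm_triangle_ineq4[of s 2] norm_triangle_ineq4[of s 4] by (simp_all add: R_def)
    have x: "norm (u - v) \<le> d" using norm_triangle_ineq4[of u v] D[OF *(1)] D[OF *(2)] by (simp add: d_def)
    have n: "norm (\<nu> u) = 1" "norm (\<nu> v) = 1" using \<nu> * by (auto simp: outward_unit_normal_def)
    have i1: "\<bar>(u - v) \<bullet> \<nu> u\<bar> \<le> d" "\<bar>(u - v) \<bullet> \<nu> v\<bar> \<le> d"
      using Cauchy_Schwarz_ineq2[of "u - v" "\<nu> u"] Cauchy_Schwarz_ineq2[of "u - v" "\<nu> v"] x n by simp_all
    have d0: "d \<ge> 0" using assms by (simp add: d_def)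
    have i2: "\<bar>\<nu> u \<bullet> \<nu> v\<bar> \<le> 1" using Cauchy_Schwarz_ineq2[of "\<nu> u" "\<nu> v"] n by simp
    have t1: "norm ((s - 2) * complex_of_real (norm (u - v)) powr (s - 4) * complex_of_real (((u - v) \<bullet> \<nu> u) * ((u - v) \<bullet> \<nu> v)))
        \<le> (R + 2) * E * (d * d)"
      unfolding norm_mult norm_of_real abs_mult
      by (intro mult_mono s E i1 x *(3) mult_nonneg_nonneg E0 d0) (auto simp: R_def)
    have t2: "norm (complex_of_real (norm (u - v)) powr (s - 2) * complex_of_real (\<nu> u \<bullet> \<nu> v)) \<le> E * 1"
      unfolding norm_mult norm_of_real by (intro mult_mono s E i2 x *(3) E0) auto
    show "norm (K s u v) \<le> R * ((R + 2) * E * (d * d) + E)"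
      unfolding K_def norm_mult[of "- s"] norm_minus_cancel
      by (intro mult_mono s(1) norm_triangle_le) (use t1 t2 in \<open>auto simp: R_def\<close>)
  qed
qed

definition J :: "complex \<Rightarrow> real^2 \<Rightarrow> complex" where "J s u = (LINT v|A. K s u v)"

lemma inner_integral_eq:
  assumes u: "u \<in> M"
  shows "(LINT v|A. double_layer_kernel \<nu> s u v) = J s u"
  unfolding J_def
proof (rule integral_cong_AE)
  have [measurable]: "K s u \<in> borel_measurable A"
    by (rule K_measurable) (use u in auto)
  have [measurable]: "{u} \<in> sets A" using singleton_null[OF u] by auto
  have "double_layer_kernel \<nu> s u v = (if v = u then double_layer_kernel \<nu> s u u else K s u v)" for v
    using K_eq_kernel[of u v s] by simp
  hence eq: "double_layer_kernel \<nu> s u = (\<lambda>v. if v = u then double_layer_kernel \<nu> s u u else K s u v)"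
    by (rule ext)
  have "{v \<in> space A. v = u} = {u}" using u by auto
  hence "{v \<in> space A. v = u} \<in> sets A" using \<open>{u} \<in> sets A\<close> by simp
  thus "double_layer_kernel \<nu> s u \<in> borel_measurable A"
    by (subst eq) (intro measurable_If measurable_const, auto)
  show "K s u \<in> borel_measurable A" by measurable
  show "AE v in A. double_layer_kernel \<nu> s u v = K s u v"
    by (rule AE_I'[OF singleton_null[OF u]]) (use K_eq_kernel[of u _ s] in \<open>auto, metis\<close>)
qed

lemma J_measurable: "J s \<in> borel_measurable A"
proof -
  interpret finite_measure A by (rule finite_measure_A)
  have "(\<lambda>x. K s (fst x) (snd x)) \<in> borel_measurable (A \<Otimes>\<^sub>M A)"
    by (rule K_measurable) auto
  from borel_measurable_lebesgue_integral[of "\<lambda>u v. K s u v", simplified case_prod_unfold, OF this]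
  show ?thesis unfolding J_def[abs_def] .
qed

lemma double_layer_integral_eq: "double_layer_integral A \<nu> s = (LINT u:M|A. J s u)"
proof -
  have "double_layer_integral A \<nu> s = (LINT u|A. J s u)"
    unfolding double_layer_integral_def by (rule Bochner_Integration.integral_cong) (auto simp: inner_integral_eq)
  also have "\<dots> = (LINT u:M|A. J s u)"
    unfolding set_lebesgue_integral_def by (rule Bochner_Integration.integral_cong) auto
  finally show ?thesis .
qed

text \<open>The four integrands of the theorem; index \<open>i\<close> belongs to the pole \<open>1 - 2 i\<close>.\<close>

definition \<rho> :: "nat \<Rightarrow> real^2 \<Rightarrow> real" where
  "\<rho> i p = (let \<kappa> = curvature_deriv M \<nu> in
     if i = 0 then -2
     else if i = 1 then 3/4 * (\<kappa> 0 p)^2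
     else if i = 2 then 45/64 * (\<kappa> 0 p)^4 + 5/4 * (\<kappa> 1 p)^2 + 15/8 * \<kappa> 0 p * \<kappa> 2 p
     else 175/512 * (\<kappa> 0 p)^6 + 1295/288 * (\<kappa> 0 p)^2 * (\<kappa> 1 p)^2
           + 1085/576 * (\<kappa> 0 p)^3 * \<kappa> 2 p + 175/576 * (\<kappa> 2 p)^2
           + 35/72 * \<kappa> 1 p * \<kappa> 3 p + 35/144 * \<kappa> 0 p * \<kappa> 4 p)"

text \<open>The assertion of the theorem for pairs \<open>(u, v)\<close> with \<open>u\<close> restricted to \<open>B\<close> and \<open>v\<close> on the whole curve. Restricting only
\<open>u\<close> makes it additive in \<open>B\<close>.\<close>

definition good_piece :: "(real^2) set \<Rightarrow> bool" where
  "good_piece B \<longleftrightarrow> (\<forall>s. Re s > 2 \<longrightarrow> set_integrable A B (J s)) \<and>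
     (\<forall>i. set_integrable A B (\<rho> i)) \<and>
     continues_with_residues (\<lambda>s. LINT u:B|A. J s u) (\<lambda>i. of_real (LINT u:B|A. \<rho> i u))"

lemma good_piece_Un:
  assumes "B \<in> sets A" "C \<in> sets A" "B \<inter> C = {}" "good_piece B" "good_piece C"
  shows "good_piece (B \<union> C)"
proof -
  have 1: "set_integrable A (B \<union> C) (J s)" "(LINT u:B\<union>C|A. J s u) = (LINT u:B|A. J s u) + (LINT u:C|A. J s u)"
    if "Re s > 2" for s
    using assms that by (auto simp: good_piece_def intro!: set_integrable_Un set_integral_Un)
  have 2: "set_integrable A (B \<union> C) (\<rho> i)" "(LINT u:B\<union>C|A. \<rho> i u) = (LINT u:B|A. \<rho> i u) + (LINT u:C|A. \<rho> i u)" for i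
    using assms by (auto simp: good_piece_def intro!: set_integrable_Un set_integral_Un)
  have "continues_with_residues (\<lambda>s. (LINT u:B|A. J s u) + (LINT u:C|A. J s u))
      (\<lambda>i. of_real (LINT u:B|A. \<rho> i u) + of_real (LINT u:C|A. \<rho> i u))"
    using assms by (intro continues_with_residues_add) (auto simp: good_piece_def)
  hence "continues_with_residues (\<lambda>s. LINT u:B\<union>C|A. J s u) (\<lambda>i. of_real (LINT u:B\<union>C|A. \<rho> i u))"
    by (rule continues_with_residues_cong) (simp_all add: 1 2)
  with 1 2 show ?thesis by (simp add: good_piece_def)
qed

end

text \<open>A Borel piece of an arc; \<open>P\<close> is Lebesgue measure on its parameter set \<open>S\<close>.\<close>

locale curve_piece = measured_curve M \<nu> A + chart_arc M \<nu> I \<gamma> a b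
  for M :: "(real^2) set" and \<nu> A I \<gamma> a b +
  fixes B :: "(real^2) set"
  assumes B: "B \<in> sets A" "B \<subseteq> \<gamma> ` {a..b}"
begin

definition S where "S = {t\<in>{a..b}. \<gamma> t \<in> B}"
definition P where "P = restrict_space lborel S"

lemma S: "S \<in> sets borel" "S \<subseteq> {a..b}" "S \<subseteq> I" "\<gamma> ` S = B"
proof -
  have "\<gamma> \<in> restrict_space lborel {a..b} \<rightarrow>\<^sub>M A" by (rule param_measurable[OF \<gamma> _ ab(2)]) auto
  from measurable_sets[OF this B(1)] have "\<gamma> -` B \<inter> {a..b} \<in> sets borel"
    by (simp add: space_restrict_space sets_restrict_space_iff)
  moreover have "\<gamma> -` B \<inter> {a..b} = S" by (auto simp: S_def)
  ultimately show "S \<in> sets borel" by simp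
  show "\<gamma> ` S = B" using B(2) by (auto simp: S_def)
qed (use ab in \<open>auto simp: S_def\<close>)

lemma space_P: "space P = S" by (simp add: P_def space_restrict_space)

lemma finite_P: "finite_measure P"
proof
  have "emeasure P (space P) = emeasure lborel S"
    unfolding space_P unfolding P_def using S(1) by (intro emeasure_restrict_space) auto
  also have "\<dots> \<le> emeasure lborel {a..b}" using S by (intro emeasure_mono) auto
  finally show "emeasure P (space P) \<noteq> \<infinity>" using ab(1) by (auto simp: top_unique)
qed

lemma \<gamma>_measurable_P: "\<gamma> \<in> P \<rightarrow>\<^sub>M A" unfolding P_def by (rule param_measurable[OF \<gamma> S(1,3)])

lemma continuous_measurable_P: "continuous_on {a..b} f \<Longrightarrow> f \<in> borel_measurable P"
  for f :: "real \<Rightarrow> 'b::topological_space"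
proof -
  assume "continuous_on {a..b} f"
  hence "f \<in> borel_measurable (restrict_space borel S)"
    by (intro borel_measurable_continuous_on_restrict continuous_on_subset[OF _ S(2)])
  thus ?thesis unfolding P_def by (simp cong: measurable_cong_sets add: sets_restrict_space)
qed

lemma integral_piece:
  fixes f :: "real^2 \<Rightarrow> 'b::{banach, second_countable_topology}"
  assumes "f \<in> borel_measurable (restrict_space A B)"
  shows "set_integrable A B f \<longleftrightarrow> integrable P (\<lambda>t. f (\<gamma> t))" "(LINT u:B|A. f u) = (LINT t|P. f (\<gamma> t))"
proof -
  have S': "S \<inter> space lborel \<in> sets lborel" using S(1) by simp
  show "set_integrable A B f \<longleftrightarrow> integrable P (\<lambda>t. f (\<gamma> t))" "(LINT u:B|A. f u) = (LINT t|P. f (\<gamma> t))"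
    using integral_chart[OF \<gamma> S(1,3), unfolded S(4), OF assms]
    unfolding P_def integrable_restrict_space[OF S'] integral_restrict_space[OF S'] set_integrable_def
      set_lebesgue_integral_def by simp_all
qed

end

section \<open>Near and far contributions of a piece of an arc\<close>

text \<open>For \<open>u = \<gamma> t\<close> the points \<open>\<gamma> (t + h)\<close> with \<open>\<bar>h\<bar> < \<epsilon>\<close> are near, all others far. Cutting in the parameter rather than by
distance makes the range of \<open>h\<close> symmetric and independent of \<open>t\<close>.\<close>

locale curve_piece_radius = curve_piece +
  fixes \<epsilon> :: real
  assumes \<epsilon>: "0 < \<epsilon>" "\<epsilon> \<le> 1" "{a - \<epsilon>..b + \<epsilon>} \<subseteq> I"
    and g_close: "\<And>t h. \<lbrakk>t \<in> {a..b}; 0 < \<bar>h\<bar>; \<bar>h\<bar> < \<epsilon>\<rbrakk> \<Longrightarrow> \<bar>g t h - 1\<bar> \<le> 1/2"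
begin

definition Q where "Q = restrict_space lborel {-\<epsilon><..<\<epsilon>}"

lemma space_Q: "space Q = {-\<epsilon><..<\<epsilon>}" by (simp add: Q_def space_restrict_space)

lemma finite_Q: "finite_measure Q"
proof
  have "emeasure Q (space Q) = emeasure lborel {-\<epsilon><..<\<epsilon>}"
    unfolding space_Q unfolding Q_def by (intro emeasure_restrict_space) auto
  thus "emeasure Q (space Q) \<noteq> \<infinity>" using \<epsilon>(1) by simp
qed

definition near :: "real \<Rightarrow> (real^2) set" where "near t = \<gamma> ` {t - \<epsilon><..<t + \<epsilon>}"

lemma interval_in_I: "t \<in> {a..b} \<Longrightarrow> {t - \<epsilon><..<t + \<epsilon>} \<subseteq> I"
proof -
  assume "t \<in> {a..b}"
  hence "{t - \<epsilon><..<t + \<epsilon>} \<subseteq> {a - \<epsilon>..b + \<epsilon>}" by auto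
  thus ?thesis using \<epsilon>(3) by blast
qed

text \<open>In terms of the continuous inverse of the chart, being near means \<open>\<bar>inv v - t\<bar> < \<epsilon>\<close>, an open condition. Openness gives
both the measurability of the cut and, by compactness of its complement, the separation in \<open>far_separated\<close>.\<close>

lemma near_open:
  obtains U where "open U" "\<And>t v. t \<in> {a..b} \<Longrightarrow> v \<in> M \<Longrightarrow> (t, v) \<in> U \<longleftrightarrow> v \<in> near t"
proof -
  obtain inv where inv: "homeomorphism I (\<gamma> ` I) \<gamma> inv" using chart(5) by blast
  let ?D = "{a..b} \<times> \<gamma> ` I"
  have "continuous_on ?D (\<lambda>x. \<bar>inv (snd x) - fst x\<bar>)"
    by (intro continuous_intros continuous_on_compose2[OF homeomorphism_cont2[OF inv] continuous_on_snd]) auto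
  from continuous_openin_preimage_gen[OF this open_lessThan[of \<epsilon>]]
  have "openin (top_of_set ?D) (?D \<inter> (\<lambda>x. \<bar>inv (snd x) - fst x\<bar>) -` {..<\<epsilon>})" .
  moreover have "openin (top_of_set ({a..b} \<times> M)) ?D"
    by (intro openin_Times openin_subtopology_self chart(4))
  ultimately have "openin (top_of_set ({a..b} \<times> M)) (?D \<inter> (\<lambda>x. \<bar>inv (snd x) - fst x\<bar>) -` {..<\<epsilon>})"
    by (rule openin_trans)
  then obtain U where U: "open U" "?D \<inter> (\<lambda>x. \<bar>inv (snd x) - fst x\<bar>) -` {..<\<epsilon>} = ({a..b} \<times> M) \<inter> U"
    unfolding openin_open by blast
  have "(t, v) \<in> U \<longleftrightarrow> v \<in> near t" if t: "t \<in> {a..b}" "v \<in> M" for t v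
  proof -
    have "(t, v) \<in> U \<longleftrightarrow> (t, v) \<in> ?D \<inter> (\<lambda>x. \<bar>inv (snd x) - fst x\<bar>) -` {..<\<epsilon>}"
      unfolding U(2) using t by simp
    also have "\<dots> \<longleftrightarrow> v \<in> \<gamma> ` I \<and> \<bar>inv v - t\<bar> < \<epsilon>" using t by auto
    also have "\<dots> \<longleftrightarrow> v \<in> near t"
    proof
      assume *: "v \<in> \<gamma> ` I \<and> \<bar>inv v - t\<bar> < \<epsilon>"
      hence "v = \<gamma> (inv v)" using homeomorphism_apply2[OF inv, of v] by simp
      moreover have "inv v \<in> {t - \<epsilon><..<t + \<epsilon>}" using * by (auto simp: abs_less_iff)
      ultimately show "v \<in> near t" unfolding near_def by blast
    next
      assume "v \<in> near t"
      then obtain \<tau> where \<tau>: "\<tau> \<in> {t - \<epsilon><..<t + \<epsilon>}" "v = \<gamma> \<tau>" unfolding near_def by blast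
      hence "\<tau> \<in> I" using interval_in_I[OF t(1)] by blast
      thus "v \<in> \<gamma> ` I \<and> \<bar>inv v - t\<bar> < \<epsilon>" using \<tau> homeomorphism_apply1[OF inv] by (auto simp: abs_less_iff)
    qed
    finally show ?thesis .
  qed
  with U(1) that show ?thesis by blast
qed

lemma far_separated:
  obtains \<delta> where "\<delta> > 0" "\<And>t v. \<lbrakk>t \<in> {a..b}; v \<in> M; v \<notin> near t\<rbrakk> \<Longrightarrow> norm (\<gamma> t - v) \<ge> \<delta>"
proof -
  obtain U where U: "open U" "\<And>t v. t \<in> {a..b} \<Longrightarrow> v \<in> M \<Longrightarrow> (t, v) \<in> U \<longleftrightarrow> v \<in> near t"
    by (rule near_open) blast
  define Z where "Z = ({a..b} \<times> M) \<inter> - U"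
  have Z: "compact Z" unfolding Z_def using U(1) compact_M by (intro compact_Int_closed compact_Times) auto
  have cont: "continuous_on Z (\<lambda>x. norm (\<gamma> (fst x) - snd x))"
    by (intro continuous_intros continuous_on_compose2[OF cont_\<gamma> continuous_on_fst]) (use ab in \<open>auto simp: Z_def\<close>)
  have pos: "norm (\<gamma> (fst x) - snd x) > 0" if "x \<in> Z" for x
  proof -
    have "fst x \<in> {a..b}" "snd x \<in> M" "snd x \<notin> near (fst x)" using that U(2) by (auto simp: Z_def)
    moreover have "\<gamma> (fst x) \<in> near (fst x)" using \<epsilon>(1) by (auto simp: near_def)
    ultimately show ?thesis by auto
  qed
  show ?thesis
  proof (cases "Z = {}")
    case True
    show ?thesis
    proof (rule that[of 1])
      fix t v assume "t \<in> {a..b}" "v \<in> M" "v \<notin> near t"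
      hence "(t, v) \<in> Z" using U(2) by (auto simp: Z_def)
      thus "1 \<le> norm (\<gamma> t - v)" using True by simp
    qed simp
  next
    case False
    obtain z where z: "z \<in> Z" "\<And>x. x \<in> Z \<Longrightarrow> norm (\<gamma> (fst z) - snd z) \<le> norm (\<gamma> (fst x) - snd x)"
      using continuous_attains_inf[OF Z False cont] by blast
    show ?thesis
    proof (rule that[OF pos[OF z(1)]])
      fix t v assume "t \<in> {a..b}" "v \<in> M" "v \<notin> near t"
      hence "(t, v) \<in> Z" using U(2) by (auto simp: Z_def)
      from z(2)[OF this] show "norm (\<gamma> (fst z) - snd z) \<le> norm (\<gamma> t - v)" by simp
    qed
  qed
qed

lemma near_integral:
  fixes f :: "real^2 \<Rightarrow> complex"
  assumes t: "t \<in> {a..b}" and f: "f \<in> borel_measurable A"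
  shows "set_integrable A (near t) f \<longleftrightarrow> integrable Q (\<lambda>h. f (\<gamma> (t + h)))"
    "(LINT v:near t|A. f v) = (LINT h|Q. f (\<gamma> (t + h)))"
proof -
  have Q': "{-\<epsilon><..<\<epsilon>} \<inter> space lborel \<in> sets lborel" by simp
  have ind: "indicator {t - \<epsilon><..<t + \<epsilon>} (t + 1 * h) = (indicator {-\<epsilon><..<\<epsilon>} h :: real)" for h
    by (auto simp: indicator_def)
  note ic = integral_chart[OF \<gamma> _ interval_in_I[OF t] measurable_restrict_space1[OF f], folded near_def]
  show "set_integrable A (near t) f \<longleftrightarrow> integrable Q (\<lambda>h. f (\<gamma> (t + h)))"
    using ic(1) lborel_integrable_real_affine_iff[of 1 "\<lambda>\<tau>. indicator {t - \<epsilon><..<t + \<epsilon>} \<tau> *\<^sub>R f (\<gamma> \<tau>)" t]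
    unfolding ind Q_def integrable_restrict_space[OF Q'] set_integrable_def by simp
  show "(LINT v:near t|A. f v) = (LINT h|Q. f (\<gamma> (t + h)))"
    using ic(2) lborel_integral_real_affine[of 1 "\<lambda>\<tau>. indicator {t - \<epsilon><..<t + \<epsilon>} \<tau> *\<^sub>R f (\<gamma> \<tau>)" t]
    unfolding ind Q_def integral_restrict_space[OF Q'] set_lebesgue_integral_def by simp
qed

definition coeff_at :: "nat \<Rightarrow> complex \<Rightarrow> real \<Rightarrow> complex" where "coeff_at j s t = c s t $ j"

text \<open>What is left of the kernel near the diagonal after removing the Taylor polynomial of \<open>\<Phi>\<close>. It is written with \<open>K\<close> rather
than \<open>\<Phi>\<close>, so that joint measurability in \<open>(t, h)\<close> is inherited from \<open>K\<close>.\<close>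

definition remainder_term :: "complex \<Rightarrow> real \<Rightarrow> real \<Rightarrow> complex" where
  "remainder_term s t h = K s (\<gamma> t) (\<gamma> (t + h)) - (\<Sum>j<8. coeff_at j s t * (of_real \<bar>h\<bar> powr (s - 2) * of_real h ^ j))"

lemmas expansion = expandsD[OF expands_\<Phi>[OF \<epsilon>(3,1) g_close], folded coeff_at_def]

lemma near_kernel:
  assumes "t \<in> {a..b}" "0 < \<bar>h\<bar>" "\<bar>h\<bar> < \<epsilon>"
  shows "K s (\<gamma> t) (\<gamma> (t + h)) = of_real \<bar>h\<bar> powr (s - 2) * \<Phi> s t h"
proof -
  have "t + h \<in> {t - \<epsilon><..<t + \<epsilon>}" using assms(3) by (auto simp: abs_less_iff)
  hence th: "t \<in> I" "t + h \<in> I" using interval_in_I[OF assms(1)] assms(1) ab by auto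
  have "g t h > 0" using g_close[OF assms] abs_ge_minus_self[of "g t h - 1"] by linarith
  from kernel_chart[OF th _ this] K_eq_kernel assms(2) show ?thesis by auto
qed

text \<open>The remainder is \<open>\<bar>h\<bar> powr (s + 6)\<close> times a bounded function, and \<open>\<bar>h\<bar> \<le> 1\<close>.\<close>

lemma remainder_term_bound:
  obtains C where "\<And>s t h. \<lbrakk>norm s < r; s \<in> half_plane; t \<in> {a..b}; \<bar>h\<bar> < \<epsilon>\<rbrakk> \<Longrightarrow> norm (remainder_term s t h) \<le> C"
proof -
  obtain C where C: "C \<ge> 0" "\<And>s t h. \<lbrakk>s \<in> ball 0 r; t \<in> {a..b}; 0 < \<bar>h\<bar>; \<bar>h\<bar> < \<epsilon>\<rbrakk> \<Longrightarrow> norm (taylor_remainder 8 \<Phi> c s t h) \<le> C"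
    using loc_bounded_D[OF expansion(2)] by metis
  show ?thesis
  proof (rule that[of C])
    fix s t h assume *: "norm s < r" "s \<in> half_plane" "t \<in> {a..b}" "\<bar>h\<bar> < \<epsilon>"
    show "norm (remainder_term s t h) \<le> C"
    proof (cases "h = 0")
      case True
      thus ?thesis using C(1) by (simp add: remainder_term_def)
    next
      case False
      hence h: "0 < \<bar>h\<bar>" by simp
      have "remainder_term s t h = of_real \<bar>h\<bar> powr (s - 2) * (\<Phi> s t h - (\<Sum>j<8. coeff_at j s t * of_real h ^ j))"
        unfolding remainder_term_def near_kernel[OF *(3) h *(4)] by (simp add: algebra_simps sum_distrib_left)
      also have "\<Phi> s t h - (\<Sum>j<8. coeff_at j s t * of_real h ^ j) = of_real h ^ 8 * taylor_remainder 8 \<Phi> c s t h"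
        using expands_eq[OF h, of \<Phi> s t c 8] by (simp add: coeff_at_def)
      also have "complex_of_real h ^ 8 = of_real \<bar>h\<bar> powr (of_nat 8)"
      proof -
        have "complex_of_real \<bar>h\<bar> powr (of_nat 8) = of_real \<bar>h\<bar> ^ 8" using h by (intro powr_nat') auto
        also have "\<dots> = complex_of_real (\<bar>h\<bar> ^ 8)" by (simp only: of_real_power)
        also have "\<bar>h\<bar> ^ 8 = h ^ 8" by (simp add: power_even_abs)
        finally show ?thesis by (simp only: of_real_power)
      qed
      finally have "remainder_term s t h = of_real \<bar>h\<bar> powr (s - 2 + of_nat 8) * taylor_remainder 8 \<Phi> c s t h"
        by (simp only: powr_add mult.assoc)
      hence "norm (remainder_term s t h) = norm (complex_of_real \<bar>h\<bar> powr (s - 2 + of_nat 8)) * norm (taylor_remainder 8 \<Phi> c s t h)"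
        by (simp only: norm_mult)
      also have "\<dots> \<le> 1 * C"
        using * \<epsilon>(2) by (intro mult_mono norm_abs_powr_le_1 C h) (auto simp: half_plane_def)
      finally show ?thesis by simp
    qed
  qed
qed

lemma coeff_at_measurable: "coeff_at j s \<in> borel_measurable P"
  using expansion(1)[of j] by (intro continuous_measurable_P) (auto simp: entire_family_def)

lemma param_sum_measurable: "(\<lambda>x. \<gamma> (fst x + snd x)) \<in> P \<Otimes>\<^sub>M Q \<rightarrow>\<^sub>M A"
proof -
  have "(\<lambda>x. fst x) \<in> borel_measurable (P \<Otimes>\<^sub>M Q)" "(\<lambda>x. snd x) \<in> borel_measurable (P \<Otimes>\<^sub>M Q)"
    by (rule measurable_compose[OF measurable_fst], simp add: P_def measurable_restrict_space1,
        rule measurable_compose[OF measurable_snd], simp add: Q_def measurable_restrict_space1)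
  hence "(\<lambda>x. fst x + snd x) \<in> borel_measurable (P \<Otimes>\<^sub>M Q)" by measurable
  moreover have "fst x + snd x \<in> {a - \<epsilon>..b + \<epsilon>}" if "x \<in> space (P \<Otimes>\<^sub>M Q)" for x
    using that S(2) by (auto simp: space_pair_measure space_P space_Q subset_eq)
  ultimately have "(\<lambda>x. fst x + snd x) \<in> P \<Otimes>\<^sub>M Q \<rightarrow>\<^sub>M restrict_space lborel {a - \<epsilon>..b + \<epsilon>}"
    by (intro measurable_restrict_space2) auto
  moreover have "\<gamma> \<in> restrict_space lborel {a - \<epsilon>..b + \<epsilon>} \<rightarrow>\<^sub>M A"
    by (rule param_measurable[OF \<gamma> _ \<epsilon>(3)]) simp
  ultimately show ?thesis by (rule measurable_compose)
qed

lemma remainder_term_measurable: "(\<lambda>x. remainder_term s (fst x) (snd x)) \<in> borel_measurable (P \<Otimes>\<^sub>M Q)"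
proof -
  have 1: "(\<lambda>x. K s (\<gamma> (fst x)) (\<gamma> (fst x + snd x))) \<in> borel_measurable (P \<Otimes>\<^sub>M Q)"
    by (rule K_measurable[OF measurable_compose[OF measurable_fst \<gamma>_measurable_P] param_sum_measurable])
  have 2: "(\<lambda>x. coeff_at j s (fst x)) \<in> borel_measurable (P \<Otimes>\<^sub>M Q)" for j
    by (rule measurable_compose[OF measurable_fst coeff_at_measurable])
  have 3: "(\<lambda>x. snd x) \<in> borel_measurable (P \<Otimes>\<^sub>M Q)"
    by (rule measurable_compose[OF measurable_snd]) (simp add: Q_def measurable_restrict_space1)
  have 4: "(\<lambda>x. complex_of_real \<bar>snd x\<bar> powr (s - 2)) \<in> borel_measurable (P \<Otimes>\<^sub>M Q)"
    by (rule measurable_of_real_powr[OF 3])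
  have 5: "(\<lambda>x. complex_of_real (snd x) ^ j) \<in> borel_measurable (P \<Otimes>\<^sub>M Q)" for j
    using 3 by measurable
  show ?thesis unfolding remainder_term_def
    by (intro borel_measurable_diff borel_measurable_sum borel_measurable_times 1 2 4 5)
qed

end

section \<open>The residues\<close>

context curve_piece_radius
begin

sublocale finP: finite_measure P by (rule finite_P)
sublocale finQ: finite_measure Q by (rule finite_Q)
sublocale finA: finite_measure A by (rule finite_measure_A)
sublocale PQ: pair_sigma_finite P Q ..
sublocale PA: pair_sigma_finite P A ..

lemma finite_PQ: "finite_measure (P \<Otimes>\<^sub>M Q)"
proof
  have "emeasure (P \<Otimes>\<^sub>M Q) (space P \<times> space Q) = emeasure P (space P) * emeasure Q (space Q)"
    by (rule finQ.emeasure_pair_measure_Times[OF sets.top sets.top])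
  thus "emeasure (P \<Otimes>\<^sub>M Q) (space (P \<Otimes>\<^sub>M Q)) \<noteq> \<infinity>"
    by (simp add: space_pair_measure ennreal_mult_eq_top_iff)
qed

lemma finite_PA: "finite_measure (P \<Otimes>\<^sub>M A)"
proof
  have "emeasure (P \<Otimes>\<^sub>M A) (space P \<times> space A) = emeasure P (space P) * emeasure A (space A)"
    by (rule finA.emeasure_pair_measure_Times[OF sets.top sets.top])
  thus "emeasure (P \<Otimes>\<^sub>M A) (space (P \<Otimes>\<^sub>M A)) \<noteq> \<infinity>"
    by (simp add: space_pair_measure ennreal_mult_eq_top_iff)
qed

definition remainder_integral :: "complex \<Rightarrow> complex" where
  "remainder_integral s = (LINT x|(P \<Otimes>\<^sub>M Q). remainder_term s (fst x) (snd x))"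

lemma in_PQ: "x \<in> space (P \<Otimes>\<^sub>M Q) \<Longrightarrow> fst x \<in> {a..b} \<and> \<bar>snd x\<bar> < \<epsilon>"
  using S(2) by (auto simp: space_pair_measure space_P space_Q abs_less_iff)

lemma remainder_integral_holomorphic: "remainder_integral holomorphic_on half_plane"
  unfolding remainder_integral_def[abs_def]
proof (rule holomorphic_on_lebesgue_integral[OF finite_PQ half_plane(1) remainder_term_measurable])
  show "(\<lambda>s. remainder_term s (fst x) (snd x)) holomorphic_on half_plane" if "x \<in> space (P \<Otimes>\<^sub>M Q)" for x
  proof -
    have "(\<lambda>s. coeff_at j s (fst x)) holomorphic_on half_plane" for j
      using expansion(1)[of j] in_PQ[OF that] unfolding entire_family_def
      by (meson holomorphic_on_subset subset_UNIV)
    moreover have "(\<lambda>s. complex_of_real \<bar>snd x\<bar> powr (s - 2)) holomorphic_on half_plane"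
      by (cases "snd x = 0") (auto intro!: holomorphic_intros)
    ultimately show ?thesis unfolding remainder_term_def
      by (intro holomorphic_intros K_holomorphic) auto
  qed
  fix s0 :: complex
  show "\<exists>r>0. \<exists>C. \<forall>s\<in>ball s0 r. \<forall>x\<in>space (P \<Otimes>\<^sub>M Q). norm (remainder_term s (fst x) (snd x)) \<le> C"
    if "s0 \<in> half_plane"
  proof -
    obtain r where r: "r > 0" "ball s0 r \<subseteq> half_plane" using openE[OF half_plane(1) \<open>s0 \<in> half_plane\<close>] by metis
    obtain C where C: "\<And>s t h. \<lbrakk>norm s < norm s0 + r; s \<in> half_plane; t \<in> {a..b}; \<bar>h\<bar> < \<epsilon>\<rbrakk> \<Longrightarrow> norm (remainder_term s t h) \<le> C"
      by (rule remainder_term_bound) blast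
    have "norm (remainder_term s (fst x) (snd x)) \<le> C" if "s \<in> ball s0 r" "x \<in> space (P \<Otimes>\<^sub>M Q)" for s x
    proof (rule C)
      show "norm s < norm s0 + r"
        using that(1) norm_triangle_ineq2[of s s0] by (simp add: dist_norm norm_minus_commute)
    qed (use that r in_PQ in auto)
    with r(1) show ?thesis by blast
  qed
qed

lemma remainder_term_integrable:
  assumes "s \<in> half_plane"
  shows "integrable (P \<Otimes>\<^sub>M Q) (\<lambda>x. remainder_term s (fst x) (snd x))" "t \<in> {a..b} \<Longrightarrow> integrable Q (remainder_term s t)"
proof -
  obtain C where C: "\<And>s' t h. \<lbrakk>norm s' < norm s + 1; s' \<in> half_plane; t \<in> {a..b}; \<bar>h\<bar> < \<epsilon>\<rbrakk> \<Longrightarrow> norm (remainder_term s' t h) \<le> C"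
    by (rule remainder_term_bound) blast
  have C': "norm (remainder_term s t h) \<le> C" if "t \<in> {a..b}" "\<bar>h\<bar> < \<epsilon>" for t h
    using C[OF _ assms that] by simp
  interpret PQ': finite_measure "P \<Otimes>\<^sub>M Q" by (rule finite_PQ)
  show "integrable (P \<Otimes>\<^sub>M Q) (\<lambda>x. remainder_term s (fst x) (snd x))"
    by (rule PQ'.integrable_const_bound[OF AE_I2 remainder_term_measurable]) (use C' in_PQ in blast)
  show "integrable Q (remainder_term s t)" if t: "t \<in> {a..b}"
  proof (rule finQ.integrable_const_bound[OF AE_I2])
    show "norm (remainder_term s t h) \<le> C" if "h \<in> space Q" for h
      using that by (intro C' t) (auto simp: space_Q abs_less_iff)
    have 1: "(\<lambda>h. \<gamma> (t + h)) \<in> Q \<rightarrow>\<^sub>M A"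
    proof -
      have "(\<lambda>h. h) \<in> borel_measurable Q" by (simp add: Q_def measurable_restrict_space1)
      moreover have "t + h \<in> {a - \<epsilon>..b + \<epsilon>}" if "h \<in> space Q" for h
        using that t by (auto simp: space_Q)
      ultimately have "(\<lambda>h. t + h) \<in> Q \<rightarrow>\<^sub>M restrict_space lborel {a - \<epsilon>..b + \<epsilon>}"
        by (intro measurable_restrict_space2) auto
      moreover have "\<gamma> \<in> restrict_space lborel {a - \<epsilon>..b + \<epsilon>} \<rightarrow>\<^sub>M A"
        by (rule param_measurable[OF \<gamma> _ \<epsilon>(3)]) simp
      ultimately show ?thesis by (rule measurable_compose)
    qed
    have 2: "(\<lambda>h. \<gamma> t) \<in> Q \<rightarrow>\<^sub>M A" using chart(9)[of t] t ab by (intro measurable_const) auto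
    have 3: "(\<lambda>h. h) \<in> borel_measurable Q" by (simp add: Q_def measurable_restrict_space1)
    have 4: "(\<lambda>h. complex_of_real \<bar>h\<bar> powr (s - 2)) \<in> borel_measurable Q"
      by (rule measurable_of_real_powr[OF 3])
    have 5: "(\<lambda>h. complex_of_real h ^ j) \<in> borel_measurable Q" for j using 3 by measurable
    show "remainder_term s t \<in> borel_measurable Q" unfolding remainder_term_def[abs_def]
      by (intro borel_measurable_diff borel_measurable_sum borel_measurable_times borel_measurable_const
          K_measurable[OF 2 1] 4 5)
  qed
qed

text \<open>The moments of \<open>\<bar>h\<bar> powr (s - 2)\<close> over \<open>(-\<epsilon>, \<epsilon>)\<close>; the only source of poles.\<close>

definition \<mu> :: "nat \<Rightarrow> complex \<Rightarrow> complex" where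
  "\<mu> j s = (if even j then 2 * of_real \<epsilon> powr (s - 1 + of_nat j) / (s - 1 + of_nat j) else 0)"

lemma near_part:
  assumes s: "Re s > 2" and t: "t \<in> {a..b}"
  shows "set_integrable A (near t) (K s (\<gamma> t))"
    "(LINT v:near t|A. K s (\<gamma> t) v) = (LINT h|Q. remainder_term s t h) + (\<Sum>j<8. coeff_at j s t * \<mu> j s)"
proof -
  have K: "K s (\<gamma> t) \<in> borel_measurable A"
    by (rule K_measurable) (use chart(9)[of t] t ab in auto)
  have Q': "{-\<epsilon><..<\<epsilon>} \<inter> space lborel \<in> sets lborel" by simp
  have m: "integrable Q (\<lambda>h. of_real \<bar>h\<bar> powr (s - 2) * of_real h ^ j)"
    "(LINT h|Q. of_real \<bar>h\<bar> powr (s - 2) * of_real h ^ j) = \<mu> j s" for j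
    using moment[OF \<epsilon>(1,2) s, of j]
    unfolding Q_def integrable_restrict_space[OF Q'] integral_restrict_space[OF Q'] set_integrable_def
      set_lebesgue_integral_def \<mu>_def by simp_all
  have R: "integrable Q (remainder_term s t)" using s t by (intro remainder_term_integrable) (auto simp: half_plane_def)
  have eq: "K s (\<gamma> t) (\<gamma> (t + h)) = remainder_term s t h + (\<Sum>j<8. coeff_at j s t * (of_real \<bar>h\<bar> powr (s - 2) * of_real h ^ j))" for h
    by (simp add: remainder_term_def)
  have i: "integrable Q (\<lambda>h. \<Sum>j<8. coeff_at j s t * (of_real \<bar>h\<bar> powr (s - 2) * of_real h ^ j))"
    by (intro Bochner_Integration.integrable_sum integrable_mult_right m)
  show "set_integrable A (near t) (K s (\<gamma> t))"
    unfolding near_integral(1)[OF t K] eq by (intro Bochner_Integration.integrable_add R i)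
  have "(LINT v:near t|A. K s (\<gamma> t) v) = (LINT h|Q. remainder_term s t h) +
      (LINT h|Q. (\<Sum>j<8. coeff_at j s t * (of_real \<bar>h\<bar> powr (s - 2) * of_real h ^ j)))"
    unfolding near_integral(2)[OF t K] eq by (rule Bochner_Integration.integral_add[OF R i])
  also have "(LINT h|Q. (\<Sum>j<8. coeff_at j s t * (of_real \<bar>h\<bar> powr (s - 2) * of_real h ^ j))) = (\<Sum>j<8. coeff_at j s t * \<mu> j s)"
    by (subst Bochner_Integration.integral_sum) (use m in \<open>auto intro!: integrable_mult_right\<close>)
  finally show "(LINT v:near t|A. K s (\<gamma> t) v) = (LINT h|Q. remainder_term s t h) + (\<Sum>j<8. coeff_at j s t * \<mu> j s)" .
qed

definition far_kernel :: "complex \<Rightarrow> real \<Rightarrow> real^2 \<Rightarrow> complex" where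
  "far_kernel s t v = (if v \<in> near t then 0 else K s (\<gamma> t) v)"

definition far_integral :: "complex \<Rightarrow> complex" where
  "far_integral s = (LINT x|(P \<Otimes>\<^sub>M A). far_kernel s (fst x) (snd x))"

lemma in_PA: "x \<in> space (P \<Otimes>\<^sub>M A) \<Longrightarrow> fst x \<in> {a..b} \<and> snd x \<in> M"
  using S(2) by (auto simp: space_pair_measure space_P)

lemma far_bound:
  obtains C where "\<And>s x. \<lbrakk>norm s \<le> r; x \<in> space (P \<Otimes>\<^sub>M A)\<rbrakk> \<Longrightarrow> norm (far_kernel s (fst x) (snd x)) \<le> C"
proof -
  obtain \<delta> where \<delta>: "\<delta> > 0" "\<And>t v. \<lbrakk>t \<in> {a..b}; v \<in> M; v \<notin> near t\<rbrakk> \<Longrightarrow> norm (\<gamma> t - v) \<ge> \<delta>"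
    by (rule far_separated) blast
  obtain C where C: "\<And>s u v. \<lbrakk>u \<in> M; v \<in> M; norm (u - v) \<ge> \<delta>; norm s \<le> r\<rbrakk> \<Longrightarrow> norm (K s u v) \<le> C"
    by (rule K_bound_off_diagonal[OF \<delta>(1)]) blast
  show ?thesis
  proof (rule that[of "max 0 C"])
    fix s :: complex and x assume *: "norm s \<le> r" "x \<in> space (P \<Otimes>\<^sub>M A)"
    note x = in_PA[OF *(2)]
    have "\<gamma> (fst x) \<in> M" using x ab by (intro chart(9)) auto
    with x *(1) C \<delta>(2) show "norm (far_kernel s (fst x) (snd x)) \<le> max 0 C"
      by (auto simp: far_kernel_def le_max_iff_disj)
  qed
qed

lemma far_measurable: "(\<lambda>x. far_kernel s (fst x) (snd x)) \<in> borel_measurable (P \<Otimes>\<^sub>M A)"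
proof -
  obtain U where U: "open U" "\<And>t v. t \<in> {a..b} \<Longrightarrow> v \<in> M \<Longrightarrow> (t, v) \<in> U \<longleftrightarrow> v \<in> near t"
    by (rule near_open) blast
  have 1: "(\<lambda>x. fst x) \<in> borel_measurable (P \<Otimes>\<^sub>M A)"
    by (rule measurable_compose[OF measurable_fst]) (simp add: P_def measurable_restrict_space1)
  have 2: "(\<lambda>x. snd x) \<in> borel_measurable (P \<Otimes>\<^sub>M A)"
    by (rule measurable_compose[OF measurable_snd id_measurable])
  have "(\<lambda>x. (fst x, snd x)) \<in> borel_measurable (P \<Otimes>\<^sub>M A)"
    by (rule borel_measurable_Pair[OF 1 2])
  from measurable_sets[OF this, of U] U(1)
  have "{x \<in> space (P \<Otimes>\<^sub>M A). x \<in> U} \<in> sets (P \<Otimes>\<^sub>M A)" by (simp add: vimage_def Int_def conj_commute)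
  moreover have "(\<lambda>x. K s (\<gamma> (fst x)) (snd x)) \<in> borel_measurable (P \<Otimes>\<^sub>M A)"
    by (rule K_measurable[OF measurable_compose[OF measurable_fst \<gamma>_measurable_P] measurable_snd])
  ultimately have "(\<lambda>x. if x \<in> U then 0 else K s (\<gamma> (fst x)) (snd x)) \<in> borel_measurable (P \<Otimes>\<^sub>M A)"
    by (intro measurable_If measurable_const) auto
  thus ?thesis
    by (rule measurable_cong[THEN iffD1, rotated]) (use in_PA U(2) in \<open>force simp: far_kernel_def\<close>)
qed

lemma far_integral_holomorphic: "far_integral holomorphic_on half_plane"
  unfolding far_integral_def[abs_def]
proof (rule holomorphic_on_lebesgue_integral[OF finite_PA half_plane(1) far_measurable])
  show "(\<lambda>s. far_kernel s (fst x) (snd x)) holomorphic_on half_plane" for x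
    unfolding far_kernel_def by (cases "snd x \<in> near (fst x)") (auto intro: K_holomorphic)
  fix s0 :: complex
  obtain C where C: "\<And>s x. \<lbrakk>norm s \<le> norm s0 + 1; x \<in> space (P \<Otimes>\<^sub>M A)\<rbrakk> \<Longrightarrow> norm (far_kernel s (fst x) (snd x)) \<le> C"
    by (rule far_bound) blast
  have "norm (far_kernel s (fst x) (snd x)) \<le> C" if "s \<in> ball s0 1" "x \<in> space (P \<Otimes>\<^sub>M A)" for s x
  proof (rule C[OF _ that(2)])
    show "norm s \<le> norm s0 + 1"
      using that(1) norm_triangle_ineq2[of s s0] by (simp add: dist_norm norm_minus_commute)
  qed
  thus "\<exists>r>0. \<exists>C. \<forall>s\<in>ball s0 r. \<forall>x\<in>space (P \<Otimes>\<^sub>M A). norm (far_kernel s (fst x) (snd x)) \<le> C"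
    by (intro exI[of _ 1] conjI zero_less_one exI[of _ C] ballI)
qed

lemma far_integrable:
  shows "integrable (P \<Otimes>\<^sub>M A) (\<lambda>x. far_kernel s (fst x) (snd x))" "t \<in> S \<Longrightarrow> integrable A (far_kernel s t)"
proof -
  obtain C where C: "\<And>s' x. \<lbrakk>norm s' \<le> norm s; x \<in> space (P \<Otimes>\<^sub>M A)\<rbrakk> \<Longrightarrow> norm (far_kernel s' (fst x) (snd x)) \<le> C"
    by (rule far_bound) blast
  interpret PA': finite_measure "P \<Otimes>\<^sub>M A" by (rule finite_PA)
  show "integrable (P \<Otimes>\<^sub>M A) (\<lambda>x. far_kernel s (fst x) (snd x))"
    by (rule PA'.integrable_const_bound[OF AE_I2 far_measurable]) (use C in blast)
  show "integrable A (far_kernel s t)" if t: "t \<in> S"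
  proof (rule finA.integrable_const_bound[OF AE_I2])
    show "norm (far_kernel s t v) \<le> C" if "v \<in> space A" for v
      using C[of s "(t, v)"] t that by (simp add: space_pair_measure space_P)
    have "t \<in> space P" using t by (simp add: space_P)
    from measurable_compose[OF measurable_Pair1'[OF this] far_measurable[of s]]
    show "far_kernel s t \<in> borel_measurable A" by simp
  qed
qed

text \<open>Only the last sum has poles as a function of \<open>s\<close>; the other two terms integrate to holomorphic functions on the half plane.\<close>

lemma J_decomposition:
  assumes s: "Re s > 2" and t: "t \<in> S"
  shows "J s (\<gamma> t) = (LINT v|A. far_kernel s t v) + (LINT h|Q. remainder_term s t h) + (\<Sum>j<8. coeff_at j s t * \<mu> j s)"
proof -
  have t': "t \<in> {a..b}" using t S(2) by blast
  have "J s (\<gamma> t) = (LINT v|A. far_kernel s t v + indicator (near t) v *\<^sub>R K s (\<gamma> t) v)"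
    unfolding J_def by (rule Bochner_Integration.integral_cong) (auto simp: far_kernel_def indicator_def)
  also have "\<dots> = (LINT v|A. far_kernel s t v) + (LINT v:near t|A. K s (\<gamma> t) v)"
    unfolding set_lebesgue_integral_def
    using far_integrable(2)[OF t] near_part(1)[OF s t'] unfolding set_integrable_def
    by (intro Bochner_Integration.integral_add)
  finally show ?thesis unfolding near_part(2)[OF s t'] by (simp add: add.assoc)
qed

definition coeff_integral :: "nat \<Rightarrow> complex \<Rightarrow> complex" where "coeff_integral j s = (LINT t|P. coeff_at j s t)"

lemma coeff_at_bound:
  obtains C where "\<And>s t. \<lbrakk>norm s < r; t \<in> {a..b}\<rbrakk> \<Longrightarrow> norm (coeff_at j s t) \<le> C"
proof -
  have "\<exists>C. \<forall>s\<in>ball 0 r. \<forall>t\<in>{a..b}. norm (coeff_at j s t) \<le> C"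
    using expansion(1)[of j] unfolding entire_family_def by blast
  then obtain C where "\<forall>s\<in>ball 0 r. \<forall>t\<in>{a..b}. norm (coeff_at j s t) \<le> C" by blast
  thus ?thesis by (intro that[of C]) auto
qed

lemma coeff_integral_holomorphic: "coeff_integral j holomorphic_on half_plane"
  unfolding coeff_integral_def[abs_def]
proof (rule holomorphic_on_lebesgue_integral[OF finite_P half_plane(1) coeff_at_measurable])
  show "(\<lambda>s. coeff_at j s t) holomorphic_on half_plane" if "t \<in> space P" for t
    using expansion(1)[of j] that S(2) unfolding entire_family_def space_P
    by (meson holomorphic_on_subset subset_UNIV subsetD)
  fix s0 :: complex
  obtain C where C: "\<And>s t. \<lbrakk>norm s < norm s0 + 1; t \<in> {a..b}\<rbrakk> \<Longrightarrow> norm (coeff_at j s t) \<le> C"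
    by (rule coeff_at_bound) blast
  have "norm (coeff_at j s t) \<le> C" if "s \<in> ball s0 1" "t \<in> space P" for s t
  proof (rule C)
    show "norm s < norm s0 + 1"
      using that(1) norm_triangle_ineq2[of s s0] by (simp add: dist_norm norm_minus_commute)
  qed (use that S(2) in \<open>auto simp: space_P\<close>)
  thus "\<exists>r>0. \<exists>C. \<forall>s\<in>ball s0 r. \<forall>t\<in>space P. norm (coeff_at j s t) \<le> C"
    by (intro exI[of _ 1] conjI zero_less_one exI[of _ C] ballI)
qed

lemma coeff_at_integrable: "integrable P (coeff_at j s)"
proof -
  obtain C where C: "\<And>s' t. \<lbrakk>norm s' < norm s + 1; t \<in> {a..b}\<rbrakk> \<Longrightarrow> norm (coeff_at j s' t) \<le> C"
    by (rule coeff_at_bound) blast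
  show ?thesis
    by (rule finP.integrable_const_bound[where B=C, OF AE_I2 coeff_at_measurable]) (use C S(2) in \<open>auto simp: space_P\<close>)
qed

lemma integral_J:
  assumes s: "Re s > 2"
  shows "set_integrable A B (J s)"
    "(LINT u:B|A. J s u) = far_integral s + remainder_integral s + (\<Sum>j<8. coeff_integral j s * \<mu> j s)"
proof -
  have sh: "s \<in> half_plane" using s by (simp add: half_plane_def)
  let ?f1 = "\<lambda>t. LINT v|A. far_kernel s t v" and ?f2 = "\<lambda>t. LINT h|Q. remainder_term s t h"
    and ?f3 = "\<lambda>t. \<Sum>j<8. coeff_at j s t * \<mu> j s"
  have i1: "integrable P ?f1" "(LINT t|P. ?f1 t) = far_integral s"
    using PA.integrable_fst'[OF far_integrable(1)] PA.integral_fst'[OF far_integrable(1)]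
    by (simp_all add: far_integral_def)
  have i2: "integrable P ?f2" "(LINT t|P. ?f2 t) = remainder_integral s"
    using PQ.integrable_fst'[OF remainder_term_integrable(1)[OF sh]] PQ.integral_fst'[OF remainder_term_integrable(1)[OF sh]]
    by (simp_all add: remainder_integral_def)
  have i3: "integrable P ?f3" "(LINT t|P. ?f3 t) = (\<Sum>j<8. coeff_integral j s * \<mu> j s)"
    unfolding coeff_integral_def by (simp_all add: coeff_at_integrable)
  have Jm: "J s \<in> borel_measurable (restrict_space A B)" by (rule measurable_restrict_space1[OF J_measurable])
  have eq: "J s (\<gamma> t) = ?f1 t + ?f2 t + ?f3 t" if "t \<in> space P" for t
    using J_decomposition[OF s] that by (simp add: space_P)
  have "integrable P (\<lambda>t. ?f1 t + ?f2 t + ?f3 t)" by (intro Bochner_Integration.integrable_add i1 i2 i3)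
  moreover have "integrable P (\<lambda>t. J s (\<gamma> t)) \<longleftrightarrow> integrable P (\<lambda>t. ?f1 t + ?f2 t + ?f3 t)"
    by (rule Bochner_Integration.integrable_cong[OF refl]) (rule eq)
  ultimately have "integrable P (\<lambda>t. J s (\<gamma> t))" by blast
  thus "set_integrable A B (J s)" by (simp add: integral_piece(1)[OF Jm])
  have "(LINT u:B|A. J s u) = (LINT t|P. ?f1 t + ?f2 t + ?f3 t)"
    unfolding integral_piece(2)[OF Jm] by (rule Bochner_Integration.integral_cong[OF refl]) (rule eq)
  also have "\<dots> = far_integral s + remainder_integral s + (\<Sum>j<8. coeff_integral j s * \<mu> j s)"
    by (simp add: i1 i2 i3 Bochner_Integration.integral_add Bochner_Integration.integrable_add del: Bochner_Integration.integral_sum)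
  finally show "(LINT u:B|A. J s u) = far_integral s + remainder_integral s + (\<Sum>j<8. coeff_integral j s * \<mu> j s)" .
qed

definition \<rho>_chart :: "nat \<Rightarrow> real \<Rightarrow> real" where
  "\<rho>_chart i t =
     (if i = 0 then -2
     else if i = 1 then 3/4 * (k 0 t)^2
     else if i = 2 then 45/64 * (k 0 t)^4 + 5/4 * (k 1 t)^2 + 15/8 * k 0 t * k 2 t
     else 175/512 * (k 0 t)^6 + 1295/288 * (k 0 t)^2 * (k 1 t)^2
           + 1085/576 * (k 0 t)^3 * k 2 t + 175/576 * (k 2 t)^2
           + 35/72 * k 1 t * k 3 t + 35/144 * k 0 t * k 4 t)"

text \<open>Every monomial contains an even total number of differentiations, so the sign \<open>\<sigma>\<close> of \<open>curvature_deriv_chart\<close> drops out.\<close>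

lemma \<rho>_eq_chart: "t \<in> I \<Longrightarrow> \<rho> i (\<gamma> t) = \<rho>_chart i t"
proof -
  assume "t \<in> I"
  then obtain \<sigma> where \<sigma>: "\<sigma> \<in> {1,-1::real}" "\<And>n. curvature_deriv M \<nu> n (\<gamma> t) = \<sigma> ^ n * k n t"
    by (rule curvature_deriv_chart) blast
  from \<sigma>(1) consider "\<sigma> = 1" | "\<sigma> = -1" by blast
  thus ?thesis by cases (simp_all add: \<rho>_def \<rho>_chart_def \<sigma>(2) Let_def)
qed

lemma cont_\<rho>_chart: "continuous_on I (\<rho>_chart i)"
  by (cases "i = 0"; cases "i = 1"; cases "i = 2") (auto simp: \<rho>_chart_def[abs_def] intro!: continuous_intros cont_k)

lemma \<rho>_measurable: "\<rho> i \<in> borel_measurable (restrict_space A B)"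
proof -
  obtain inv where inv: "homeomorphism I (\<gamma> ` I) \<gamma> inv" using chart(5) by blast
  have BI: "B \<subseteq> \<gamma> ` I" using B(2) ab by blast
  have "continuous_on B (\<lambda>u. \<rho>_chart i (inv u))"
    by (rule continuous_on_compose2[OF cont_\<rho>_chart continuous_on_subset[OF homeomorphism_cont2[OF inv] BI]])
       (use BI inv in \<open>auto simp: homeomorphism_def\<close>)
  moreover have "\<rho> i u = \<rho>_chart i (inv u)" if "u \<in> B" for u
  proof -
    have "u \<in> \<gamma> ` I" using that BI by blast
    hence "inv u \<in> I" "\<gamma> (inv u) = u" using homeomorphism_apply2[OF inv] homeomorphism_image2[OF inv] by auto
    thus ?thesis using \<rho>_eq_chart[of "inv u" i] by simp
  qed
  ultimately have "continuous_on B (\<rho> i)" by (simp cong: continuous_on_cong)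
  hence "\<rho> i \<in> borel_measurable (restrict_space borel B)" by (rule borel_measurable_continuous_on_restrict)
  moreover have "sets (restrict_space A B) = sets (restrict_space borel B)"
  proof (rule set_eqI)
    fix X
    have BM: "B \<in> sets borel" "B \<subseteq> M" using B(1) sets_A by blast+
    have "X \<in> sets (restrict_space A B) \<longleftrightarrow> X \<in> sets A \<and> X \<subseteq> B"
      using sets_restrict_space_iff[OF sets.Int[OF B(1) sets.top]] by blast
    also have "\<dots> \<longleftrightarrow> X \<in> sets borel \<and> X \<subseteq> B" using sets_A BM(2) by blast
    also have "\<dots> \<longleftrightarrow> X \<in> sets (restrict_space borel B)"
      using sets_restrict_space_iff[OF sets.Int[OF BM(1) sets.top]] by blast
    finally show "X \<in> sets (restrict_space A B) \<longleftrightarrow> X \<in> sets (restrict_space borel B)" .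
  qed
  ultimately show ?thesis by (simp cong: measurable_cong_sets)
qed

lemma coeff_at_pole:
  assumes "i < 4" "t \<in> I"
  shows "2 * coeff_at (2 * i) (pole i) t = of_real (\<rho>_chart i t)"
proof -
  note fs = frenet_series.kernel_series_residue_0[OF frenet_series_chart[OF assms(2)]]
    frenet_series.kernel_series_residue_2[OF frenet_series_chart[OF assms(2)]]
    frenet_series.kernel_series_residue_4[OF frenet_series_chart[OF assms(2)]]
    frenet_series.kernel_series_residue_6[OF frenet_series_chart[OF assms(2)]]
  from assms(1) consider "i = 0" | "i = 1" | "i = 2" | "i = 3" by linarith
  thus ?thesis
    by cases (simp_all add: coeff_at_def c_def pole_def \<rho>_chart_def fs, simp_all add: algebra_simps)
qed

text \<open>For even \<open>j = 2 i\<close> the product of the integrated coefficient and the moment is \<open>\<phi> i s / (s - pole i)\<close> with \<open>\<phi> i\<close> holomorphic. Its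
residue \<open>\<phi> i (pole i)\<close> is \<open>2 \<integral> c\<^sub>2\<^sub>i(pole i, t) dt\<close>, since \<open>\<epsilon> powr 0 = 1\<close>.\<close>

lemma good_piece_B: "good_piece B"
proof -
  have \<rho>: "set_integrable A B (\<rho> i)" "(LINT u:B|A. \<rho> i u) = (LINT t|P. \<rho>_chart i t)" for i
  proof -
    have eq: "\<rho> i (\<gamma> t) = \<rho>_chart i t" if "t \<in> space P" for t using that S(3) \<rho>_eq_chart by (auto simp: space_P)
    have "compact (\<rho>_chart i ` {a..b})"
      by (intro compact_continuous_image continuous_on_subset[OF cont_\<rho>_chart ab(2)]) auto
    then obtain D where D: "\<And>x. x \<in> \<rho>_chart i ` {a..b} \<Longrightarrow> norm x \<le> D"
      using compact_imp_bounded bounded_iff by metis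
    have "integrable P (\<rho>_chart i)"
      by (rule finP.integrable_const_bound[OF AE_I2 continuous_measurable_P[OF continuous_on_subset[OF cont_\<rho>_chart ab(2)]], where B=D])
         (use D S(2) in \<open>auto simp: space_P\<close>)
    moreover have "integrable P (\<lambda>t. \<rho> i (\<gamma> t)) \<longleftrightarrow> integrable P (\<rho>_chart i)"
      by (rule Bochner_Integration.integrable_cong[OF refl]) (rule eq)
    ultimately show "set_integrable A B (\<rho> i)"
      unfolding integral_piece(1)[OF \<rho>_measurable] by blast
    show "(LINT u:B|A. \<rho> i u) = (LINT t|P. \<rho>_chart i t)"
      unfolding integral_piece(2)[OF \<rho>_measurable] by (rule Bochner_Integration.integral_cong[OF refl]) (rule eq)
  qed
  define \<phi> where "\<phi> = (\<lambda>i s. 2 * coeff_integral (2 * i) s * of_real \<epsilon> powr (s - 1 + of_nat (2 * i)))"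
  have \<phi>: "\<phi> i holomorphic_on half_plane" for i
    unfolding \<phi>_def using \<epsilon>(1) by (auto intro!: holomorphic_intros coeff_integral_holomorphic)
  have \<phi>_pole: "\<phi> i (pole i) = of_real (LINT u:B|A. \<rho> i u)" if "i < 4" for i
  proof -
    have "\<phi> i (pole i) = 2 * coeff_integral (2 * i) (pole i)" using \<epsilon>(1) by (simp add: \<phi>_def pole_def)
    also have "\<dots> = (LINT t|P. 2 * coeff_at (2 * i) (pole i) t)" unfolding coeff_integral_def by simp
    also have "\<dots> = (LINT t|P. of_real (\<rho>_chart i t))"
      by (rule Bochner_Integration.integral_cong) (use coeff_at_pole[OF that] S(3) in \<open>auto simp: space_P\<close>)
    finally show ?thesis by (simp add: \<rho>)
  qed
  have "continues_with_residues (\<lambda>s. (far_integral s + remainder_integral s) + (\<Sum>i<4. \<phi> i s / (s - pole i)))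
     (\<lambda>j. 0 + (\<Sum>i<4. if j = i then \<phi> i (pole i) else 0))"
    by (intro continues_with_residues_add continues_with_residues_sum continues_with_residues_simple_pole
        continues_with_residues_holomorphic holomorphic_on_add far_integral_holomorphic remainder_integral_holomorphic \<phi>) auto
  hence "continues_with_residues (\<lambda>s. LINT u:B|A. J s u) (\<lambda>i. of_real (LINT u:B|A. \<rho> i u))"
  proof (rule continues_with_residues_cong)
    fix s assume s: "Re s > 2"
    have "(\<Sum>j<8. coeff_integral j s * \<mu> j s) = (\<Sum>i<4. coeff_integral (2 * i) s * \<mu> (2 * i) s)"
    proof -
      have "{..<8::nat} = {0,1,2,3,4,5,6,7}" "{..<4::nat} = {0,1,2,3}" by auto
      moreover have "\<mu> 1 s = 0" "\<mu> 3 s = 0" "\<mu> 5 s = 0" "\<mu> 7 s = 0" by (simp_all add: \<mu>_def)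
      ultimately show ?thesis by simp
    qed
    also have "\<dots> = (\<Sum>i<4. \<phi> i s / (s - pole i))"
      by (rule sum.cong) (auto simp: \<mu>_def \<phi>_def pole_def algebra_simps)
    finally show "far_integral s + remainder_integral s + (\<Sum>i<4. \<phi> i s / (s - pole i)) = (LINT u:B|A. J s u)"
      unfolding integral_J(2)[OF s] by simp
  qed (auto simp: \<phi>_pole)
  thus ?thesis unfolding good_piece_def using integral_J(1) \<rho>(1) by blast
qed

end

lemma (in curve_piece) good_piece_arc: "good_piece B"
proof -
  obtain e where e: "e > 0" "{a - e..b + e} \<subseteq> I" "\<And>t h. \<lbrakk>t \<in> {a..b}; 0 < \<bar>h\<bar>; \<bar>h\<bar> < e\<rbrakk> \<Longrightarrow> \<bar>g t h - 1\<bar> \<le> 1/2"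
    by (rule g_close_to_1) blast
  \<comment> \<open>A radius at most \<open>1\<close> gives \<open>\<bar>h\<bar> powr z\<close> norm at most \<open>1\<close> whenever \<open>Re z \<ge> 0\<close>.\<close>
  define \<epsilon> where "\<epsilon> = min e 1"
  have "{a - \<epsilon>..b + \<epsilon>} \<subseteq> {a - e..b + e}" by (auto simp: \<epsilon>_def)
  with e(2) have sub: "{a - \<epsilon>..b + \<epsilon>} \<subseteq> I" by blast
  interpret curve_piece_radius M \<nu> A I \<gamma> a b B \<epsilon>
    by unfold_locales (use e sub in \<open>auto simp: \<epsilon>_def\<close>)
  show ?thesis by (rule good_piece_B)
qed

lemma (in measured_curve) good_piece_M: "good_piece M"
proof (rule additive_induct[where P=good_piece])
  fix E B assume E: "is_arc E" "B \<in> sets A" "B \<subseteq> E"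
  obtain I \<gamma> a b where *: "unit_speed_param M I \<gamma>" "a \<le> b" "{a..b} \<subseteq> I" "E = \<gamma> ` {a..b}"
    using E(1) unfolding is_arc_def by blast
  interpret curve_piece M \<nu> A I \<gamma> a b B
    by unfold_locales (use * E \<nu> in auto)
  show "good_piece B" by (rule good_piece_arc)
qed (rule good_piece_Un)

theorem theorem4p1:
  fixes M :: "(real^2) set"
    and A :: "(real^2) measure"
    and \<nu> :: "real^2 \<Rightarrow> real^2"
    and B :: "complex \<Rightarrow> complex"
    and \<kappa> :: "nat \<Rightarrow> real^2 \<Rightarrow> real"
  assumes "compact_smooth_curve M"
    and "arclength_measure M A"
    and "outward_unit_normal M \<nu>"
    and "double_layer_beta A \<nu> B"
    and "\<kappa> = curvature_deriv M \<nu>"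
  shows "residue B 1 = complex_of_real (- 2 * measure A M) \<and>
         residue B (-1) = complex_of_real (LINT p|A. 3/4 * (\<kappa> 0 p)^2) \<and>
         residue B (-3) = complex_of_real (LINT p|A.
           45/64 * (\<kappa> 0 p)^4 + 5/4 * (\<kappa> 1 p)^2 + 15/8 * \<kappa> 0 p * \<kappa> 2 p) \<and>
         residue B (-5) = complex_of_real (LINT p|A.
           175/512 * (\<kappa> 0 p)^6 + 1295/288 * (\<kappa> 0 p)^2 * (\<kappa> 1 p)^2
           + 1085/576 * (\<kappa> 0 p)^3 * \<kappa> 2 p + 175/576 * (\<kappa> 2 p)^2
           + 35/72 * \<kappa> 1 p * \<kappa> 3 p + 35/144 * \<kappa> 0 p * \<kappa> 4 p)"
proof -
  interpret measured_curve M \<nu> A by unfold_locales fact+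
  have int: "(LINT u:M|A. \<rho> i u) = (LINT u|A. \<rho> i u)" for i
    unfolding set_lebesgue_integral_def by (rule Bochner_Integration.integral_cong) auto
  have "continues_with_residues B (\<lambda>i. of_real (LINT u:M|A. \<rho> i u))"
    using good_piece_M assms(4)
    by (auto simp: good_piece_def double_layer_beta_def double_layer_integral_eq intro: continues_with_residues_cong)
  with assms(4) have r: "residue B (pole i) = of_real (LINT u|A. \<rho> i u)" if "i < 4" for i
    using residue_of_continuation[OF _ _ that] by (simp add: double_layer_beta_def int)
  have "\<rho> 0 = (\<lambda>p. -2)" by (simp add: \<rho>_def fun_eq_iff)
  hence "(LINT u|A. \<rho> 0 u) = - 2 * measure A M" by simp
  with r[of 0] r[of 1] r[of 2] r[of 3] show ?thesis
    unfolding assms(5) by (simp add: pole_def \<rho>_def[abs_def] Let_def)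
qed

end
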